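(* Let $G$ be of type $B_n$, $\mathbf{i}_0=(1\,2\cdots n)^n$ and $c=(c^{(m)}_i)_{1\le i,m\le n}\in(\mathbb{C}^\times)^{n^2}$. Let $m^{(k)}_i:B(\Lambda_i)\hookrightarrow\mathcal{Y}(p_0)$ be the embedding of crystals sending the highest weight element $u_{\Lambda_i}$ to the monomial $c^{(k)}_i$. Then $$\Delta_{w_0\Lambda_n,s_n\Lambda_n}(\Theta^-_{\mathbf{i}_0}(c))=m^{(n)}_n(u_{\Lambda_n})\;(=c^{(n)}_n),$$ and for $k=1,2,\dots,n-1$, $$\Delta_{w_0\Lambda_k,s_k\Lambda_k}(\Theta^-_{\mathbf{i}_0}(c))=\sum_{j=1}^n m^{(k)}_1(v_j)+2m^{(k)}_1(v_0)+\sum_{j=k+1}^n m^{(k)}_1(v_{\overline{j}}),$$ $$\Delta_{w_0s_k\Lambda_k,\Lambda_k}(\Theta^-_{\mathbf{i}_0}(c))=\sum_{j=1}^k m^{(k-n)}_1(v_{\overline{j}}).$$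
   Context: Group side. $G$ is the simply connected simple algebraic group over $\mathbb{C}$ of type $B_n$ ($n\ge2$), $I=\{1,\dots,n\}$, with Chevalley generators $e_i,f_i,h_i$, simple roots $\alpha_i$, fundamental weights $\Lambda_i$, Cartan matrix $a_{ij}=\alpha_j(h_i)$: $a_{ii}=2$, $a_{n,n-1}=-2$, $a_{ij}=-1$ for other $|i-j|=1$, $0$ otherwise. $T$ is the maximal torus, $U^{\pm}$ the unipotent subgroups generated by $x_i(t)=\exp(te_i)$, resp. $y_i(t)=\exp(tf_i)$; $\alpha_i^\vee$ is the coroot one-parameter subgroup; $s_i$ are the simple reflections, $w_0$ the longest Weyl group element. $\overline{s}_i=x_i(-1)y_i(1)x_i(-1)$ and $\overline{w}=\overline{s}_{i_1}\cdots\overline{s}_{i_l}$ for any reduced expression $w=s_{i_1}\cdots s_{i_l}$. $\Delta_{\Lambda_i}$ is the regular function on $G$ with $\Delta_{\Lambda_i}(u^-tu^+)=\Lambda_i(t)$ ($u^\pm\in U^\pm$, $t\in T$), and $\Delta_{u\Lambda_i,v\Lambda_i}(g)=\Delta_{\Lambda_i}(\overline{u}^{-1}g\,\overline{v})$ for Weyl group elements $u,v$. With $\mathbf{y}_i(c)=y_i(c)\alpha_i^\vee(c^{-1})$, $\Theta^-_{\mathbf{i}_0}(c)=\prod_{m=1}^{n}\mathbf{y}_1(c^{(m)}_1)\cdots\mathbf{y}_n(c^{(m)}_n)$ (factors for $m=1,\dots,n$ from left to right). Monomial crystals. $\mathcal{Y}$ is the set of Laurent monomials $Y=\prod_{m\in\mathbb{Z},i\in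 I}(c^{(m)}_i)^{l_{m,i}}$ in variables $c_i^{(m)}$, with only finitely many $l_{m,i}\in\mathbb{Z}$ nonzero. For a sign $p=(p_{i,j})_{i\ne j}$ (integers with $p_{i,j}+p_{j,i}=1$) put $A_{m,i}=c^{(m)}_ic^{(m+1)}_i\prod_{j\ne i}(c^{(m+p_{j,i})}_j)^{a_{j,i}}$. The crystal $\mathcal{Y}(p)$ is $\mathcal{Y}$ with $\mathrm{wt}(Y)=\sum l_{m,i}\Lambda_i$, $\varphi_i(Y)=\max_m\sum_{k\le m}l_{k,i}$, $\varepsilon_i(Y)=\varphi_i(Y)-\langle h_i,\mathrm{wt}(Y)\rangle$, $\tilde f_iY=A_{n_f,i}^{-1}Y$ if $\varphi_i(Y)>0$ and $0$ otherwise, $\tilde e_iY=A_{n_e,i}Y$ if $\varepsilon_i(Y)>0$ and $0$ otherwise, where $n_f=\min\{n:\varphi_i(Y)=\sum_{k\le n}l_{k,i}\}$, $n_e=\max\{n:\varphi_i(Y)=\sum_{k\le n}l_{k,i}\}$. Known: the connected component of a monomial $Y$ with all $\varepsilon_i(Y)=0$ is isomorphic to the crystal $B(\mathrm{wt}(Y))$ of the irreducible highest weight module. Here $p_0$ is the sign with $p_{i,j}=1$ if $i<j$ and $p_{i,j}=0$ if $i>j$. The crystal $B(\Lambda_1)=\{v_i,v_{\overline{i}}\mid1\le i\le n\}\sqcup\{v_0\}$ has $u_{\Lambda_1}=v_1$ and arrows $\tilde f_iv_i=v_{i+1}$, $\tilde f_iv_{\overline{i+1}}=v_{\overline{i}}$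 ($1\le i<n$), $\tilde f_nv_n=v_0$, $\tilde f_nv_0=v_{\overline{n}}$ (all other $\tilde f_i$ are $0$). Explicitly, with $c_0^{(m)}=1$: $m^{(k)}_1(v_j)=(c^{(k)}_j)^{1+\delta_{j,n}}/c^{(k+1)}_{j-1}$, $m^{(k)}_1(v_0)=c^{(k)}_n/c^{(k+1)}_n$, $m^{(k)}_1(v_{\overline{j}})=c^{(k+n-j+1)}_{j-1}/(c^{(k+n-j+1)}_{j})^{1+\delta_{j,n}}$. Monomials are evaluated at the given $c$. *)

theory Defs
  imports
    "HOL-Analysis.Analysis"
    "HOL-Algebra.Generated_Groups"
    "HOL-Library.Poly_Mapping"
begin

section \<open>The root datum of type B\<close>

text \<open>\<open>cartan_B n i j\<close> is \<open>\<langle>h\<^sub>i, \<alpha>\<^sub>j\<rangle>\<close>, for \<open>i, j \<in> {1..n}\<close>.\<close>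

definition cartan_B :: "nat \<Rightarrow> nat \<Rightarrow> nat \<Rightarrow> int" where
  "cartan_B n i j =
     (if i = j then 2
      else if i = n \<and> j + 1 = n then -2
      else if j = i + 1 \<or> i = j + 1 then -1
      else 0)"

text \<open>A weight \<open>\<mu>\<close> is given by its coordinates \<open>\<mu> j = \<langle>h\<^sub>j, \<mu>\<rangle>\<close> in the basis of fundamental weights;
  only \<open>j \<in> {1..n}\<close> is relevant, and the other coordinates are left alone by the reflections
  \<open>s\<^sub>i \<mu> = \<mu> - \<langle>h\<^sub>i, \<mu>\<rangle> \<alpha>\<^sub>i\<close>.  The Weyl group is realised by its faithful action on weights.\<close>

definition simple_refl :: "nat \<Rightarrow> nat \<Rightarrow> (nat \<Rightarrow> int) \<Rightarrow> (nat \<Rightarrow> int)" where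
  "simple_refl n i \<mu> = (\<lambda>j. if j \<in> {1..n} then \<mu> j - \<mu> i * cartan_B n j i else \<mu> j)"

definition weyl_word :: "nat \<Rightarrow> nat list \<Rightarrow> (nat \<Rightarrow> int) \<Rightarrow> (nat \<Rightarrow> int)" where
  "weyl_word n r = foldr (\<circ>) (map (simple_refl n) r) id"

definition weyl_group :: "nat \<Rightarrow> ((nat \<Rightarrow> int) \<Rightarrow> (nat \<Rightarrow> int)) set" where
  "weyl_group n = weyl_word n ` lists {1..n}"

definition weyl_length :: "nat \<Rightarrow> ((nat \<Rightarrow> int) \<Rightarrow> (nat \<Rightarrow> int)) \<Rightarrow> nat" where
  "weyl_length n w = (LEAST l. \<exists>r \<in> lists {1..n}. weyl_word n r = w \<and> length r = l)"

definition reduced_expression :: "nat \<Rightarrow> ((nat \<Rightarrow> int) \<Rightarrow> (nat \<Rightarrow> int)) \<Rightarrow> nat list \<Rightarrow> bool" where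
  "reduced_expression n w r \<longleftrightarrow>
     r \<in> lists {1..n} \<and> weyl_word n r = w \<and> length r = weyl_length n w"

definition longest_elt :: "nat \<Rightarrow> (nat \<Rightarrow> int) \<Rightarrow> (nat \<Rightarrow> int)" where
  "longest_elt n =
     (THE w. w \<in> weyl_group n \<and> (\<forall>v \<in> weyl_group n. weyl_length n v \<le> weyl_length n w))"


section \<open>The simply connected group of type B\<close>

text \<open>Complex scalars act on square matrices through \<open>mat t ** A = t A\<close>.\<close>

definition mexp :: "complex^'N^'N \<Rightarrow> complex^'N^'N" where
  "mexp A = suminf (\<lambda>k. (1 / fact k) *\<^sub>R (((**) A ^^ k) (mat 1)))"

definition mprod :: "(complex^'N^'N) list \<Rightarrow> complex^'N^'N" where
  "mprod As = foldr (**) As (mat 1)"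

definition lie_bracket :: "complex^'N^'N \<Rightarrow> complex^'N^'N \<Rightarrow> complex^'N^'N" where
  "lie_bracket A B = A ** B - B ** A"

text \<open>Matrices satisfying the Chevalley--Serre relations of type \<open>B\<^sub>n\<close>: by Serre's theorem this is
  the same as a finite-dimensional representation of the simple Lie algebra of type \<open>B\<^sub>n\<close>.\<close>

definition chevalley_serre_B ::
    "nat \<Rightarrow> (nat \<Rightarrow> complex^'N^'N) \<Rightarrow> (nat \<Rightarrow> complex^'N^'N) \<Rightarrow> (nat \<Rightarrow> complex^'N^'N) \<Rightarrow> bool" where
  "chevalley_serre_B n e f h \<longleftrightarrow>
     (\<forall>i\<in>{1..n}. \<forall>j\<in>{1..n}.
        lie_bracket (h i) (h j) = 0 \<and>
        lie_bracket (h i) (e j) = mat (of_int (cartan_B n i j)) ** e j \<and>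
        lie_bracket (h i) (f j) = - (mat (of_int (cartan_B n i j)) ** f j) \<and>
        lie_bracket (e i) (f j) = (if i = j then h i else 0) \<and>
        (i \<noteq> j \<longrightarrow>
           (lie_bracket (e i) ^^ nat (1 - cartan_B n i j)) (e j) = 0 \<and>
           (lie_bracket (f i) ^^ nat (1 - cartan_B n i j)) (f j) = 0))"

text \<open>\<open>one_param a i\<close> is \<open>x\<^sub>i\<close> for \<open>a = e\<close> and \<open>y\<^sub>i\<close> for \<open>a = f\<close>.\<close>

definition one_param :: "(nat \<Rightarrow> complex^'N^'N) \<Rightarrow> nat \<Rightarrow> complex \<Rightarrow> complex^'N^'N" where
  "one_param a i t = mexp (mat t ** a i)"

text \<open>\<open>\<alpha>\<^sub>i\<^sup>\<or>(exp z) = exp (z h\<^sub>i)\<close>; as \<open>h\<^sub>i\<close> is diagonalisable with integer eigenvalues, the choice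
  of the logarithm is immaterial.\<close>

definition coroot_subgroup :: "(nat \<Rightarrow> complex^'N^'N) \<Rightarrow> nat \<Rightarrow> complex \<Rightarrow> complex^'N^'N" where
  "coroot_subgroup h i t = mexp (mat (Ln t) ** h i)"

definition torus_elt :: "nat \<Rightarrow> (nat \<Rightarrow> complex^'N^'N) \<Rightarrow> (nat \<Rightarrow> complex) \<Rightarrow> complex^'N^'N" where
  "torus_elt n h t = mprod (map (\<lambda>i. coroot_subgroup h i (t i)) [1..<n+1])"

definition GL :: "(complex^'N^'N) monoid" where
  "GL = \<lparr>carrier = {A. invertible A}, mult = (**), one = mat 1\<rparr>"

definition chevalley_group ::
    "nat \<Rightarrow> (nat \<Rightarrow> complex^'N^'N) \<Rightarrow> (nat \<Rightarrow> complex^'N^'N) \<Rightarrow> (complex^'N^'N) set" where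
  "chevalley_group n e f =
     generate GL (\<Union>i\<in>{1..n}. range (one_param e i) \<union> range (one_param f i))"

text \<open>\<open>unipotent_subgroup n e\<close> is \<open>U\<^sup>+\<close> and \<open>unipotent_subgroup n f\<close> is \<open>U\<^sup>-\<close>.\<close>

definition unipotent_subgroup :: "nat \<Rightarrow> (nat \<Rightarrow> complex^'N^'N) \<Rightarrow> (complex^'N^'N) set" where
  "unipotent_subgroup n a = generate GL (\<Union>i\<in>{1..n}. range (one_param a i))"

text \<open>The simply connected group of type \<open>B\<^sub>n\<close>, realised as a linear group by an arbitrary faithful
  finite-dimensional representation: \<open>chevalley_group n e f\<close>, a closed connected subgroup of the
  general linear group.  It is simply connected iff the cocharacter lattice of its maximal torus \<open>T\<close>
  (the set of all \<open>torus_elt n h t\<close>) is spanned by the coroots, i.e. iff the surjection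
  \<open>(\<complex>\<^sup>\<times>)\<^sup>n \<rightarrow> T\<close>, \<open>t \<mapsto> \<Prod>\<^sub>i \<alpha>\<^sub>i\<^sup>\<or>(t\<^sub>i)\<close>, is injective.\<close>

definition simply_connected_B ::
    "nat \<Rightarrow> (nat \<Rightarrow> complex^'N^'N) \<Rightarrow> (nat \<Rightarrow> complex^'N^'N) \<Rightarrow> (nat \<Rightarrow> complex^'N^'N) \<Rightarrow> bool" where
  "simply_connected_B n e f h \<longleftrightarrow>
     chevalley_serre_B n e f h \<and> inj_on (torus_elt n h) ({1..n} \<rightarrow>\<^sub>E - {0})"

text \<open>The coordinate ring of the general linear group: polynomials in the matrix entries and
  the inverse of the determinant.\<close>

inductive regular_GL :: "(complex^'N^'N \<Rightarrow> complex) \<Rightarrow> bool" where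
  entry: "regular_GL (\<lambda>A. A $ i $ j)"
| det_inverse: "regular_GL (\<lambda>A. inverse (det A))"
| const: "regular_GL (\<lambda>A. a)"
| add: "regular_GL p \<Longrightarrow> regular_GL q \<Longrightarrow> regular_GL (\<lambda>A. p A + q A)"
| mult: "regular_GL p \<Longrightarrow> regular_GL q \<Longrightarrow> regular_GL (\<lambda>A. p A * q A)"

definition regular_on :: "(complex^'N^'N) set \<Rightarrow> (complex^'N^'N \<Rightarrow> complex) \<Rightarrow> bool" where
  "regular_on G D \<longleftrightarrow> (\<exists>p. regular_GL p \<and> (\<forall>g\<in>G. D g = p g))"

text \<open>\<open>D\<close> is \<open>\<Delta>\<^bsub>\<Lambda>\<^sub>i\<^esub>\<close>.  Since \<open>\<langle>h\<^sub>j, \<Lambda>\<^sub>i\<rangle> = \<delta>\<^sub>i\<^sub>j\<close>, the value \<open>\<Lambda>\<^sub>i(\<Prod>\<^sub>j \<alpha>\<^sub>j\<^sup>\<or>(t\<^sub>j))\<close> is \<open>t\<^sub>i\<close>.  This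
  determines \<open>D\<close> on the group, because \<open>U\<^sup>- T U\<^sup>+\<close> is dense.\<close>

definition principal_minor ::
    "nat \<Rightarrow> (nat \<Rightarrow> complex^'N^'N) \<Rightarrow> (nat \<Rightarrow> complex^'N^'N) \<Rightarrow> (nat \<Rightarrow> complex^'N^'N) \<Rightarrow>
     nat \<Rightarrow> (complex^'N^'N \<Rightarrow> complex) \<Rightarrow> bool" where
  "principal_minor n e f h i D \<longleftrightarrow>
     regular_on (chevalley_group n e f) D \<and>
     (\<forall>u \<in> unipotent_subgroup n f. \<forall>u' \<in> unipotent_subgroup n e. \<forall>t. (\<forall>j\<in>{1..n}. t j \<noteq> 0) \<longrightarrow>
        D (u ** torus_elt n h t ** u') = t i)"

definition refl_lift ::
    "(nat \<Rightarrow> complex^'N^'N) \<Rightarrow> (nat \<Rightarrow> complex^'N^'N) \<Rightarrow> nat \<Rightarrow> complex^'N^'N" where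
  "refl_lift e f i = one_param e i (-1) ** one_param f i 1 ** one_param e i (-1)"

text \<open>\<open>weyl_lift n e f w\<close> does not depend on the reduced expression chosen, by the braid relations.\<close>

definition weyl_lift ::
    "nat \<Rightarrow> (nat \<Rightarrow> complex^'N^'N) \<Rightarrow> (nat \<Rightarrow> complex^'N^'N) \<Rightarrow>
     ((nat \<Rightarrow> int) \<Rightarrow> (nat \<Rightarrow> int)) \<Rightarrow> complex^'N^'N" where
  "weyl_lift n e f w = mprod (map (refl_lift e f) (SOME r. reduced_expression n w r))"

text \<open>\<open>\<Delta>\<^bsub>u\<Lambda>\<^sub>i,v\<Lambda>\<^sub>i\<^esub>(g)\<close>, where \<open>D\<close> is \<open>\<Delta>\<^bsub>\<Lambda>\<^sub>i\<^esub>\<close>.\<close>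

definition gen_minor ::
    "nat \<Rightarrow> (nat \<Rightarrow> complex^'N^'N) \<Rightarrow> (nat \<Rightarrow> complex^'N^'N) \<Rightarrow> (complex^'N^'N \<Rightarrow> complex) \<Rightarrow>
     ((nat \<Rightarrow> int) \<Rightarrow> (nat \<Rightarrow> int)) \<Rightarrow> ((nat \<Rightarrow> int) \<Rightarrow> (nat \<Rightarrow> int)) \<Rightarrow>
     complex^'N^'N \<Rightarrow> complex" where
  "gen_minor n e f D u v g = D (matrix_inv (weyl_lift n e f u) ** g ** weyl_lift n e f v)"

definition bold_y ::
    "(nat \<Rightarrow> complex^'N^'N) \<Rightarrow> (nat \<Rightarrow> complex^'N^'N) \<Rightarrow> nat \<Rightarrow> complex \<Rightarrow> complex^'N^'N" where
  "bold_y f h i t = one_param f i t ** coroot_subgroup h i (inverse t)"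

text \<open>The variable \<open>c\<^sub>i\<^sup>(\<^sup>m\<^sup>)\<close> is written \<open>c m i\<close> throughout.\<close>

definition Theta_minus ::
    "nat \<Rightarrow> (nat \<Rightarrow> complex^'N^'N) \<Rightarrow> (nat \<Rightarrow> complex^'N^'N) \<Rightarrow> (int \<Rightarrow> nat \<Rightarrow> complex) \<Rightarrow>
     complex^'N^'N" where
  "Theta_minus n f h c =
     mprod (map (\<lambda>m. mprod (map (\<lambda>i. bold_y f h i (c m i)) [1..<n+1])) [1..int n])"


section \<open>Crystals\<close>

text \<open>The value \<open>0\<close> of a crystal operator is represented by \<open>None\<close>.\<close>

record 'b crystal =
  elts :: "'b set"
  wt :: "'b \<Rightarrow> nat \<Rightarrow> int"
  eps :: "nat \<Rightarrow> 'b \<Rightarrow> int"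
  phi :: "nat \<Rightarrow> 'b \<Rightarrow> int"
  e_op :: "nat \<Rightarrow> 'b \<Rightarrow> 'b option"
  f_op :: "nat \<Rightarrow> 'b \<Rightarrow> 'b option"

definition crystal_embedding :: "nat \<Rightarrow> 'b crystal \<Rightarrow> 'd crystal \<Rightarrow> ('b \<Rightarrow> 'd) \<Rightarrow> bool" where
  "crystal_embedding n B C \<psi> \<longleftrightarrow>
     \<psi> \<in> elts B \<rightarrow> elts C \<and> inj_on \<psi> (elts B) \<and>
     (\<forall>i\<in>{1..n}. \<forall>b \<in> elts B.
        wt C (\<psi> b) i = wt B b i \<and> eps C i (\<psi> b) = eps B i b \<and> phi C i (\<psi> b) = phi B i b \<and>
        (\<forall>b'. f_op B i b = Some b' \<longrightarrow> f_op C i (\<psi> b) = Some (\<psi> b')) \<and>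
        (\<forall>b'. e_op B i b = Some b' \<longrightarrow> e_op C i (\<psi> b) = Some (\<psi> b')))"

text \<open>A crystal \<open>B(\<lambda>)\<close> is determined by its arrows: \<open>\<phi>\<^sub>i(b)\<close> and \<open>\<epsilon>\<^sub>i(b)\<close> are the largest powers of
  \<open>f\<^sub>i\<close> and \<open>e\<^sub>i\<close> that do not annihilate \<open>b\<close>, and \<open>\<langle>h\<^sub>i, wt b\<rangle> = \<phi>\<^sub>i(b) - \<epsilon>\<^sub>i(b)\<close>.\<close>

definition string_length :: "('b \<Rightarrow> 'b option) \<Rightarrow> 'b \<Rightarrow> int" where
  "string_length g b = int (Max {k. ((\<lambda>x. Option.bind x g) ^^ k) (Some b) \<noteq> None})"

definition reverse_arrows :: "'b set \<Rightarrow> ('b \<Rightarrow> 'b option) \<Rightarrow> 'b \<Rightarrow> 'b option" where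
  "reverse_arrows B g b =
     (if \<exists>b'\<in>B. g b' = Some b then Some (THE b'. b' \<in> B \<and> g b' = Some b) else None)"

definition crystal_of_arrows :: "'b set \<Rightarrow> (nat \<Rightarrow> 'b \<Rightarrow> 'b option) \<Rightarrow> 'b crystal" where
  "crystal_of_arrows B g =
     (let er = (\<lambda>i. reverse_arrows B (g i)) in
      \<lparr>elts = B,
       wt = (\<lambda>b i. string_length (g i) b - string_length (er i) b),
       eps = (\<lambda>i. string_length (er i)),
       phi = (\<lambda>i. string_length (g i)),
       e_op = er,
       f_op = g\<rparr>)"

datatype vec_elt = V nat | V0 | Vbar nat

text \<open>The crystal \<open>B(\<Lambda>\<^sub>1)\<close>, with highest weight element \<open>V 1\<close>.\<close>

fun vec_arrow :: "nat \<Rightarrow> nat \<Rightarrow> vec_elt \<Rightarrow> vec_elt option" where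
  "vec_arrow n i (V j) = (if j = i then Some (if i = n then V0 else V (i + 1)) else None)"
| "vec_arrow n i V0 = (if i = n then Some (Vbar n) else None)"
| "vec_arrow n i (Vbar j) = (if j = i + 1 \<and> i < n then Some (Vbar i) else None)"

definition vec_crystal :: "nat \<Rightarrow> vec_elt crystal" where
  "vec_crystal n = crystal_of_arrows (V ` {1..n} \<union> {V0} \<union> Vbar ` {1..n}) (vec_arrow n)"

text \<open>The spin crystal \<open>B(\<Lambda>\<^sub>n)\<close> of Kashiwara and Nakashima.  Its elements are the sign vectors of
  length \<open>n\<close>; such a vector is represented by the set of positions of its minus signs, so that the
  highest weight element \<open>(+,\<dots>,+)\<close> is the empty set.  For \<open>i < n\<close>, \<open>f\<^sub>i\<close> turns \<open>(+,-)\<close> in the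
  positions \<open>i, i + 1\<close> into \<open>(-,+)\<close>, and \<open>f\<^sub>n\<close> turns \<open>+\<close> in position \<open>n\<close> into \<open>-\<close>.\<close>

definition spin_arrow :: "nat \<Rightarrow> nat \<Rightarrow> nat set \<Rightarrow> nat set option" where
  "spin_arrow n i S =
     (if i < n \<and> i \<notin> S \<and> i + 1 \<in> S then Some (insert i (S - {i + 1}))
      else if i = n \<and> n \<notin> S then Some (insert n S)
      else None)"

definition spin_crystal :: "nat \<Rightarrow> nat set crystal" where
  "spin_crystal n = crystal_of_arrows (Pow {1..n}) (spin_arrow n)"


section \<open>Monomial crystals\<close>

text \<open>A Laurent monomial in the variables \<open>c\<^sub>i\<^sup>(\<^sup>m\<^sup>)\<close> is represented by its exponents \<open>l\<^bsub>m,i\<^esub>\<close>, so the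
  product of monomials is written additively.\<close>

type_synonym monomial = "(int \<times> nat) \<Rightarrow>\<^sub>0 int"

definition var :: "int \<Rightarrow> nat \<Rightarrow> monomial" where
  "var m i = Poly_Mapping.single (m, i) 1"

definition is_sign :: "nat \<Rightarrow> (nat \<Rightarrow> nat \<Rightarrow> int) \<Rightarrow> bool" where
  "is_sign n p \<longleftrightarrow> (\<forall>i\<in>{1..n}. \<forall>j\<in>{1..n}. i \<noteq> j \<longrightarrow> p i j + p j i = 1)"

definition sign0 :: "nat \<Rightarrow> nat \<Rightarrow> int" where
  "sign0 i j = (if i < j then 1 else 0)"

lemma is_sign_sign0: "is_sign n sign0"
  by (auto simp: is_sign_def sign0_def)

definition mono_A :: "nat \<Rightarrow> (nat \<Rightarrow> nat \<Rightarrow> int) \<Rightarrow> int \<Rightarrow> nat \<Rightarrow> monomial" where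
  "mono_A n p m i =
     var m i + var (m + 1) i +
     (\<Sum>j \<in> {1..n} - {i}. Poly_Mapping.single (m + p j i, j) (cartan_B n j i))"

definition mono_wt :: "monomial \<Rightarrow> nat \<Rightarrow> int" where
  "mono_wt Y i = (\<Sum>k \<in> {k. (k, i) \<in> Poly_Mapping.keys Y}. Poly_Mapping.lookup Y (k, i))"

definition partial_wt :: "monomial \<Rightarrow> nat \<Rightarrow> int \<Rightarrow> int" where
  "partial_wt Y i m =
     (\<Sum>k \<in> {k. (k, i) \<in> Poly_Mapping.keys Y \<and> k \<le> m}. Poly_Mapping.lookup Y (k, i))"

definition mono_phi :: "nat \<Rightarrow> monomial \<Rightarrow> int" where
  "mono_phi i Y = Max (range (partial_wt Y i))"

definition mono_eps :: "nat \<Rightarrow> monomial \<Rightarrow> int" where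
  "mono_eps i Y = mono_phi i Y - mono_wt Y i"

definition mono_nf :: "nat \<Rightarrow> monomial \<Rightarrow> int" where
  "mono_nf i Y = (LEAST m. mono_phi i Y = partial_wt Y i m)"

definition mono_ne :: "nat \<Rightarrow> monomial \<Rightarrow> int" where
  "mono_ne i Y = (GREATEST m. mono_phi i Y = partial_wt Y i m)"

definition mono_crystal :: "nat \<Rightarrow> (nat \<Rightarrow> nat \<Rightarrow> int) \<Rightarrow> monomial crystal" where
  "mono_crystal n p =
     \<lparr>elts = {Y. Poly_Mapping.keys Y \<subseteq> UNIV \<times> {1..n}},
      wt = mono_wt,
      eps = mono_eps,
      phi = mono_phi,
      e_op = (\<lambda>i Y. if mono_eps i Y > 0 then Some (Y + mono_A n p (mono_ne i Y) i) else None),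
      f_op = (\<lambda>i Y. if mono_phi i Y > 0 then Some (Y - mono_A n p (mono_nf i Y) i) else None)\<rparr>"

definition mono_eval :: "(int \<Rightarrow> nat \<Rightarrow> complex) \<Rightarrow> monomial \<Rightarrow> complex" where
  "mono_eval c Y =
     (\<Prod>(m, i) \<in> Poly_Mapping.keys Y. c m i powi Poly_Mapping.lookup Y (m, i))"

end

theory Submission
  imports Defs "HOL-Complex_Analysis.Complex_Analysis"
begin

text \<open>
  Each factor \<open>y\<^sub>i(c) \<alpha>\<^sub>i\<^sup>\<or>(c\<^sup>-\<^sup>1)\<close> of \<open>\<Theta>\<^sup>-\<close> equals \<open>x\<^sub>i(c\<^sup>-\<^sup>1) s\<^sub>i x\<^sub>i(c)\<close>, so Bruhat multiplication along the
  reduced word \<open>(1 \<dots> n)\<^sup>n\<close> gives \<open>\<Theta>\<^sup>- = u w\<^sub>0 v\<close> with \<open>u, v \<in> U\<^sup>+\<close>.  The minors of the theorem are the values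
  at \<open>v\<close> and \<open>u\<close> (up to inversion) of the character \<open>\<chi>\<^sub>k\<close> of \<open>U\<^sup>+\<close> attached to \<open>\<alpha>\<^sub>k\<close>.  For \<open>k = n\<close> only the last
  factor contributes.  For \<open>k < n\<close>, \<open>\<chi>\<^sub>k\<close> is the coefficient of \<open>v\<^sub>k\<close> in \<open>g v\<^sub>k\<^sub>+\<^sub>1\<close> for the vector representation,
  which turns the minors into entries of an explicit matrix product.

  The vector representation is not constructed: its coefficients are translates of \<open>\<Delta>\<^bsub>\<Lambda>\<^sub>1\<^esub>\<close> by lifts of
  Weyl group elements.  They transform linearly under \<open>x\<^sub>i(t)\<close>, because such a translate is an entire
  function of \<open>t\<close> whose growth is bounded by its weight, hence a polynomial of degree at most two.
  Identities between regular functions are checked on the dense cell \<open>U\<^sup>- T U\<^sup>+\<close>; lifts of reduced words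
  are independent of the word by Matsumoto's theorem.
\<close>



section \<open>Exponentials in a complex Banach algebra\<close>

text \<open>The main device is contraction. For a cocharacter w, conjugation by
  \<open>tau r w\<close> with r tending to infinity takes x_i(t) to 1 if \<alpha>_i is negative on
  w, and y_i(t) to 1 if it is positive. A minor is continuous and invariant under conjugation by the
  torus, so it is 1 on everything contracted. Such limits stand in for root subgroups and weight
  spaces: positivity of a root is tested as the sign of an integer, the value of the root on a point
  of the Weyl orbit of \<rho>. The case k = n is separate because the character of \<alpha>_n is not
  a coefficient between extremal vectors of the vector representation: v_n and the barred v_n are
  joined through v_0, which is not extremal. For k < n the product is cut into its n blocks (1 ...
  n). The root \<alpha>_k belongs to a single letter of the reduced word; once the blocks beyond
  that letter are cut away, the remaining ones carry one basis vector to another along paths that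
  can be listed. The coefficient 2 arises because the SL_2 of \<alpha>_n acts on v_n, v_0 and the
  barred v_n as on its adjoint representation.\<close>

lemma (in monoid_mult) conj_mult: "g' * g = 1 \<Longrightarrow> (g * a * g') * (g * b * g') = g * (a * b) * g'"
  by (metis mult.assoc mult_1_left)

lemma (in monoid_mult) conj_power: "g' * g = 1 \<Longrightarrow> g * g' = 1 \<Longrightarrow> (g * a * g') ^ k = g * a ^ k * g'"
proof (induction k)
  case (Suc k)
  then show ?case by (simp add: conj_mult)
qed simp

definition comm :: "'a::ring \<Rightarrow> 'a \<Rightarrow> 'a" where "comm a b = a * b - b * a"

lemma comm_add_left: "comm (a + b) c = comm a c + comm b c"
  and comm_minus_left: "comm (- a) c = - comm a c"
  and comm_minus_right: "comm a (- c) = - comm a c"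
  and comm_diff_left: "comm (a - b) c = comm a c - comm b c"
  and comm_zero_right: "comm c 0 = 0"
  and comm_self: "comm a a = 0"
  by (auto simp: comm_def algebra_simps)

lemma comm_anti: "comm a b = - comm b a"
  by (simp add: comm_def)

lemma comm_jacobi: "comm a (comm b c) = comm (comm a b) c + comm b (comm a c)"
  by (simp add: comm_def algebra_simps)

lemma comm_eq_0_iff: "comm a b = 0 \<longleftrightarrow> a * b = b * a"
  by (auto simp: comm_def)

lemma exp_conj:
  fixes g :: "'a::{real_normed_algebra_1,banach}"
  assumes "g * g' = 1" "g' * g = 1"
  shows "g * exp A * g' = exp (g * A * g')"
proof -
  have "(\<lambda>k. g * (A ^ k /\<^sub>R fact k) * g') sums (g * exp A * g')"
    by (intro sums_mult sums_mult2 exp_converges)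
  moreover have "g * (A ^ k /\<^sub>R fact k) * g' = (g * A * g') ^ k /\<^sub>R fact k" for k
    using assms by (simp add: conj_power)
  ultimately show ?thesis
    using exp_converges[of "g * A * g'"] sums_unique2 by simp
qed

lemma tendsto_exp_at_0:
  assumes "((f :: 'b \<Rightarrow> 'a::{real_normed_algebra_1,banach}) \<longlongrightarrow> 0) F"
  shows "((\<lambda>t. exp (f t)) \<longlongrightarrow> 1) F"
proof -
  have bound: "norm (exp x - 1) \<le> exp (norm x) - 1" for x :: 'a
  proof -
    have s: "summable (\<lambda>n. norm x ^ Suc n /\<^sub>R fact (Suc n))"
      using summable_exp_generic[of "norm x"] by (subst summable_Suc_iff)
    have "exp x - 1 = suminf (\<lambda>n. x ^ Suc n /\<^sub>R fact (Suc n))"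
      using exp_first_term[of x] by (metis add_diff_cancel_left')
    then have "norm (exp x - 1) = norm (suminf (\<lambda>n. x ^ Suc n /\<^sub>R fact (Suc n)))"
      by (rule arg_cong)
    also have "\<dots> \<le> suminf (\<lambda>n. norm x ^ Suc n /\<^sub>R fact (Suc n))"
    proof (rule norm_suminf_le[OF _ s])
      fix n
      have "norm (x ^ Suc n /\<^sub>R fact (Suc n)) = norm (x ^ Suc n) / fact (Suc n)"
        by (simp only: norm_scaleR abs_inverse abs_of_pos[OF fact_gt_zero] divide_inverse mult.commute)
      also have "\<dots> \<le> norm x ^ Suc n / fact (Suc n)"
        by (intro divide_right_mono norm_power_ineq) (simp del: fact_Suc)
      finally show "norm (x ^ Suc n /\<^sub>R fact (Suc n)) \<le> norm x ^ Suc n /\<^sub>R fact (Suc n)"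
        by (simp only: real_scaleR_def divide_inverse mult.commute)
    qed
    also have "\<dots> = exp (norm x) - 1"
      using exp_first_term[of "norm x"] by linarith
    finally show ?thesis .
  qed
  have "((\<lambda>t. exp (norm (f t)) - 1) \<longlongrightarrow> exp 0 - 1) F"
    using assms by (intro tendsto_intros tendsto_norm_zero)
  then have l: "((\<lambda>t. exp (norm (f t)) - 1) \<longlongrightarrow> 0) F"
    by simp
  have "((\<lambda>t. exp (f t) - 1) \<longlongrightarrow> 0) F"
    by (rule Lim_null_comparison[OF _ l]) (simp add: bound)
  then show ?thesis by (simp add: LIM_zero_iff)
qed

lemma exp_inverse_right: "exp (A::'a::{real_normed_algebra_1,banach}) * exp (- A) = 1"
  by (simp flip: exp_add_commuting)

text \<open>P satisfies the differential equation of conjugation by exp(rA), so exp(-rA) P(r)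
  exp(rA) has derivative 0. The conjugation formulas below are proved by guessing P.\<close>

lemma exp_conj_ode:
  fixes A :: "'a::{real_normed_algebra_1,banach}"
  assumes P: "\<And>r. (P has_vector_derivative P' r) (at r)"
    and ode: "\<And>r. P' r = A * P r - P r * A"
  shows "exp A * P 0 * exp (- A) = P 1"
proof -
  define F where "F r = exp (r *\<^sub>R (- A)) * P r * exp (r *\<^sub>R A)" for r
  have "(F has_vector_derivative 0) (at r)" for r
    unfolding F_def
    by (rule has_vector_derivative_eq_rhs, rule has_vector_derivative_mult[OF has_vector_derivative_mult[OF
          exp_scaleR_has_vector_derivative_right P] exp_scaleR_has_vector_derivative_left])
       (simp add: ode algebra_simps)
  then have "F constant_on UNIV"
    using has_vector_derivative_zero_constant[of UNIV F]
    by (metis UNIV_I constant_on_def convex_UNIV has_vector_derivative_at_within)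
  then have "F 0 = F 1"
    by (auto simp: constant_on_def)
  then have "P 0 = exp (- A) * P 1 * exp A"
    by (simp add: F_def)
  then show ?thesis
    by (metis (no_types, lifting) exp_inverse_right mult.assoc mult.left_neutral mult.right_neutral)
qed

text \<open>The series of exp(ad A) applied to \<open>B0\<close> stops after its quadratic
  term.\<close>

lemma exp_conj_string:
  fixes A :: "'a::{real_normed_algebra_1,banach}"
  assumes "comm A B0 = B1" "comm A B1 = B2" "comm A B2 = 0"
  shows "exp A * B0 * exp (- A) = B0 + B1 + (1/2) *\<^sub>R B2"
proof -
  define P where "P r = B0 + r *\<^sub>R B1 + (r^2/2) *\<^sub>R B2" for r :: real
  have "exp A * P 0 * exp (- A) = P 1"
  proof (rule exp_conj_ode)
    show "(P has_vector_derivative (B1 + r *\<^sub>R B2)) (at r)" for r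
      unfolding P_def by (auto intro!: derivative_eq_intros simp: algebra_simps)
    show "B1 + r *\<^sub>R B2 = A * P r - P r * A" for r
      using assms by (auto simp: P_def comm_def algebra_simps)
  qed
  then show ?thesis by (simp add: P_def)
qed

text \<open>The type class provides real scalars only; complex scalars enter as an operation
  \<open>scl\<close> that extends them and commutes with products.\<close>

locale complex_banach_algebra =
  fixes scl :: "complex \<Rightarrow> 'a::{real_normed_algebra_1,banach} \<Rightarrow> 'a" (infixr "*\<^sub>C" 75)
  assumes scl_add_right: "z *\<^sub>C (x + y) = z *\<^sub>C x + z *\<^sub>C y"
    and scl_add_left: "(z + w) *\<^sub>C x = z *\<^sub>C x + w *\<^sub>C x"
    and scl_scl [simp]: "z *\<^sub>C w *\<^sub>C x = (z * w) *\<^sub>C x"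
    and scl_mult_left [simp]: "(z *\<^sub>C x) * y = z *\<^sub>C (x * y)"
    and scl_mult_right [simp]: "x * (z *\<^sub>C y) = z *\<^sub>C (x * y)"
    and scl_of_real: "of_real r *\<^sub>C x = r *\<^sub>R x"
begin

lemma scl_one [simp]: "1 *\<^sub>C x = x"
  using scl_of_real[of 1] by simp

lemma scl_zero_left [simp]: "0 *\<^sub>C x = 0"
  using scl_of_real[of 0] by simp

lemma scl_zero_right [simp]: "z *\<^sub>C 0 = 0"
  using scl_add_right[of z 0 0] by simp

lemma scl_minus_right [simp]: "z *\<^sub>C (- x) = - (z *\<^sub>C x)"
  using scl_add_right[of z x "- x"] by (simp add: add_eq_0_iff)

lemma scl_minus_left [simp]: "(- z) *\<^sub>C x = - (z *\<^sub>C x)"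
  using scl_add_left[of z "- z" x] by (simp add: add_eq_0_iff)

lemma scl_diff_right: "z *\<^sub>C (x - y) = z *\<^sub>C x - z *\<^sub>C y"
  using scl_add_right[of z x "- y"] by simp

lemma scl_diff_left: "(z - w) *\<^sub>C x = z *\<^sub>C x - w *\<^sub>C x"
  using scl_add_left[of z "- w" x] by simp

lemma scl_scaleR [simp]: "r *\<^sub>R z *\<^sub>C x = (of_real r * z) *\<^sub>C x"
  using scl_of_real by (metis scl_scl)

lemma scl_sum_left: "(\<Sum>i\<in>S. z i) *\<^sub>C x = (\<Sum>i\<in>S. z i *\<^sub>C x)"
  by (induction S rule: infinite_finite_induct) (auto simp: scl_add_left)

lemma comm_scl_left [simp]: "comm (z *\<^sub>C x) y = z *\<^sub>C comm x y"
  and comm_scl_right [simp]: "comm x (z *\<^sub>C y) = z *\<^sub>C comm x y"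
  by (simp_all add: comm_def scl_diff_right)

lemma scl_conj: "g * (z *\<^sub>C x) * g' = z *\<^sub>C (g * x * g')"
  by simp

lemma scl_decompose: "z *\<^sub>C x = Re z *\<^sub>R x + Im z *\<^sub>R (\<i> *\<^sub>C x)"
proof -
  have "z *\<^sub>C x = (of_real (Re z) + of_real (Im z) * \<i>) *\<^sub>C x"
    by (metis complex_eq mult.commute)
  also have "\<dots> = of_real (Re z) *\<^sub>C x + of_real (Im z) *\<^sub>C (\<i> *\<^sub>C x)"
    by (simp only: scl_add_left scl_scl)
  finally show ?thesis by (simp only: scl_of_real)
qed

lemma bounded_linear_scl: "bounded_linear (\<lambda>z. z *\<^sub>C x)"
proof -
  have "(\<lambda>z. z *\<^sub>C x) = (\<lambda>z. Re z *\<^sub>R x + Im z *\<^sub>R (\<i> *\<^sub>C x))"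
    by (rule ext, rule scl_decompose)
  then show ?thesis
    by (simp only:) (intro bounded_linear_add bounded_linear_compose[OF bounded_linear_scaleR_left]
        bounded_linear_Re bounded_linear_Im)
qed

lemmas tendsto_scl [tendsto_intros] = bounded_linear.tendsto[OF bounded_linear_scl]

definition ep :: "'a \<Rightarrow> complex \<Rightarrow> 'a" where "ep A t = exp (t *\<^sub>C A)"

lemma ep_zero [simp]: "ep A 0 = 1"
  by (simp add: ep_def)

lemma ep_add: "ep A s * ep A t = ep A (s + t)"
  unfolding ep_def by (subst exp_add_commuting [symmetric]) (simp_all add: scl_add_left mult_ac)

lemma ep_add_assoc: "ep A s * (ep A t * z) = ep A (s + t) * z"
  by (metis ep_add mult.assoc)

lemma ep_inv [simp]: "ep A t * ep A (- t) = 1" "ep A (- t) * ep A t = 1"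
  by (simp_all add: ep_add)

lemma ep_inv_assoc [simp]: "ep A t * (ep A (- t) * z) = z" "ep A (- t) * (ep A t * z) = z"
  by (simp_all add: ep_add_assoc)

lemma ep_neg: "ep (- A) t = ep A (- t)"
  by (simp add: ep_def)

lemma ep_scl: "ep (z *\<^sub>C A) t = ep A (z * t)"
  by (simp add: ep_def mult_ac)

lemma ep_conj: "g * g' = 1 \<Longrightarrow> g' * g = 1 \<Longrightarrow> g * ep A t * g' = ep (g * A * g') t"
  by (simp add: ep_def exp_conj)

lemma ep_sum: "comm A B = 0 \<Longrightarrow> ep (A + B) t = ep A t * ep B t"
  unfolding ep_def scl_add_right
  by (subst exp_add_commuting) (simp_all add: comm_eq_0_iff mult_ac)

lemma ep_comm: "comm A B = 0 \<Longrightarrow> ep A s * ep B t = ep B t * ep A s"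
  unfolding ep_def
  by (metis (no_types, lifting) add.commute comm_eq_0_iff comm_scl_left comm_scl_right exp_add_commuting scl_zero_right)

lemma ep_commute_elt: "comm A B = 0 \<Longrightarrow> ep A t * B * ep A (- t) = B"
proof -
  assume "comm A B = 0"
  then have "exp (t *\<^sub>C A) * B * exp (- (t *\<^sub>C A)) = B"
    by (subst exp_conj_string[where ?B1.0 = 0 and ?B2.0 = 0]) (auto simp: comm_zero_right)
  then show ?thesis by (simp add: ep_def)
qed

lemma ep_string:
  assumes "comm A B0 = B1" "comm A B1 = B2" "comm A B2 = 0"
  shows "ep A t * B0 * ep A (- t) = B0 + t *\<^sub>C B1 + (t^2/2) *\<^sub>C B2"
proof -
  have "exp (t *\<^sub>C A) * B0 * exp (- (t *\<^sub>C A)) = B0 + t *\<^sub>C B1 + (1/2) *\<^sub>R (t^2 *\<^sub>C B2)"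
    by (rule exp_conj_string) (simp_all add: assms power2_eq_square)
  then show ?thesis by (simp add: ep_def)
qed

text \<open>The complex time z is reached along the real path r z, so that the real differential
  equation of \<open>exp_conj_ode\<close> applies to A scaled by z.\<close>

lemma ep_eigen:
  assumes "comm A B = w *\<^sub>C B"
  shows "ep A z * B * ep A (- z) = exp (z * w) *\<^sub>C B"
proof -
  define P where "P r = exp (of_real r * (z * w)) *\<^sub>C B" for r :: real
  have "exp (z *\<^sub>C A) * P 0 * exp (- (z *\<^sub>C A)) = P 1"
  proof (rule exp_conj_ode)
    show "(P has_vector_derivative (exp (of_real r * (z * w)) * (z * w)) *\<^sub>C B) (at r)" for r
    proof -
      have e: "((\<lambda>r. exp (of_real r * (z * w))) has_vector_derivative (exp (of_real r * (z * w)) * (z * w))) (at r)"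
        by (rule has_vector_derivative_real_field[where f = "\<lambda>x. exp (x * (z * w))"]) (auto intro!: derivative_eq_intros)
      from bounded_linear.has_vector_derivative[OF bounded_linear_scl e, of B] show ?thesis
        by (simp add: P_def[abs_def])
    qed
    show "(exp (of_real r * (z * w)) * (z * w)) *\<^sub>C B = (z *\<^sub>C A) * P r - P r * (z *\<^sub>C A)" for r
    proof -
      have "(z *\<^sub>C A) * P r - P r * (z *\<^sub>C A) = comm (z *\<^sub>C A) (P r)" by (simp add: comm_def)
      also have "\<dots> = (z * exp (of_real r * (z * w)) * w) *\<^sub>C B" by (simp add: P_def assms mult_ac)
      finally show ?thesis by (simp add: mult_ac)
    qed
  qed
  then show ?thesis by (simp add: P_def ep_def)
qed

lemma tendsto_ep: "(f \<longlongrightarrow> a) F \<Longrightarrow> ((\<lambda>t. ep A (f t)) \<longlongrightarrow> ep A a) F"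
proof -
  assume f: "(f \<longlongrightarrow> a) F"
  have "((\<lambda>t. (f t - a) *\<^sub>C A) \<longlongrightarrow> 0) F"
    using tendsto_scl[OF tendsto_diff[OF f tendsto_const[of a]], of A] by simp
  then have "((\<lambda>t. exp ((f t - a) *\<^sub>C A)) \<longlongrightarrow> 1) F"
    by (rule tendsto_exp_at_0)
  then have "((\<lambda>t. ep A a * ep A (f t - a)) \<longlongrightarrow> ep A a * 1) F"
    unfolding ep_def by (intro tendsto_intros)
  then show ?thesis by (simp add: ep_add)
qed

end

section \<open>Identities in the SL_2 of a triple E, F, H\<close>

locale sl2_triple = complex_banach_algebra +
  fixes E F H :: 'a
  assumes HE: "comm H E = 2 *\<^sub>C E" and HF: "comm H F = - (2 *\<^sub>C F)" and EF: "comm E F = H"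
begin

definition s where "s = ep E (-1) * ep F 1 * ep E (-1)"
definition s' where "s' = ep E 1 * ep F (-1) * ep E 1"

lemma s_inv [simp]: "s * s' = 1" "s' * s = 1"
  by (simp_all add: s_def s'_def mult.assoc ep_add_assoc ep_add)

lemma s_inv_assoc [simp]: "s * (s' * z) = z" "s' * (s * z) = z"
  by (simp_all flip: mult.assoc)

lemma EH: "comm E H = - (2 *\<^sub>C E)" and FH: "comm F H = 2 *\<^sub>C F" and FE: "comm F E = - H"
  using HE HF EF by (metis comm_anti minus_minus)+

lemma conj_E_F: "ep E t * F * ep E (- t) = F + t *\<^sub>C H - t^2 *\<^sub>C E"
  by (subst ep_string[OF EF EH]) (simp_all add: comm_minus_right comm_self)

lemma conj_E_H: "ep E t * H * ep E (- t) = H - (2 * t) *\<^sub>C E"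
  by (subst ep_string[OF EH, where ?B2.0 = 0]) (simp_all add: comm_minus_right comm_self comm_zero_right mult_ac)

lemma conj_F_E: "ep F t * E * ep F (- t) = E - t *\<^sub>C H - t^2 *\<^sub>C F"
  by (subst ep_string[OF FE, where ?B2.0 = "- (2 *\<^sub>C F)"]) (simp_all add: comm_minus_right comm_self FH)

lemma conj_F_H: "ep F t * H * ep F (- t) = H + (2 * t) *\<^sub>C F"
  by (subst ep_string[OF FH, where ?B2.0 = 0]) (simp_all add: comm_minus_right comm_self comm_zero_right mult_ac)

lemma conj_self: "ep A t * A * ep A (- t) = A"
  by (rule ep_commute_elt) (simp add: comm_self)

lemma conj_s_expand: "s * a * s' = ep E (-1) * (ep F 1 * (ep E (-1) * a * ep E (-(-1))) * ep F (-1)) * ep E (-(-1))"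
  by (simp add: s_def s'_def mult.assoc)

lemma conj_add: "g * (a + b) * g' = g * a * g' + g * b * (g'::'a)"
  and conj_diff: "g * (a - b) * g' = g * a * g' - g * b * (g'::'a)"
  and conj_minus: "g * (- a) * g' = - (g * a * (g'::'a))"
  by (simp_all add: algebra_simps)

lemma two_scl: "2 *\<^sub>C a = a + a"
  using scl_add_left[of 1 1 a] by simp

lemma conj_s_E: "s * E * s' = - F"
proof -
  have "s * E * s' = ep E (-1) * (E - H - F) * ep E (-(-1))"
    unfolding conj_s_expand conj_self conj_F_E by simp
  also have "\<dots> = - F"
    unfolding conj_add conj_diff conj_self conj_E_H conj_E_F by (simp add: two_scl)
  finally show ?thesis .
qed

lemma conj_s_H: "s * H * s' = - H"
proof -
  have "s * H * s' = ep E (-1) * (E + E - H) * ep E (-(-1))"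
    unfolding conj_s_expand conj_E_H conj_add conj_diff scl_conj conj_F_E conj_F_H by (simp add: two_scl)
  also have "\<dots> = - H"
    unfolding conj_add conj_diff conj_self conj_E_H conj_E_F by (simp add: two_scl)
  finally show ?thesis .
qed

lemma conj_s_F: "s * F * s' = - E"
proof -
  have "s * F * s' = ep E (-1) * (- E) * ep E (-(-1))"
    unfolding conj_s_expand conj_E_F conj_add conj_diff scl_conj conj_F_E conj_F_H conj_self[of F] by (simp add: two_scl)
  also have "\<dots> = - E"
    unfolding conj_minus conj_self ..
  finally show ?thesis .
qed

lemma conj_s'_swap: "s * a * s' = b \<Longrightarrow> s' * b * s = a"
  by (auto simp: mult.assoc)

lemma conj_s'_E: "s' * E * s = - F" and conj_s'_F: "s' * F * s = - E"
  using conj_s'_swap[OF conj_s_F] conj_s'_swap[OF conj_s_E] unfolding conj_minus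
  by (metis minus_minus)+

lemma s_epE: "s * ep E t = ep F (- t) * s" and s_epF: "s * ep F t = ep E (- t) * s"
  and s'_epE: "s' * ep E t = ep F (- t) * s'" and s'_epF: "s' * ep F t = ep E (- t) * s'"
proof -
  have "s * ep E t * s' = ep F (- t)" "s * ep F t * s' = ep E (- t)"
    "s' * ep E t * s = ep F (- t)" "s' * ep F t * s = ep E (- t)"
    by (simp_all add: ep_conj conj_s_E conj_s_F conj_s'_E conj_s'_F ep_neg)
  then show "s * ep E t = ep F (- t) * s" "s * ep F t = ep E (- t) * s"
    "s' * ep E t = ep F (- t) * s'" "s' * ep F t = ep E (- t) * s'"
    by (metis s_inv mult.assoc mult.right_neutral)+
qed

text \<open>One s in s * s is expanded and the other moved through it, which exchanges E and F. This
  symmetry makes the lift invariant under the Chevalley involution.\<close>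

lemma s_alt: "s = ep F 1 * ep E (-1) * ep F 1"
proof -
  have "s = s * s * s'" by (simp add: mult.assoc)
  also have "s * s = s * ep E (-1) * ep F 1 * ep E (-1)" by (simp add: s_def mult.assoc)
  also have "\<dots> = ep F 1 * (s * ep F 1) * ep E (-1)" by (simp add: s_epE mult.assoc)
  also have "\<dots> = ep F 1 * ep E (-1) * (s * ep E (-1))" by (simp add: s_epF mult.assoc)
  also have "\<dots> = ep F 1 * ep E (-1) * ep F 1 * s" by (simp add: s_epE mult.assoc)
  finally show ?thesis by (simp add: mult.assoc)
qed

lemma s_epH: "s * ep H z = ep H (- z) * s"
proof -
  have "s * ep H z * s' = ep H (- z)"
    by (simp add: ep_conj conj_s_H ep_neg)
  then show ?thesis by (metis s_inv mult.assoc mult.right_neutral)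
qed

lemma epH_epE: "ep H z * ep E t = ep E (exp (2 * z) * t) * ep H z"
proof -
  have "ep H z * ep E t * ep H (- z) = ep E (exp (2 * z) * t)"
    by (subst ep_conj) (simp_all only: ep_inv ep_eigen[OF HE] ep_scl mult.commute)
  then show ?thesis by (metis ep_inv(2) mult.assoc mult.right_neutral)
qed

lemma epH_epF: "ep H z * ep F t = ep F (exp (- 2 * z) * t) * ep H z"
proof -
  have c: "comm H F = (-2) *\<^sub>C F" using HF by simp
  have "ep H z * ep F t * ep H (- z) = ep F (exp (- 2 * z) * t)"
    by (subst ep_conj) (simp_all only: ep_inv ep_eigen[OF c] ep_scl mult.commute)
  then show ?thesis by (metis ep_inv(2) mult.assoc mult.right_neutral)
qed

text \<open>The factor in brackets is conjugate under the torus to the inverse of \<open>s\<close>.\<close>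

lemma epH_exp: "ep H z = (ep E (exp z) * ep F (- exp (- z)) * ep E (exp z)) * s"
proof -
  have "ep H (z/2) * s' * ep H (- (z/2)) = ep E (exp z) * ep F (- exp (- z)) * ep E (exp z)"
    (is "?L = ?R")
  proof -
    have "?L = (ep H (z/2) * ep E 1) * ep F (-1) * ep E 1 * ep H (- (z/2))"
      by (simp add: s'_def mult.assoc)
    also have "\<dots> = ep E (exp z) * (ep H (z/2) * ep F (-1)) * ep E 1 * ep H (- (z/2))"
      by (simp add: epH_epE mult.assoc)
    also have "\<dots> = ep E (exp z) * ep F (- exp (- z)) * (ep H (z/2) * ep E 1) * ep H (- (z/2))"
      by (simp add: epH_epF mult.assoc)
    also have "\<dots> = ?R"
      by (simp add: epH_epE mult.assoc)
    finally show ?thesis .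
  qed
  then have "?R * s = ep H (z/2) * s' * ep H (- (z/2)) * s" by simp
  also have "\<dots> = ep H (z/2) * s' * (ep H (- (z/2)) * s)" by (simp only: mult.assoc)
  also have "\<dots> = ep H (z/2) * s' * (s * ep H (z/2))" by (simp add: s_epH)
  also have "\<dots> = ep H z" by (simp add: mult.assoc ep_add)
  finally show ?thesis by simp
qed

text \<open>This takes the place of integrality of the eigenvalues of H: \<open>epH_exp\<close>
  writes \<open>ep H z\<close> in terms of exp z alone. Hence \<open>al\<close> is multiplicative
  whatever branch of the logarithm is used.\<close>

lemma epH_cong: "exp z = exp w \<Longrightarrow> ep H z = ep H w"
proof -
  assume e: "exp z = exp w"
  have "exp (- z) = exp (- w)" unfolding exp_minus e ..
  then show ?thesis unfolding epH_exp[of z] epH_exp[of w] e by (simp only:)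
qed

definition al where "al t = ep H (Ln t)"

lemma al_exp: "al (exp z) = ep H z"
  unfolding al_def by (rule epH_cong) simp

lemma al_mult: "t \<noteq> 0 \<Longrightarrow> u \<noteq> 0 \<Longrightarrow> al t * al u = al (t * u)"
  unfolding al_def ep_add by (rule epH_cong) (simp add: exp_add)

lemma al_one [simp]: "al 1 = 1" by (simp add: al_def)

lemma s_al: "t \<noteq> 0 \<Longrightarrow> s * al t = al (inverse t) * s"
  unfolding al_def s_epH by (rule arg_cong[where f = "\<lambda>x. x * s"], rule epH_cong) (simp add: exp_minus)

lemma al_epE: "t \<noteq> 0 \<Longrightarrow> al t * ep E u = ep E (t^2 * u) * al t"
  by (simp add: al_def epH_epE exp_double)

lemma al_expand: "t \<noteq> 0 \<Longrightarrow> al t = ep E t * ep F (- inverse t) * ep E t * s"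
  unfolding al_def epH_exp exp_minus by simp

lemma al_minus_one: "al (-1) = s * s"
  by (subst al_expand) (simp_all add: s_def)

text \<open>Bruhat decomposition of a lower unipotent element of SL_2. \<open>al_expand\<close>
  yields it with the inverse of s and a minus sign in the torus part; both disappear together
  because \<open>al (-1)\<close> is s * s.\<close>

lemma epF_expand: "u \<noteq> 0 \<Longrightarrow> ep F u = ep E (inverse u) * al (inverse u) * s * ep E (inverse u)"
proof -
  assume u: "u \<noteq> 0"
  have "al (- inverse u) * s' = ep E (- inverse u) * ep F u * ep E (- inverse u)"
    using u by (simp add: al_expand mult.assoc)
  then have *: "ep F u = ep E (inverse u) * (al (- inverse u) * s') * ep E (inverse u)"
    by (simp add: mult.assoc)
  have "al (- inverse u) * s' = al (inverse u) * al (-1) * s'"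
    using u by (simp add: al_mult)
  also have "\<dots> = al (inverse u) * s" by (simp add: al_minus_one mult.assoc)
  finally show ?thesis using * by (simp add: mult.assoc)
qed

lemma s_al_assoc: "t \<noteq> 0 \<Longrightarrow> s * (al t * z) = al (inverse t) * (s * z)"
  by (metis s_al mult.assoc)

lemma al_mult_assoc: "t \<noteq> 0 \<Longrightarrow> u \<noteq> 0 \<Longrightarrow> al t * (al u * z) = al (t * u) * z"
  by (metis al_mult mult.assoc)

text \<open>The element \<open>ep F u * al (inverse u)\<close> is \<open>bold_y\<close>.\<close>

lemma bold_expand: "u \<noteq> 0 \<Longrightarrow> ep F u * al (inverse u) = ep E (inverse u) * s * ep E u"
proof -
  assume u: "u \<noteq> 0"
  have "ep F u * al (inverse u) = ep E (inverse u) * al (inverse u) * s * (ep E (inverse u) * al (inverse u))"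
    using u by (simp add: epF_expand mult.assoc)
  also have "\<dots> = ep E (inverse u) * (al (inverse u) * (s * (ep E (inverse u) * al (inverse u))))"
    by (simp add: mult.assoc)
  also have "ep E (inverse u) * al (inverse u) = al (inverse u) * ep E u"
    using u by (simp add: al_epE power2_eq_square field_simps)
  also have "ep E (inverse u) * (al (inverse u) * (s * (al (inverse u) * ep E u)))
      = ep E (inverse u) * (al (inverse u) * (al u * (s * ep E u)))"
    using u by (simp add: s_al_assoc)
  also have "\<dots> = ep E (inverse u) * s * ep E u"
    using u by (simp add: al_mult_assoc mult.assoc)
  finally show ?thesis .
qed

text \<open>Gauss decomposition: the product lies in the big cell of SL_2 unless 1 + a t = 0. The
  proof puts both sides into Bruhat form by \<open>epF_expand\<close>.\<close>

lemma epE_epF: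
  assumes w: "1 + a * t \<noteq> 0"
  shows "ep E a * ep F t = ep F (t / (1 + a * t)) * al (1 + a * t) * ep E (a / (1 + a * t))"
proof (cases "t = 0")
  case False
  define w where "w = 1 + a * t"
  have w0: "w \<noteq> 0" using w by (simp add: w_def)
  have "ep F (t / w) * al w * ep E (a / w)
      = ep E (w / t) * (al (w / t) * (s * (ep E (w / t) * (al w * ep E (a / w)))))"
    using False w0 by (simp add: epF_expand mult.assoc)
  also have "ep E (w / t) * (al w * ep E (a / w)) = al w * ep E (1 / (w * t) + a / w)"
  proof -
    have "w\<^sup>2 * (1 / (w * t) + a / w) = w / t + w * a" using False w0
      by (simp add: power2_eq_square field_simps)
    moreover have "al w * ep E (1 / (w * t) + a / w) = ep E (w\<^sup>2 * (1 / (w * t) + a / w)) * al w"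
      using w0 by (rule al_epE)
    moreover have "ep E (w / t) * (al w * ep E (a / w)) = ep E (w / t + w * a) * al w"
      using w0 by (simp add: al_epE power2_eq_square flip: ep_add_assoc)
    ultimately show ?thesis by simp
  qed
  also have "1 / (w * t) + a / w = 1 / t"
  proof -
    have "1 / (w * t) + a / w = (1 + a * t) / (w * t)" using False w0 by (simp add: add_divide_distrib)
    then show ?thesis using w0 by (simp flip: w_def)
  qed
  also have "ep E (w / t) * (al (w / t) * (s * (al w * ep E (1 / t))))
     = ep E (w / t) * (al (1 / t) * (s * ep E (1 / t)))"
    using False w0 by (simp add: s_al_assoc al_mult_assoc)
  also have "w / t = a + inverse t"
    using False by (simp add: w_def add_divide_distrib inverse_eq_divide)
  also have "ep E (a + inverse t) * (al (1 / t) * (s * ep E (1 / t))) = ep E a * ep F t"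
    using False by (simp add: epF_expand mult.assoc ep_add_assoc divide_inverse)
  finally show ?thesis by (simp add: w_def)
qed simp

lemma epE_expand: "t \<noteq> 0 \<Longrightarrow> ep E t = ep F (inverse t) * al t * s' * ep F (inverse t)"
proof -
  assume t: "t \<noteq> 0"
  \<comment> \<open>s * s is \<open>al (-1)\<close>, whose square is 1, so the cube of s is its
    inverse.\<close>
  have s4: "s * (s * s) = s'"
  proof -
    have "(s * s) * (s * s) = al (-1) * al (-1)" by (simp add: al_minus_one)
    also have "\<dots> = 1" by (subst al_mult) simp_all
    finally have "s * (s * (s * s)) = 1" by (simp add: mult.assoc)
    then show ?thesis by (metis s_inv(2) mult.assoc mult.left_neutral mult.right_neutral)
  qed
  have "ep E t = s * ep F (- t) * s'"
    by (simp add: s_epF mult.assoc)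
  also have "\<dots> = (s * ep E (- inverse t)) * al (- inverse t) * s * ep E (- inverse t) * s'"
    using t by (simp add: epF_expand mult.assoc)
  also have "\<dots> = ep F (inverse t) * (s * al (- inverse t)) * (s * ep E (- inverse t)) * s'"
    by (simp add: s_epE mult.assoc)
  also have "\<dots> = ep F (inverse t) * al (- t) * (s * s) * ep E (- inverse t) * s'"
    using t by (simp add: s_al mult.assoc)
  also have "\<dots> = ep F (inverse t) * al (- t) * s * (s * ep E (- inverse t)) * s'"
    by (simp add: mult.assoc)
  also have "\<dots> = ep F (inverse t) * al (- t) * s * ep F (inverse t)"
    by (simp add: s_epE mult.assoc)
  also have "al (- t) = al t * (s * s)"
    using t by (simp add: al_mult flip: al_minus_one)
  also have "ep F (inverse t) * (al t * (s * s)) * s = ep F (inverse t) * al t * s'"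
    by (simp add: mult.assoc s4)
  finally show ?thesis .
qed

end


section \<open>Signed permutations\<close>

text \<open>In the orthonormal basis the simple roots are \<open>\<epsilon>\<^sub>i - \<epsilon>\<^sub>i\<^sub>+\<^sub>1\<close> and \<open>\<epsilon>\<^sub>n\<close>.  Elements of the Weyl group are
  compared through their action on \<open>\<rho>\<^sup>\<or> = (n, \<dots>, 1)\<close>.\<close>

definition alpha :: "nat \<Rightarrow> nat \<Rightarrow> (nat \<Rightarrow> int) \<Rightarrow> int" where
  "alpha n i y = (if i < n then y i - y (Suc i) else y n)"

definition sr :: "nat \<Rightarrow> nat \<Rightarrow> (nat \<Rightarrow> int) \<Rightarrow> (nat \<Rightarrow> int)" where
  "sr n i y = (if i < n then y(i := y (Suc i), Suc i := y i) else y(n := - y n))"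

definition wact :: "nat \<Rightarrow> nat list \<Rightarrow> (nat \<Rightarrow> int) \<Rightarrow> (nat \<Rightarrow> int)" where
  "wact n r y = foldr (sr n) r y"

definition rho :: "nat \<Rightarrow> nat \<Rightarrow> int" where "rho n j = int n + 1 - int j"

lemma wact_simps [simp]: "wact n [] y = y" "wact n (i # r) y = sr n i (wact n r y)"
  "wact n (r @ r') y = wact n r (wact n r' y)"
  by (simp_all add: wact_def)

lemma sr_sr [simp]: "sr n i (sr n i y) = y"
  by (auto simp: sr_def fun_eq_iff)

lemma alpha_sr [simp]: "alpha n i (sr n i y) = - alpha n i y"
  by (auto simp: sr_def alpha_def)

lemma wact_rev [simp]: "wact n (rev r) (wact n r y) = y" "wact n r (wact n (rev r) y) = y"
  by (induction r arbitrary: y) simp_all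

lemma alpha_rho [simp]: "1 \<le> n \<Longrightarrow> alpha n i (rho n) = 1"
  by (auto simp: alpha_def rho_def)

text \<open>The Weyl orbit of \<open>rho n\<close>: the absolute values are a permutation of 1, ...,
  n. Coordinates outside {1..n} are frozen so that points can be compared as functions.\<close>

definition good :: "nat \<Rightarrow> (nat \<Rightarrow> int) \<Rightarrow> bool" where
  "good n y \<longleftrightarrow> (\<forall>j\<in>{1..n}. y j \<noteq> 0 \<and> \<bar>y j\<bar> \<le> int n) \<and> inj_on (\<lambda>j. \<bar>y j\<bar>) {1..n} \<and>
     (\<forall>j. j \<notin> {1..n} \<longrightarrow> y j = rho n j)"

lemma good_rho: "good n (rho n)"
  by (auto simp: good_def rho_def inj_on_def)

lemma good_sr:
  assumes "good n y" "i \<in> {1..n}"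
  shows "good n (sr n i y)"
proof -
  have "inj_on (\<lambda>j. \<bar>sr n i y j\<bar>) {1..n}"
  proof (cases "i < n")
    case True
    define p where "p j = (if j = i then Suc i else if j = Suc i then i else j)" for j
    have eq: "(\<lambda>j. \<bar>sr n i y j\<bar>) = (\<lambda>j. \<bar>y j\<bar>) \<circ> p"
      using True by (auto simp: sr_def p_def)
    have "inj_on ((\<lambda>j. \<bar>y j\<bar>) \<circ> p) {1..n}"
    proof (rule comp_inj_on)
      show "inj_on p {1..n}" by (auto simp: p_def inj_on_def split: if_splits)
      have "p ` {1..n} \<subseteq> {1..n}" using assms True by (auto simp: p_def)
      then show "inj_on (\<lambda>j. \<bar>y j\<bar>) (p ` {1..n})" using assms(1) unfolding good_def by (meson inj_on_subset)
    qed
    then show ?thesis by (simp only: eq)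
  next
    case False
    then have "(\<lambda>j. \<bar>sr n i y j\<bar>) = (\<lambda>j. \<bar>y j\<bar>)" by (auto simp: sr_def)
    then show ?thesis using assms by (simp add: good_def)
  qed
  moreover have "\<forall>j\<in>{1..n}. sr n i y j \<noteq> 0 \<and> \<bar>sr n i y j\<bar> \<le> int n"
    "\<forall>j. j \<notin> {1..n} \<longrightarrow> sr n i y j = rho n j"
    using assms by (auto simp: good_def sr_def)
  ultimately show ?thesis by (simp add: good_def)
qed

lemma good_wact: "good n y \<Longrightarrow> set r \<subseteq> {1..n} \<Longrightarrow> good n (wact n r y)"
  by (induction r) (auto intro: good_sr)

lemma good_alpha: "good n y \<Longrightarrow> i \<in> {1..n} \<Longrightarrow> alpha n i y \<noteq> 0"
  using inj_onD[of "\<lambda>j. \<bar>y j\<bar>" "{1..n}" i "Suc i"] by (auto simp: good_def alpha_def)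

definition inv_pair :: "int \<Rightarrow> int \<Rightarrow> nat" where
  "inv_pair u v = (if u < v then 1 else 0) + (if u + v < 0 then 1 else 0)"

definition pairs :: "nat \<Rightarrow> (nat \<times> nat) set" where
  "pairs n = {(a, b). 1 \<le> a \<and> a < b \<and> b \<le> n}"

text \<open>The number of positive roots that are negative on y, that is the Coxeter length:
  \<open>inv_pair\<close> counts the roots \<epsilon>_a - \<epsilon>_b and \<epsilon>_a +
  \<epsilon>_b, the second sum the short roots \<epsilon>_a.\<close>

definition ninv :: "nat \<Rightarrow> (nat \<Rightarrow> int) \<Rightarrow> nat" where
  "ninv n y = (\<Sum>(a, b)\<in>pairs n. inv_pair (y a) (y b)) + (\<Sum>a\<in>{1..n}. if y a < 0 then 1 else 0)"

lemma finite_pairs [simp]: "finite (pairs n)"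
  by (rule finite_subset[of _ "{1..n} \<times> {1..n}"]) (auto simp: pairs_def)

text \<open>A simple reflection permutes the positive roots other than its own. For i < n this is
  the reindexing by the transposition \<open>p\<close>, with the pair (i, i+1) treated
  separately.\<close>

lemma ninv_sr:
  assumes i: "i \<in> {1..n}" and pos: "alpha n i y > 0"
  shows "ninv n (sr n i y) = Suc (ninv n y)"
proof (cases "i < n")
  case True
  define p where "p j = (if j = i then Suc i else if j = Suc i then i else j)" for j
  have s: "sr n i y j = y (p j)" for j using True by (auto simp: sr_def p_def)
  have pp: "p (p j) = j" for j by (auto simp: p_def)
  have mem: "(i, Suc i) \<in> pairs n" using True i by (auto simp: pairs_def)
  have r: "(\<Sum>(a, b)\<in>pairs n - {(i, Suc i)}. inv_pair (y (p a)) (y (p b))) =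
        (\<Sum>(a, b)\<in>pairs n - {(i, Suc i)}. inv_pair (y a) (y b))"
    by (rule sum.reindex_bij_witness[where i = "map_prod p p" and j = "map_prod p p"])
       (use True i in \<open>auto simp: pairs_def p_def split: if_splits\<close>)
  have q: "(\<Sum>a\<in>{1..n}. if y (p a) < 0 then 1 else 0) = (\<Sum>a\<in>{1..n}. if y a < 0 then 1 else (0::nat))"
    by (rule sum.reindex_bij_witness[where i = p and j = p])
       (use True i in \<open>auto simp: p_def split: if_splits\<close>)
  have "y i > y (Suc i)" using pos True by (simp add: alpha_def)
  then have t: "inv_pair (y (p i)) (y (p (Suc i))) = Suc (inv_pair (y i) (y (Suc i)))"
    by (simp add: p_def inv_pair_def)
  show ?thesis
    unfolding ninv_def s q sum.remove[OF finite_pairs mem]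
    using r t by simp
next
  case False
  then have i': "i = n" using i by simp
  have 1: "(\<Sum>(a, b)\<in>pairs n. inv_pair (sr n i y a) (sr n i y b)) = (\<Sum>(a, b)\<in>pairs n. inv_pair (y a) (y b))"
    by (rule sum.cong) (auto simp: i' pairs_def sr_def inv_pair_def)
  have n: "n \<in> {1..n}" "finite {1..n}" using i by auto
  have "(\<Sum>a\<in>{1..n}-{n}. if sr n i y a < 0 then 1 else 0) = (\<Sum>a\<in>{1..n}-{n}. if y a < 0 then 1 else (0::nat))"
    by (rule sum.cong) (auto simp: i' sr_def)
  moreover have "y n > 0" using pos i' by (simp add: alpha_def)
  ultimately have "(\<Sum>a\<in>{1..n}. if sr n i y a < 0 then 1 else 0) = Suc (\<Sum>a\<in>{1..n}. if y a < 0 then 1 else (0::nat))"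
    unfolding sum.remove[OF n(2,1)] by (simp add: i' sr_def)
  then show ?thesis unfolding ninv_def 1 by simp
qed

lemma ninv_sr_neg: "i \<in> {1..n} \<Longrightarrow> alpha n i y < 0 \<Longrightarrow> ninv n y = Suc (ninv n (sr n i y))"
  using ninv_sr[of i n "sr n i y"] by simp

lemma ninv_rho: "ninv n (rho n) = 0"
proof -
  have "(\<Sum>(a, b)\<in>pairs n. inv_pair (rho n a) (rho n b)) = 0"
    by (rule sum.neutral) (auto simp: pairs_def inv_pair_def rho_def)
  then show ?thesis by (simp add: ninv_def rho_def)
qed

text \<open>The coordinates are n strictly decreasing integers squeezed between 1 and n:
  \<open>lower\<close> counts upwards from coordinate n, \<open>upper\<close> downwards from
  coordinate 1.\<close>

lemma dominant_good:
  assumes g: "good n y" and pos: "\<And>i. i \<in> {1..n} \<Longrightarrow> alpha n i y > 0"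
  shows "y = rho n"
proof
  fix j
  have step: "y j \<ge> y (Suc j) + 1" if "1 \<le> j" "j < n" for j
    using pos[of j] that by (auto simp: alpha_def)
  have lower: "y (n - d) \<ge> 1 + int d" if "d < n" for d
    using that
  proof (induction d)
    case 0
    then show ?case using pos[of n] by (simp add: alpha_def)
  next
    case (Suc d)
    have "1 \<le> n - Suc d" "n - Suc d < n" "Suc (n - Suc d) = n - d" using Suc.prems by auto
    then show ?case using step[of "n - Suc d"] Suc by simp
  qed
  have upper: "y (Suc d) \<le> int n - int d" if "d < n" for d
    using that
  proof (induction d)
    case 0
    then have "\<bar>y 1\<bar> \<le> int n" using g by (auto simp: good_def)
    then show ?case by simp
  next
    case (Suc d)
    then show ?case using step[of "Suc d"] by simp
  qed
  show "y j = rho n j"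
  proof (cases "j \<in> {1..n}")
    case True
    then have "n - j < n" "j - 1 < n" "n - (n - j) = j" "Suc (j - 1) = j" "int (n - j) = int n - int j"
      "int (j - 1) = int j - 1" by auto
    then show ?thesis using lower[of "n - j"] upper[of "j - 1"] by (simp add: rho_def)
  next
    case False
    then show ?thesis using g by (simp add: good_def)
  qed
qed

text \<open>Bubble sort: as long as some simple root is negative on y, reflecting in it removes
  exactly one inversion; the process ends in the dominant chamber.\<close>

lemma sort_word:
  assumes "good n y"
  obtains t where "set t \<subseteq> {1..n}" "length t = ninv n y" "wact n t (rho n) = y"
  using assms
proof (induction "ninv n y" arbitrary: y thesis)
  case 0
  have "alpha n i y > 0" if "i \<in> {1..n}" for i
    using ninv_sr_neg[OF that, of y] good_alpha[OF 0(3) that] 0(1) by linarith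
  then have "y = rho n" using 0(3) by (rule dominant_good[rotated])
  then show ?case using 0(2)[of "[]"] by (simp add: ninv_rho)
next
  case (Suc k)
  have "\<exists>i\<in>{1..n}. alpha n i y < 0"
  proof (rule ccontr)
    assume "\<not> (\<exists>i\<in>{1..n}. alpha n i y < 0)"
    then have "y = rho n"
      using good_alpha[OF Suc(4)] by (intro dominant_good[OF Suc(4)]) (meson linorder_neqE)
    then show False using Suc(2) by (simp add: ninv_rho)
  qed
  then obtain i where i: "i \<in> {1..n}" "alpha n i y < 0" by blast
  have "k = ninv n (sr n i y)" using ninv_sr_neg[OF i] Suc(2) by simp
  from Suc(1)[OF this _ good_sr[OF Suc(4) i(1)]]
  obtain t where "set t \<subseteq> {1..n}" "length t = ninv n (sr n i y)" "wact n t (rho n) = sr n i y" by blast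
  with i show ?case using Suc(3)[of "i # t"] ninv_sr_neg[OF i] by simp
qed

lemma ninv_le_length: "set r \<subseteq> {1..n} \<Longrightarrow> ninv n (wact n r (rho n)) \<le> length r"
proof (induction r)
  case (Cons i r)
  then have i: "i \<in> {1..n}" by simp
  have "alpha n i (wact n r (rho n)) \<noteq> 0"
    using Cons by (intro good_alpha good_wact good_rho) auto
  then show ?case
    using Cons ninv_sr[OF i, of "wact n r (rho n)"] ninv_sr_neg[OF i, of "wact n r (rho n)"]
    by (cases "alpha n i (wact n r (rho n)) > 0") auto
qed (simp add: ninv_rho)

lemma wact_signed_perm:
  "set r \<subseteq> {1..n} \<Longrightarrow> \<exists>p e. (\<forall>j\<in>{1..n}. p j \<in> {1..n} \<and> e j \<in> {1, -1}) \<and>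
     (\<forall>y. wact n r y = (\<lambda>j. if j \<in> {1..n} then e j * y (p j) else y j))"
proof (induction r)
  case Nil
  show ?case by (rule exI[of _ id], rule exI[of _ "\<lambda>_. 1"]) auto
next
  case (Cons i r)
  then obtain p e where pe: "\<forall>j\<in>{1..n}. p j \<in> {1..n} \<and> e j \<in> {1, -1}"
    "\<And>y. wact n r y = (\<lambda>j. if j \<in> {1..n} then e j * y (p j) else y j)" by (auto simp del: insert_iff)
  show ?case
  proof (cases "i < n")
    case True
    have "wact n (i # r) y = (\<lambda>j. if j \<in> {1..n} then (e(i := e (Suc i), Suc i := e i)) j *
        y ((p(i := p (Suc i), Suc i := p i)) j) else y j)" for y
      unfolding wact_simps pe(2) using True Cons.prems by (auto simp: sr_def fun_eq_iff)
    then show ?thesis using pe(1) Cons.prems True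
      by (intro exI[of _ "p(i := p (Suc i), Suc i := p i)"] exI[of _ "e(i := e (Suc i), Suc i := e i)"]) simp
  next
    case False
    have "wact n (i # r) y = (\<lambda>j. if j \<in> {1..n} then (e(n := - e n)) j * y (p j) else y j)" for y
      unfolding wact_simps pe(2) using False Cons.prems by (auto simp: sr_def fun_eq_iff)
    then show ?thesis using pe(1) Cons.prems False
      by (intro exI[of _ p] exI[of _ "e(n := - e n)"]) auto
  qed
qed

text \<open>The entries of \<rho> are distinct and positive, so the sign and the source of every
  coordinate can be read off from the image of \<rho>.\<close>

lemma wact_faithful:
  assumes "set r \<subseteq> {1..n}" "set r' \<subseteq> {1..n}" "wact n r (rho n) = wact n r' (rho n)"
  shows "wact n r = wact n r'"
proof -
  from wact_signed_perm[OF assms(1)] obtain p e where pe: "\<forall>j\<in>{1..n}. p j \<in> {1..n} \<and> e j \<in> {1, -1}"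
    "\<And>y. wact n r y = (\<lambda>j. if j \<in> {1..n} then e j * y (p j) else y j)" by blast
  from wact_signed_perm[OF assms(2)] obtain q f where qf: "\<forall>j\<in>{1..n}. q j \<in> {1..n} \<and> f j \<in> {1, -1}"
    "\<And>y. wact n r' y = (\<lambda>j. if j \<in> {1..n} then f j * y (q j) else y j)" by blast
  have "p j = q j \<and> e j = f j" if j: "j \<in> {1..n}" for j
  proof -
    have "e j * rho n (p j) = f j * rho n (q j)"
      using fun_cong[OF assms(3), of j] j by (simp add: pe qf)
    moreover have "rho n (p j) > 0" "rho n (q j) > 0" using pe(1) qf(1) j by (auto simp: rho_def)
    moreover have "e j \<in> {1, -1}" "f j \<in> {1, -1}" using pe(1) qf(1) j by blast+
    ultimately show ?thesis by (auto simp: rho_def)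
  qed
  then show ?thesis by (auto simp: fun_eq_iff pe(2) qf(2))
qed

definition redu :: "nat \<Rightarrow> nat list \<Rightarrow> bool" where
  "redu n r \<longleftrightarrow> set r \<subseteq> {1..n} \<and> ninv n (wact n r (rho n)) = length r"

text \<open>No word is shorter than the number of inversions it creates, and
  \<open>sort_word\<close> produces a word that attains this number.\<close>

lemma redu_minimal:
  "redu n r \<longleftrightarrow> set r \<subseteq> {1..n} \<and> (\<forall>r'. set r' \<subseteq> {1..n} \<longrightarrow> wact n r' = wact n r \<longrightarrow> length r \<le> length r')"
proof (intro iffI conjI allI impI)
  assume "redu n r"
  then show "set r \<subseteq> {1..n}" by (simp add: redu_def)
  fix r' assume "set r' \<subseteq> {1..n}" "wact n r' = wact n r"
  then show "length r \<le> length r'" using ninv_le_length[of r' n] \<open>redu n r\<close> by (simp add: redu_def)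
next
  assume *: "set r \<subseteq> {1..n} \<and> (\<forall>r'. set r' \<subseteq> {1..n} \<longrightarrow> wact n r' = wact n r \<longrightarrow> length r \<le> length r')"
  obtain t where t: "set t \<subseteq> {1..n}" "length t = ninv n (wact n r (rho n))" "wact n t (rho n) = wact n r (rho n)"
    using sort_word[OF good_wact[OF good_rho]] * by blast
  then have "length r \<le> length t" using * wact_faithful by blast
  then show "redu n r" using t * ninv_le_length[of r n] by (simp add: redu_def)
qed

lemma redu_append: "redu n (r @ r') \<Longrightarrow> redu n r \<and> redu n r'"
  unfolding redu_minimal
proof (intro conjI allI impI; (elim conjE)?)
  assume *: "\<forall>s. set s \<subseteq> {1..n} \<longrightarrow> wact n s = wact n (r @ r') \<longrightarrow> length (r @ r') \<le> length s"
    and s: "set (r @ r') \<subseteq> {1..n}"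
  show "set r \<subseteq> {1..n}" "set r' \<subseteq> {1..n}" using s by auto
  show "length r \<le> length s" if "set s \<subseteq> {1..n}" "wact n s = wact n r" for s
    using *[rule_format, of "s @ r'"] that s by (auto simp: fun_eq_iff)
  show "length r' \<le> length s" if "set s \<subseteq> {1..n}" "wact n s = wact n r'" for s
    using *[rule_format, of "r @ s"] that s by (auto simp: fun_eq_iff)
qed

lemma wact_rev_eq: "wact n r = wact n r' \<Longrightarrow> wact n (rev r) = wact n (rev r')"
  by (metis ext wact_rev)

lemma redu_rev: "redu n r \<Longrightarrow> redu n (rev r)"
  unfolding redu_minimal by (metis length_rev rev_rev_ident set_rev wact_rev_eq)

lemma redu_Cons: "redu n (i # r) \<longleftrightarrow> i \<in> {1..n} \<and> redu n r \<and> alpha n i (wact n r (rho n)) > 0"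
proof
  assume a: "redu n (i # r)"
  then have i: "i \<in> {1..n}" "redu n r" using redu_append[of n "[i]" r] by (auto simp: redu_def)
  then have "alpha n i (wact n r (rho n)) \<noteq> 0"
    by (intro good_alpha good_wact good_rho) (auto simp: redu_def)
  moreover have "\<not> alpha n i (wact n r (rho n)) < 0"
    using ninv_sr_neg[OF i(1), of "wact n r (rho n)"] a i(2) by (auto simp: redu_def)
  ultimately show "i \<in> {1..n} \<and> redu n r \<and> alpha n i (wact n r (rho n)) > 0" using i by linarith
qed (auto simp: redu_def ninv_sr)

lemma redu_exists_word:
  assumes "good n y"
  obtains t where "redu n t" "wact n t (rho n) = y"
  using sort_word[OF assms] redu_def by metis

text \<open>If two reduced words of y begin with i and j, both letters are descents of y. Then y
  also has reduced words beginning with either side of the braid relation for i and j, and the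
  induction hypothesis links these to the given ones.\<close>

lemma matsumoto:
  fixes g :: "nat \<Rightarrow> 'b::monoid_mult"
  assumes n: "n \<ge> 2"
    and far: "\<And>i j. 1 \<le> i \<Longrightarrow> Suc i < j \<Longrightarrow> j \<le> n \<Longrightarrow> g i * g j = g j * g i"
    and braid3: "\<And>i. 1 \<le> i \<Longrightarrow> Suc i < n \<Longrightarrow> g i * g (Suc i) * g i = g (Suc i) * g i * g (Suc i)"
    and braid4: "g (n - 1) * g n * g (n - 1) * g n = g n * g (n - 1) * g n * g (n - 1)"
  shows "redu n r \<Longrightarrow> redu n r' \<Longrightarrow> wact n r (rho n) = wact n r' (rho n) \<Longrightarrow>
    prod_list (map g r) = prod_list (map g r')"
proof (induction "length r" arbitrary: r r' rule: less_induct)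
  case less
  have len: "length r = length r'" using less.prems by (simp add: redu_def)
  define y where "y = wact n r (rho n)"
  have gy: "good n y" unfolding y_def using less.prems(1) by (intro good_wact good_rho) (auto simp: redu_def)
  \<comment> \<open>Reduced words of y with a common first letter: the induction hypothesis applies
    after deleting it.\<close>
  have sub: "prod_list (map g (i # u)) = prod_list (map g (d @ t))"
    if "redu n (i # u)" "length (i # u) = length r" "wact n (i # u) (rho n) = y"
       "redu n (d @ t)" "d = i # d'" "wact n (d @ t) (rho n) = y" for i u d d' t
  proof -
    have "redu n u" "redu n (d' @ t)" using that(1,4) unfolding that(5) append_Cons redu_Cons by blast+
    moreover have "wact n u (rho n) = wact n (d' @ t) (rho n)"
      using that(3,6) unfolding that(5) by (metis append_Cons wact_simps(2) sr_sr)
    ultimately have "prod_list (map g u) = prod_list (map g (d' @ t))"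
      using that(2) by (intro less.hyps) auto
    then show ?thesis by (simp add: that(5))
  qed
  \<comment> \<open>If stripping the letters of d from y descends at every step, then y has a
    reduced word that begins with d.\<close>
  have word: "\<exists>t. redu n t \<and> redu n (d @ t) \<and> wact n (d @ t) (rho n) = y"
    if "set d \<subseteq> {1..n}" "\<And>p i q. d = p @ i # q \<Longrightarrow> alpha n i (wact n (rev p) y) < 0" for d
    using that gy
  proof (induction d arbitrary: y)
    case Nil
    then show ?case using redu_exists_word by (metis append_Nil)
  next
    case (Cons i d)
    have neg: "alpha n i y < 0" using Cons.prems(2)[of "[]" i d] by simp
    have i: "i \<in> {1..n}" using Cons.prems(1) by simp
    have "\<exists>t. redu n t \<and> redu n (d @ t) \<and> wact n (d @ t) (rho n) = sr n i y"
    proof (rule Cons.IH)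
      show "alpha n j (wact n (rev p) (sr n i y)) < 0" if "d = p @ j # q" for p j q
        using Cons.prems(2)[of "i # p" j q] that by simp
    qed (use Cons.prems i in \<open>auto intro: good_sr\<close>)
    then obtain t where t: "redu n t" "redu n (d @ t)" "wact n (d @ t) (rho n) = sr n i y" by blast
    then have "redu n (i # d @ t)" unfolding redu_Cons using neg i by simp
    with t show ?case by (intro exI[of _ t]) simp
  qed
  \<comment> \<open>The three cases are those in which s_i s_j has order 2, 3 and 4. In each, the
    remainders t and t' of the two braid words represent the same element and are shorter, so their
    products agree.\<close>
  have main: "prod_list (map g (i # u)) = prod_list (map g (j # v))"
    if "i < j" and r: "redu n (i # u)" "redu n (j # v)" "wact n (i # u) (rho n) = y" "wact n (j # v) (rho n) = y"
      "length (i # u) = length r" "length (j # v) = length r" for i j u v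
  proof -
    have ij: "i \<in> {1..n}" "j \<in> {1..n}" using r(1,2) by (auto simp: redu_def)
    have "alpha n i (wact n u (rho n)) > 0" "alpha n j (wact n v (rho n)) > 0"
      using r(1,2) by (auto simp: redu_Cons)
    moreover have "alpha n i y = - alpha n i (wact n u (rho n))" "alpha n j y = - alpha n j (wact n v (rho n))"
      using r(3,4) by (metis alpha_sr wact_simps(2))+
    ultimately have neg: "alpha n i y < 0" "alpha n j y < 0" by simp_all
    consider "Suc i < j" | "j = Suc i" "j < n" | "j = Suc i" "j = n" using \<open>i < j\<close> ij by force
    then show ?thesis
    proof cases
      case 1
      have "\<exists>t. redu n t \<and> redu n ([i, j] @ t) \<and> wact n ([i, j] @ t) (rho n) = y"
        by (rule word) (use ij neg 1 in \<open>auto simp: Cons_eq_append_conv alpha_def sr_def\<close>)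
      then obtain t where t: "redu n t" "redu n ([i, j] @ t)" "wact n ([i, j] @ t) (rho n) = y" by blast
      have "\<exists>t. redu n t \<and> redu n ([j, i] @ t) \<and> wact n ([j, i] @ t) (rho n) = y"
        by (rule word) (use ij neg 1 in \<open>auto simp: Cons_eq_append_conv alpha_def sr_def\<close>)
      then obtain t' where t': "redu n t'" "redu n ([j, i] @ t')" "wact n ([j, i] @ t') (rho n) = y" by blast
      have s: "wact n [i, j] = wact n [j, i]" using 1 ij by (auto simp: fun_eq_iff sr_def)
      have "wact n t (rho n) = wact n (rev [i, j]) y" "wact n t' (rho n) = wact n (rev [j, i]) y"
        using t(3) t'(3) by (metis wact_rev(1) wact_simps(3))+
      then have tt: "wact n t (rho n) = wact n t' (rho n)"
        using fun_cong[OF wact_rev_eq[OF s], of y] by simp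
      have "length t < length r" using t r(3) r(5) r(1) by (auto simp: redu_def)
      then have "prod_list (map g t) = prod_list (map g t')" using less.hyps t(1) t'(1) tt by blast
      moreover have "g i * g j = g j * g i" using far 1 ij by simp
      ultimately have "prod_list (map g ([i, j] @ t)) = prod_list (map g ([j, i] @ t'))"
        by (simp flip: mult.assoc)
      moreover have "prod_list (map g (i # u)) = prod_list (map g ([i, j] @ t))"
        by (rule sub[OF r(1,5,3) t(2) _ t(3)]) simp
      moreover have "prod_list (map g (j # v)) = prod_list (map g ([j, i] @ t'))"
        by (rule sub[OF r(2,6,4) t'(2) _ t'(3)]) simp
      ultimately show ?thesis by simp
    next
      case 2
      have "\<exists>t. redu n t \<and> redu n ([i, j, i] @ t) \<and> wact n ([i, j, i] @ t) (rho n) = y"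
        by (rule word) (use ij neg 2 in \<open>auto simp: Cons_eq_append_conv alpha_def sr_def\<close>)
      then obtain t where t: "redu n t" "redu n ([i, j, i] @ t)" "wact n ([i, j, i] @ t) (rho n) = y" by blast
      have "\<exists>t. redu n t \<and> redu n ([j, i, j] @ t) \<and> wact n ([j, i, j] @ t) (rho n) = y"
        by (rule word) (use ij neg 2 in \<open>auto simp: Cons_eq_append_conv alpha_def sr_def\<close>)
      then obtain t' where t': "redu n t'" "redu n ([j, i, j] @ t')" "wact n ([j, i, j] @ t') (rho n) = y" by blast
      have s: "wact n [i, j, i] = wact n [j, i, j]" using 2 ij by (auto simp: fun_eq_iff sr_def)
      have "wact n t (rho n) = wact n (rev [i, j, i]) y" "wact n t' (rho n) = wact n (rev [j, i, j]) y"
        using t(3) t'(3) by (metis wact_rev(1) wact_simps(3))+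
      then have tt: "wact n t (rho n) = wact n t' (rho n)"
        using fun_cong[OF wact_rev_eq[OF s], of y] by simp
      have "length t < length r" using t r(3) r(5) r(1) by (auto simp: redu_def)
      then have "prod_list (map g t) = prod_list (map g t')" using less.hyps t(1) t'(1) tt by blast
      moreover have "g i * g j * g i = g j * g i * g j" using braid3 2 ij by simp
      ultimately have "prod_list (map g ([i, j, i] @ t)) = prod_list (map g ([j, i, j] @ t'))"
        by (simp flip: mult.assoc)
      moreover have "prod_list (map g (i # u)) = prod_list (map g ([i, j, i] @ t))"
        by (rule sub[OF r(1,5,3) t(2) _ t(3)]) simp
      moreover have "prod_list (map g (j # v)) = prod_list (map g ([j, i, j] @ t'))"
        by (rule sub[OF r(2,6,4) t'(2) _ t'(3)]) simp
      ultimately show ?thesis by simp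
    next
      case 3
      have "\<exists>t. redu n t \<and> redu n ([i, j, i, j] @ t) \<and> wact n ([i, j, i, j] @ t) (rho n) = y"
        by (rule word) (use ij neg 3 in \<open>auto simp: Cons_eq_append_conv alpha_def sr_def\<close>)
      then obtain t where t: "redu n t" "redu n ([i, j, i, j] @ t)" "wact n ([i, j, i, j] @ t) (rho n) = y" by blast
      have "\<exists>t. redu n t \<and> redu n ([j, i, j, i] @ t) \<and> wact n ([j, i, j, i] @ t) (rho n) = y"
        by (rule word) (use ij neg 3 in \<open>auto simp: Cons_eq_append_conv alpha_def sr_def\<close>)
      then obtain t' where t': "redu n t'" "redu n ([j, i, j, i] @ t')" "wact n ([j, i, j, i] @ t') (rho n) = y" by blast
      have s: "wact n [i, j, i, j] = wact n [j, i, j, i]" using 3 ij by (auto simp: fun_eq_iff sr_def)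
      have "wact n t (rho n) = wact n (rev [i, j, i, j]) y" "wact n t' (rho n) = wact n (rev [j, i, j, i]) y"
        using t(3) t'(3) by (metis wact_rev(1) wact_simps(3))+
      then have tt: "wact n t (rho n) = wact n t' (rho n)"
        using fun_cong[OF wact_rev_eq[OF s], of y] by simp
      have "length t < length r" using t r(3) r(5) r(1) by (auto simp: redu_def)
      then have "prod_list (map g t) = prod_list (map g t')" using less.hyps t(1) t'(1) tt by blast
      moreover have "g i * g j * g i * g j = g j * g i * g j * g i" using braid4 3 by simp
      ultimately have "prod_list (map g ([i, j, i, j] @ t)) = prod_list (map g ([j, i, j, i] @ t'))"
        by (simp flip: mult.assoc)
      moreover have "prod_list (map g (i # u)) = prod_list (map g ([i, j, i, j] @ t))"
        by (rule sub[OF r(1,5,3) t(2) _ t(3)]) simp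
      moreover have "prod_list (map g (j # v)) = prod_list (map g ([j, i, j, i] @ t'))"
        by (rule sub[OF r(2,6,4) t'(2) _ t'(3)]) simp
      ultimately show ?thesis by simp
    qed
  qed
  show ?case
  proof (cases r)
    case Nil
    then show ?thesis using len by simp
  next
    case (Cons i u)
    then obtain j v where r': "r' = j # v" using len by (cases r') auto
    consider "i = j" | "i < j" | "j < i" by linarith
    then show ?thesis
    proof cases
      case 1
      have "redu n u" "redu n v" using less.prems(1,2) unfolding Cons r' redu_Cons by blast+
      moreover have "wact n u (rho n) = wact n v (rho n)"
        using less.prems(3) unfolding Cons r' 1 by (metis sr_sr wact_simps(2))
      ultimately show ?thesis using less.hyps[of u v] by (simp add: Cons r' 1)
    next
      case 2
      then show ?thesis using main[of i j u v] less.prems len by (simp add: Cons r' y_def)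
    next
      case 3
      then show ?thesis using main[of j i v u] less.prems len by (simp add: Cons r' y_def)
    qed
  qed
qed


section \<open>The powers of the Coxeter word 1 2 ... n\<close>

definition cox :: "nat \<Rightarrow> nat \<Rightarrow> nat list" where
  "cox n p = concat (replicate p [1..<n+1])"

lemma cox_0 [simp]: "cox n 0 = []"
  and cox_Suc: "cox n (Suc p) = [1..<n+1] @ cox n p"
  by (simp_all add: cox_def)

lemma cox_add: "cox n (p + q) = cox n p @ cox n q"
  by (induction p) (simp_all add: cox_Suc)

lemma set_cox: "set (cox n p) \<subseteq> {1..n}"
  by (auto simp: cox_def)

lemma length_cox [simp]: "length (cox n p) = n * p"
  by (induction p) (simp_all add: cox_Suc)

lemma wact_up:
  assumes "1 \<le> a" "a \<le> n"
  shows "wact n [a..<n+1] z j = (if j < a \<or> n < j then z j else if j = a then - z n else z (j - 1))"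
  using assms(2,1)
proof (induction arbitrary: j rule: inc_induct)
  case base
  then show ?case by (auto simp: sr_def)
next
  case (step m)
  have "[m..<n+1] = m # [Suc m..<n+1]" using step by (simp add: upt_rec)
  then show ?case using step.IH step.hyps step.prems by (auto simp: sr_def simp del: upt_Suc)
qed

text \<open>The Coxeter word acts as a cyclic shift that changes the sign of the coordinate wrapped
  around. Its n-th power is therefore -1, the longest element.\<close>

lemma wact_cox:
  "p \<le> n \<Longrightarrow> wact n (cox n p) y j =
     (if j < 1 \<or> n < j then y j else if j \<le> p then - y (n - p + j) else y (j - p))"
proof (induction p arbitrary: j)
  case (Suc p)
  then show ?case
    using wact_up[of 1 n "wact n (cox n p) y" j]
    by (auto simp: cox_Suc Suc_diff_Suc simp del: upt_Suc)
qed auto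

text \<open>The root belonging to the letter i with p complete blocks to the right of its own,
  evaluated at y. At \<rho> positivity shows that the word is reduced; at s_k \<rho> the sign shows
  whether the root is \<alpha>_k.\<close>

lemma alpha_suffix:
  assumes "i \<in> {1..n}" "p < n"
  shows "alpha n i (wact n ([i+1..<n+1] @ cox n p) y) =
    (if i < n then y (n - p) + (if i \<le> p then - y (n - p + i) else y (i - p)) else y (n - p))"
proof (cases "i < n")
  case True
  then show ?thesis
    using assms wact_up[of "i+1" n "wact n (cox n p) y" i] wact_up[of "i+1" n "wact n (cox n p) y" "Suc i"]
    by (simp add: alpha_def wact_cox del: upt_Suc)
next
  case False
  then show ?thesis using assms by (simp add: alpha_def wact_cox)
qed

lemma redu_suffix:
  assumes "p < n" "redu n (cox n p)" "1 \<le> a" "a \<le> n + 1"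
  shows "redu n ([a..<n+1] @ cox n p)"
  using assms(4,3)
proof (induction rule: inc_induct)
  case base
  then show ?case using assms by simp
next
  case (step m)
  have "[m..<n+1] = m # [m+1..<n+1]" using step by (simp add: upt_rec)
  then have "[m..<n+1] @ cox n p = m # ([m+1..<n+1] @ cox n p)" by simp
  moreover have "alpha n m (wact n ([m+1..<n+1] @ cox n p) (rho n)) > 0"
    using step assms(1) by (subst alpha_suffix) (auto simp: rho_def)
  ultimately show ?case using step by (simp only: redu_Cons) auto
qed

lemma redu_cox: "p \<le> n \<Longrightarrow> redu n (cox n p)"
proof (induction p)
  case (Suc p)
  then show ?case using redu_suffix[of p n 1] by (simp add: cox_Suc del: upt_Suc)
qed (simp add: redu_def ninv_rho)

lemma wact_cox_n: "wact n (cox n n) y = (\<lambda>j. if j \<in> {1..n} then - y j else y j)"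
  by (auto simp: wact_cox)

text \<open>A position in the word is given by its letter i and the number q of complete blocks to
  the right.\<close>

lemma suffix_form:
  assumes "cox n m = p @ i # s" "n \<ge> 1"
  shows "\<exists>q<m. i \<in> {1..n} \<and> s = [i+1..<n+1] @ cox n q \<and> p = cox n (m - Suc q) @ [1..<i]"
  using assms(1)
proof (induction m arbitrary: p)
  case (Suc m)
  have shift: ?case if us: "p = [1..<n+1] @ us" "cox n m = us @ i # s" for us
  proof -
    obtain q where q: "q < m" "i \<in> {1..n}" "s = [i+1..<n+1] @ cox n q" "us = cox n (m - Suc q) @ [1..<i]"
      using Suc.IH[OF us(2)] by blast
    have "p = cox n (Suc m - Suc q) @ [1..<i]"
      using q(1) by (simp add: us(1) q(4) Suc_diff_Suc cox_Suc[of n "m - Suc q", unfolded Suc_diff_Suc[OF q(1)]] del: upt_Suc)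
    then show ?thesis using q by (intro exI[of _ q]) auto
  qed
  consider us where "[1..<n+1] = p @ us" "us @ cox n m = i # s" | us where "p = [1..<n+1] @ us" "cox n m = us @ i # s"
    using Suc.prems unfolding cox_Suc append_eq_append_conv2 by blast
  then show ?case
  proof cases
    case 1
    show ?thesis
    proof (cases us)
      case Nil
      then show ?thesis using shift[of "[]"] 1 by simp
    next
      case (Cons a u)
      then have e: "p @ i # u = [1..<n+1]" using 1 by simp
      then have "p = take (length p) [1..<n+1]" "i # u = drop (length p) [1..<n+1]"
        using append_eq_conv_conj[of p "i # u"] e by blast+
      moreover have "length p < n" using arg_cong[OF e, of length] by (simp del: upt_Suc)
      ultimately have "length p < n" and p: "p = [1..<1 + length p]" and iu: "[1 + length p..<n+1] = i # u"
        by (simp_all add: take_upt drop_upt del: upt_Suc)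
      then have "i = 1 + length p" "u = [i+1..<n+1]" by (auto simp: upt_eq_Cons_conv simp del: upt_Suc)
      then show ?thesis using 1 Cons p \<open>length p < n\<close> by (intro exI[of _ m]) (auto simp del: upt_Suc)
    qed
  next
    case 2
    then show ?thesis by (rule shift)
  qed
qed simp

lemma wact_down:
  assumes "1 \<le> i" "i \<le> n"
  shows "wact n (rev [1..<i]) z j = (if j < 1 \<or> i < j then z j else if j = i then z 1 else z (Suc j))"
  using assms
proof (induction i arbitrary: j rule: dec_induct)
  case (step m)
  then show ?case by (auto simp: sr_def)
qed (auto intro!: arg_cong[where f = z])

lemma wact_rev_cox:
  assumes "p \<le> n"
  shows "wact n (rev (cox n p)) y =
     (\<lambda>j. if j < 1 \<or> n < j then y j else if j + p \<le> n then y (j + p) else - y (j + p - n))" (is "_ = ?z")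
proof -
  have "wact n (cox n p) ?z = y"
  proof
    fix j
    consider "j < 1 \<or> n < j" | "1 \<le> j" "j \<le> p" | "p < j" "j \<le> n" by linarith
    then show "wact n (cox n p) ?z j = y j"
      using assms by cases (auto simp: wact_cox)
  qed
  then show ?thesis using wact_rev(1)[of n "cox n p" ?z] by simp
qed

lemma alpha_prefix:
  assumes "i \<in> {1..n}" "p < n"
  shows "alpha n i (wact n (rev (cox n p @ [1..<i])) y) =
    (if i < n then y (1 + p) - (if i + 1 + p \<le> n then y (i + 1 + p) else - y (i + 1 + p - n)) else y (1 + p))"
proof -
  define z where "z = wact n (rev (cox n p)) y"
  have z: "z j = (if j + p \<le> n then y (j + p) else - y (j + p - n))" if "j \<in> {1..n}" for j
    using that assms by (simp add: z_def wact_rev_cox)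
  have "wact n (rev (cox n p @ [1..<i])) y = wact n (rev [1..<i]) z"
    by (simp add: z_def)
  moreover have "alpha n i (wact n (rev [1..<i]) z) = (if i < n then z 1 - z (Suc i) else z 1)"
    using assms(1) wact_down[of i n z i] wact_down[of i n z "Suc i"] by (auto simp: alpha_def)
  ultimately show ?thesis
    using assms z[of 1] z[of "Suc i"] by simp
qed

lemma sr_rho:
  assumes "1 \<le> k" "k \<le> n"
  shows "sr n k (rho n) j = (if k = n then (if j = n then - 1 else rho n j)
     else rho n j + (if j = k then - 1 else if j = Suc k then 1 else 0))"
  using assms by (auto simp: sr_def rho_def)

text \<open>Among the positive roots only \<alpha>_k is negative on s_k \<rho>. For k < n it belongs
  to the letter 1 with exactly q = n - k blocks to its right, for k = n to the very last letter of
  the word; the hypothesis excludes these positions.\<close>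

lemma alpha_suffix_pos:
  assumes i: "i \<in> {1..n}" and q: "q < n" and k: "k \<in> {1..n}" and *: "n < q + k \<or> k = n \<and> (i, q) \<noteq> (n, 0)"
  shows "alpha n i (wact n ([i+1..<n+1] @ cox n q) (sr n k (rho n))) > 0"
proof -
  obtain r where r: "n = q + r" "1 \<le> r" using q that[of "n - q"] by simp
  define y where "y = sr n k (rho n)"
  have y: "y j = (if k = n then (if j = n then - 1 else rho n j)
     else rho n j + (if j = k then - 1 else if j = Suc k then 1 else 0))" for j
    unfolding y_def using k by (intro sr_rho) auto
  have a: "alpha n i (wact n ([i+1..<n+1] @ cox n q) y) =
    (if i < n then y r + (if i \<le> q then - y (r + i) else y (i - q)) else y r)"
    using alpha_suffix[OF i q, of y] r by simp
  consider "i < n" "i \<le> q" | p where "i < n" "i = q + p" "1 \<le> p" | "i = n"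
    using i that(2)[of "i - q"] by fastforce
  then show ?thesis
    unfolding y_def[symmetric] a
  proof cases
    case 1
    then show "0 < (if i < n then y r + (if i \<le> q then - y (r + i) else y (i - q)) else y r)"
      using r i k * by (auto simp: y rho_def split: if_splits)
  next
    case 2
    then show "0 < (if i < n then y r + (if i \<le> q then - y (r + i) else y (i - q)) else y r)"
      using r i k * by (auto simp: y rho_def split: if_splits)
  next
    case 3
    then show "0 < (if i < n then y r + (if i \<le> q then - y (r + i) else y (i - q)) else y r)"
      using r i k * by (auto simp: y rho_def split: if_splits)
  qed
qed

text \<open>The mirror image for the reversed word, with q counting the complete blocks to the left.
  Here \<alpha>_k belongs to the letter 1 with q = k - 1.\<close>

lemma alpha_prefix_pos:
  assumes i: "i \<in> {1..n}" and q: "q < n" and k: "k \<in> {1..<n}" and *: "k \<le> q"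
  shows "alpha n i (wact n (rev (cox n q @ [1..<i])) (sr n k (rho n))) > 0"
proof -
  define y where "y = sr n k (rho n)"
  have y: "y j = rho n j + (if j = k then - 1 else if j = Suc k then 1 else 0)" for j
    unfolding y_def using k sr_rho[of k n j] by simp
  show ?thesis
    unfolding y_def[symmetric] alpha_prefix[OF i q]
    using i q k * by (auto simp: y rho_def)
qed

section \<open>Comparison with the Weyl group acting on weights\<close>

text \<open>Fundamental coordinates of the weight with orthonormal coordinates y. The coordinates
  outside {1..n}, which reflections do not move, are copied from m.\<close>

definition wt_of :: "nat \<Rightarrow> (nat \<Rightarrow> int) \<Rightarrow> (nat \<Rightarrow> int) \<Rightarrow> (nat \<Rightarrow> int)" where
  "wt_of n m y = (\<lambda>j. if j \<in> {1..n} then (if j < n then y j - y (Suc j) else 2 * y n) else m j)"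

lemma simple_refl_wt_of:
  "n \<ge> 2 \<Longrightarrow> i \<in> {1..n} \<Longrightarrow> simple_refl n i (wt_of n m y) = wt_of n m (sr n i y)"
  by (auto simp: simple_refl_def wt_of_def sr_def cartan_B_def fun_eq_iff)

lemma weyl_word_simps [simp]: "weyl_word n [] = id" "weyl_word n (i # r) = simple_refl n i \<circ> weyl_word n r"
  by (simp_all add: weyl_word_def)

lemma weyl_word_append: "weyl_word n (r @ r') = weyl_word n r \<circ> weyl_word n r'"
  by (induction r) auto

lemma weyl_word_wt_of:
  "n \<ge> 2 \<Longrightarrow> set r \<subseteq> {1..n} \<Longrightarrow> weyl_word n r (wt_of n m y) = wt_of n m (wact n r y)"
  by (induction r) (auto simp: simple_refl_wt_of)

lemma simple_refl_double: "simple_refl n i (\<lambda>j. 2 * m j) = (\<lambda>j. 2 * simple_refl n i m j)"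
  by (auto simp: simple_refl_def algebra_simps)

lemma weyl_word_double: "weyl_word n r (\<lambda>j. 2 * m j) = (\<lambda>j. 2 * weyl_word n r m j)"
  by (induction r) (auto simp: simple_refl_double)

text \<open>A weight such as \<Lambda>_n has half-integral orthonormal coordinates. Twice a weight
  always has integral ones, and since reflections are linear, doubling loses nothing.\<close>

lemma double_wt_of: "(\<lambda>j. 2 * m j) = wt_of n (\<lambda>j. 2 * m j) (\<lambda>j. 2 * (\<Sum>l=j..<n. m l) + m n)"
  by (auto simp: wt_of_def fun_eq_iff sum.atLeast_Suc_lessThan)

lemma wt_of_inj:
  assumes "wt_of n m y = wt_of n m y'" "j \<in> {1..n}"
  shows "y j = y' j"
proof -
  have "j \<le> n" using assms by simp
  then show ?thesis using assms(2)
  proof (induction rule: inc_induct)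
    case base
    then show ?case using fun_cong[OF assms(1), of n] by (simp add: wt_of_def)
  next
    case (step j)
    then show ?case using fun_cong[OF assms(1), of j] by (simp add: wt_of_def)
  qed
qed

lemma wact_outside: "set r \<subseteq> {1..n} \<Longrightarrow> j \<notin> {1..n} \<Longrightarrow> wact n r y j = y j"
  using wact_signed_perm[of r n] by auto

lemma weyl_word_eq_iff:
  assumes n: "n \<ge> 2" and r: "set r \<subseteq> {1..n}" "set r' \<subseteq> {1..n}"
  shows "weyl_word n r = weyl_word n r' \<longleftrightarrow> wact n r = wact n r'"
proof
  assume e: "weyl_word n r = weyl_word n r'"
  show "wact n r = wact n r'"
  proof (intro ext)
    fix y j
    have "wt_of n y (wact n r y) = wt_of n y (wact n r' y)"
      using e weyl_word_wt_of[OF n] r by metis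
    then show "wact n r y j = wact n r' y j"
      using wt_of_inj wact_outside r by (cases "j \<in> {1..n}") auto
  qed
next
  assume e: "wact n r = wact n r'"
  show "weyl_word n r = weyl_word n r'"
  proof (intro ext)
    fix m j
    have "weyl_word n r (wt_of n (\<lambda>j. 2 * m j) y) = weyl_word n r' (wt_of n (\<lambda>j. 2 * m j) y)" for y
      by (simp only: weyl_word_wt_of[OF n r(1)] weyl_word_wt_of[OF n r(2)] e)
    from this[of "\<lambda>j. 2 * (\<Sum>l=j..<n. m l) + m n"]
    have "weyl_word n r (\<lambda>j. 2 * m j) = weyl_word n r' (\<lambda>j. 2 * m j)"
      unfolding double_wt_of[of m n, symmetric] .
    then have "2 * weyl_word n r m j = 2 * weyl_word n r' m j"
      unfolding weyl_word_double by (rule fun_cong)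
    then show "weyl_word n r m j = weyl_word n r' m j" by simp
  qed
qed

lemma weyl_length_word:
  assumes n: "n \<ge> 2" and r: "set r \<subseteq> {1..n}"
  shows "weyl_length n (weyl_word n r) = ninv n (wact n r (rho n))"
  unfolding weyl_length_def
proof (rule Least_equality)
  obtain t where t: "set t \<subseteq> {1..n}" "length t = ninv n (wact n r (rho n))" "wact n t (rho n) = wact n r (rho n)"
    using sort_word[OF good_wact[OF good_rho r]] by blast
  then have "weyl_word n t = weyl_word n r" using weyl_word_eq_iff[OF n t(1) r] wact_faithful[OF t(1) r] by simp
  then show "\<exists>r'\<in>lists {1..n}. weyl_word n r' = weyl_word n r \<and> length r' = ninv n (wact n r (rho n))"
    using t by (intro bexI[of _ t]) auto
next
  fix l assume "\<exists>r'\<in>lists {1..n}. weyl_word n r' = weyl_word n r \<and> length r' = l"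
  then obtain r' where "set r' \<subseteq> {1..n}" "weyl_word n r' = weyl_word n r" "length r' = l"
    unfolding lists_eq_set by blast
  then show "ninv n (wact n r (rho n)) \<le> l"
    using weyl_word_eq_iff[OF n _ r] ninv_le_length by metis
qed

lemma reduced_expression_word:
  assumes n: "n \<ge> 2" and r: "set r \<subseteq> {1..n}"
  shows "reduced_expression n (weyl_word n r) r' \<longleftrightarrow> redu n r' \<and> wact n r' = wact n r"
  unfolding reduced_expression_def weyl_length_word[OF n r] redu_def lists_eq_set mem_Collect_eq
  using weyl_word_eq_iff[OF n _ r] by auto

lemma reduced_expression_ex:
  assumes n: "n \<ge> 2" and r: "set r \<subseteq> {1..n}"
  shows "\<exists>r'. reduced_expression n (weyl_word n r) r'"
  unfolding reduced_expression_word[OF assms]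
  using redu_exists_word[OF good_wact[OF good_rho r]] wact_faithful[OF _ r] redu_def by metis

text \<open>All positive roots are negative on -\<rho>, so -1 has the greatest length. Conversely an
  element of greatest length has no ascent; the negative of its image of \<rho> is then dominant,
  hence \<rho> itself.\<close>

lemma longest_elt_eq:
  assumes n: "n \<ge> 2"
  shows "longest_elt n = weyl_word n (cox n n)"
  unfolding longest_elt_def
proof (rule the_equality)
  define y0 where "y0 = wact n (cox n n) (rho n)"
  have y0: "y0 j = - rho n j" if "j \<in> {1..n}" for j using that by (simp add: y0_def wact_cox_n)
  have bound: "ninv n y \<le> ninv n y0" for y
    unfolding ninv_def
  proof (rule add_mono; rule sum_mono)
    show "(case x of (a, b) \<Rightarrow> inv_pair (y a) (y b)) \<le> (case x of (a, b) \<Rightarrow> inv_pair (y0 a) (y0 b))"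
      if "x \<in> pairs n" for x
      using that by (auto simp: pairs_def y0 rho_def inv_pair_def)
    show "(if y a < 0 then 1 else 0) \<le> (if y0 a < 0 then 1 else (0::nat))" if "a \<in> {1..n}" for a
      using that by (auto simp: y0 rho_def)
  qed
  have len: "weyl_length n (weyl_word n r) = ninv n (wact n r (rho n))" if "set r \<subseteq> {1..n}" for r
    using weyl_length_word[OF n that] .
  have gr: "weyl_group n = {weyl_word n r |r. set r \<subseteq> {1..n}}"
    by (auto simp: weyl_group_def in_lists_conv_set subset_iff)
  show "weyl_word n (cox n n) \<in> weyl_group n \<and> (\<forall>v\<in>weyl_group n. weyl_length n v \<le> weyl_length n (weyl_word n (cox n n)))"
    using bound set_cox[of n n] by (auto simp: gr len y0_def)
  show "w = weyl_word n (cox n n)" if w: "w \<in> weyl_group n \<and> (\<forall>v\<in>weyl_group n. weyl_length n v \<le> weyl_length n w)" for w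
  proof -
    obtain r where r: "set r \<subseteq> {1..n}" "w = weyl_word n r" using w by (auto simp: gr)
    define y where "y = wact n r (rho n)"
    have gy: "good n y" unfolding y_def by (intro good_wact good_rho r)
    have neg: "alpha n i y < 0" if i: "i \<in> {1..n}" for i
    proof (rule ccontr)
      assume "\<not> alpha n i y < 0"
      then have "alpha n i y > 0" using good_alpha[OF gy i] by simp
      then have "ninv n (wact n (i # r) (rho n)) > ninv n y" using ninv_sr[OF i] by (simp add: y_def)
      moreover have "weyl_word n (i # r) \<in> weyl_group n" using r i unfolding gr by (intro CollectI exI[of _ "i # r"]) simp
      ultimately show False using w len[of "i # r"] len[OF r(1)] r i by (fastforce simp: y_def simp del: weyl_word_simps)
    qed
    have "wact n (cox n n) y = rho n"
    proof (rule dominant_good)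
      show "good n (wact n (cox n n) y)" by (intro good_wact gy set_cox)
      show "alpha n i (wact n (cox n n) y) > 0" if "i \<in> {1..n}" for i
        using neg[OF that] that by (auto simp: alpha_def wact_cox_n)
    qed
    moreover have "wact n (cox n n) (wact n (cox n n) y) = y" by (auto simp: wact_cox_n fun_eq_iff)
    ultimately have "wact n r (rho n) = wact n (cox n n) (rho n)" by (simp add: y_def)
    then show ?thesis using wact_faithful[OF r(1) set_cox] weyl_word_eq_iff[OF n r(1) set_cox] r(2) by simp
  qed
qed


section \<open>Chevalley generators of type B\<close>

text \<open>Only products are formed, but the generating sets below are closed under inversion, so
  this is the generated group (\<open>gen_inverse\<close>). Adding one factor on the left gives a
  convenient induction.\<close>

inductive_set gen :: "'a::monoid_mult set \<Rightarrow> 'a set" for S where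
  gen_one [simp]: "1 \<in> gen S"
| gen_left: "a \<in> S \<Longrightarrow> u \<in> gen S \<Longrightarrow> a * u \<in> gen S"

lemma gen_base: "a \<in> S \<Longrightarrow> a \<in> gen S"
  using gen_left[of a S 1] by simp

lemma gen_mult: "u \<in> gen S \<Longrightarrow> v \<in> gen S \<Longrightarrow> u * v \<in> gen S"
  by (induction u rule: gen.induct) (auto simp: mult.assoc intro: gen_left)

lemma gen_mono: "S \<subseteq> T \<Longrightarrow> gen S \<subseteq> gen T"
proof
  fix u assume "S \<subseteq> T" "u \<in> gen S"
  from this(2,1) show "u \<in> gen T" by induction (auto intro: gen_left)
qed

lemma gen_inverse:
  assumes "\<And>a. a \<in> S \<Longrightarrow> \<exists>b\<in>S. a * b = 1 \<and> b * a = 1" and "u \<in> gen S"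
  shows "\<exists>v\<in>gen S. u * v = 1 \<and> v * u = 1"
  using assms(2)
proof induction
  case (gen_left a u)
  then obtain b v where "b \<in> S" "a * b = 1" "b * a = 1" "v \<in> gen S" "u * v = 1" "v * u = 1"
    using assms(1) by blast
  moreover from this have "(a * u) * (v * b) = 1" "(v * b) * (a * u) = 1"
    by (metis mult.assoc mult.left_neutral)+
  ultimately show ?case by (intro bexI[of _ "v * b"]) (auto intro: gen_mult gen_base)
qed (auto intro: bexI[of _ 1])

lemma inverse_unique_mult: "a * b = 1 \<Longrightarrow> c * a = (1::'a::monoid_mult) \<Longrightarrow> c = b"
  by (metis mult.assoc mult.left_neutral mult.right_neutral)

text \<open>The value of \<Lambda>_j on the cocharacter y: \<Lambda>_j is \<epsilon>_1 + ... +
  \<epsilon>_j for j < n, and half of the full sum for j = n.\<close>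

definition Lam :: "nat \<Rightarrow> nat \<Rightarrow> (nat \<Rightarrow> int) \<Rightarrow> complex" where
  "Lam n j y = (if j < n then of_int (\<Sum>l=1..j. y l) else of_int (\<Sum>l=1..n. y l) / 2)"

text \<open>s_i y is y minus \<alpha>_i(y) times the coroot of \<alpha>_i, and \<Lambda>_j pairs
  with that coroot to 0 or 1.\<close>

lemma Lam_sr:
  assumes i: "i \<in> {1..n}" and j: "j \<in> {1..n}"
  shows "Lam n j (sr n i y) = Lam n j y - (if i = j then of_int (alpha n i y) else 0)"
proof -
  have s: "(\<Sum>l=1..m. sr n i y l) = (\<Sum>l=1..m. y l) - (if i = m then alpha n i y else 0) - (if i = n \<and> m = n then y n else 0)"
    if "m \<le> n" for m
    using that i
  proof (induction m)
    case (Suc m)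
    then show ?case by (cases "i = m"; cases "i = Suc m"; cases "i < n") (auto simp: sr_def alpha_def)
  qed (auto)
  have L: "Lam n j z = of_int (\<Sum>l=1..j. z l) / (if j < n then 1 else 2)" for z
    using j by (auto simp: Lam_def)
  have "j \<le> n" using j by simp
  show ?thesis
    unfolding L s[OF \<open>j \<le> n\<close>] using i j by (auto simp: alpha_def field_simps simp del: of_int_sum)
qed

lemma Lam_cartan:
  assumes n: "n \<ge> 2" and i: "i \<in> {1..n}"
  shows "(\<Sum>j\<in>{1..n}. Lam n j y * of_int (cartan_B n j i)) = of_int (alpha n i y)"
proof -
  have c: "Lam n j y * of_int (cartan_B n j i) =
      (if j = i then 2 * Lam n i y else 0) +
      (if j = Suc i then (if Suc i = n then - 2 else - 1) * Lam n (Suc i) y else 0) +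
      (if j = i - 1 then - Lam n (i - 1) y else 0)" if "j \<in> {1..n}" for j
    using that i n by (auto simp: cartan_B_def)
  have "(\<Sum>j\<in>{1..n}. Lam n j y * of_int (cartan_B n j i)) = 2 * Lam n i y +
      (if Suc i \<le> n then (if Suc i = n then - 2 else - 1) * Lam n (Suc i) y else 0) +
      (if i - 1 \<in> {1..n} then - Lam n (i - 1) y else 0)"
    using i by (subst sum.cong[OF refl c]) (assumption, simp add: sum.distrib)
  also have "\<dots> = of_int (alpha n i y)"
  proof -
    obtain k where k: "i = Suc k" using i by (cases i) auto
    have "Suc i < n \<or> Suc i = n \<or> i = n" using i by auto
    then show ?thesis
      using i n unfolding k
      by (cases k; elim disjE) (auto simp: Lam_def alpha_def field_simps)
  qed
  finally show ?thesis .
qed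

section \<open>Braid relations for the lifts of the simple reflections\<close>

locale chevalley_B = complex_banach_algebra scl for scl :: "complex \<Rightarrow> 'a::{real_normed_algebra_1,banach} \<Rightarrow> 'a" (infixr "*\<^sub>C" 75) +
  fixes n :: nat and e f h :: "nat \<Rightarrow> 'a"
  assumes n2: "n \<ge> 2"
    and hh: "i \<in> {1..n} \<Longrightarrow> j \<in> {1..n} \<Longrightarrow> comm (h i) (h j) = 0"
    and he: "i \<in> {1..n} \<Longrightarrow> j \<in> {1..n} \<Longrightarrow> comm (h i) (e j) = of_int (cartan_B n i j) *\<^sub>C e j"
    and hf: "i \<in> {1..n} \<Longrightarrow> j \<in> {1..n} \<Longrightarrow> comm (h i) (f j) = - (of_int (cartan_B n i j) *\<^sub>C f j)"
    and ef: "i \<in> {1..n} \<Longrightarrow> j \<in> {1..n} \<Longrightarrow> comm (e i) (f j) = (if i = j then h i else 0)"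
    and ee: "i \<in> {1..n} \<Longrightarrow> j \<in> {1..n} \<Longrightarrow> i \<noteq> j \<Longrightarrow> (comm (e i) ^^ nat (1 - cartan_B n i j)) (e j) = 0"
    and ff: "i \<in> {1..n} \<Longrightarrow> j \<in> {1..n} \<Longrightarrow> i \<noteq> j \<Longrightarrow> (comm (f i) ^^ nat (1 - cartan_B n i j)) (f j) = 0"
begin

definition I where "I = {1..n}"

lemma sl2: "i \<in> I \<Longrightarrow> sl2_triple scl (e i) (f i) (h i)"
  using he[of i i] hf[of i i] ef[of i i] by unfold_locales (auto simp: I_def cartan_B_def)

definition x where "x i t = ep (e i) t"
definition y where "y i t = ep (f i) t"
definition sb where "sb i = x i (-1) * y i 1 * x i (-1)"
definition sb' where "sb' i = x i 1 * y i (-1) * x i 1"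
definition al where "al i t = ep (h i) (Ln t)"

lemma sl2_s: "i \<in> I \<Longrightarrow> sl2_triple.s scl (e i) (f i) = sb i" "i \<in> I \<Longrightarrow> sl2_triple.s' scl (e i) (f i) = sb' i"
  "i \<in> I \<Longrightarrow> sl2_triple.al scl (h i) = al i"
  using sl2_triple.s_def[OF sl2] sl2_triple.s'_def[OF sl2] sl2_triple.al_def[OF sl2]
  by (auto simp: sb_def sb'_def x_def y_def al_def fun_eq_iff)

lemma x_zero [simp]: "x i 0 = 1" and y_zero [simp]: "y i 0 = 1"
  by (simp_all add: x_def y_def)

lemma x_add: "x i s * x i t = x i (s + t)" and y_add: "y i s * y i t = y i (s + t)"
  and x_add_assoc: "x i s * (x i t * z) = x i (s + t) * z" and y_add_assoc: "y i s * (y i t * z) = y i (s + t) * z"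
  by (simp_all add: x_def y_def ep_add ep_add_assoc)

lemma x_inv [simp]: "x i t * x i (- t) = 1" "x i (- t) * x i t = 1" "x i t * (x i (- t) * z) = z" "x i (- t) * (x i t * z) = z"
  and y_inv [simp]: "y i t * y i (- t) = 1" "y i (- t) * y i t = 1" "y i t * (y i (- t) * z) = z" "y i (- t) * (y i t * z) = z"
  by (simp_all add: x_def y_def)

lemma sb_inv [simp]: "sb i * sb' i = 1" "sb' i * sb i = 1" "sb i * (sb' i * z) = z" "sb' i * (sb i * z) = z"
  by (simp_all add: sb_def sb'_def mult.assoc x_add_assoc y_add_assoc x_add y_add)

lemma sb'_x: "i \<in> I \<Longrightarrow> sb' i * x i t = y i (- t) * sb' i"
  and sb_alt: "i \<in> I \<Longrightarrow> sb i = y i 1 * x i (-1) * y i 1"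
  and bold_expand: "i \<in> I \<Longrightarrow> t \<noteq> 0 \<Longrightarrow> y i t * al i (inverse t) = x i (inverse t) * sb i * x i t"
  and x_expand: "i \<in> I \<Longrightarrow> t \<noteq> 0 \<Longrightarrow> x i t = y i (inverse t) * al i t * sb' i * y i (inverse t)"
  and y_expand: "i \<in> I \<Longrightarrow> t \<noteq> 0 \<Longrightarrow> y i t = x i (inverse t) * al i (inverse t) * sb i * x i (inverse t)"
  and al_exp: "i \<in> I \<Longrightarrow> al i (exp z) = ep (h i) z"
  and x_y: "i \<in> I \<Longrightarrow> 1 + a * t \<noteq> 0 \<Longrightarrow>
      x i a * y i t = y i (t / (1 + a * t)) * al i (1 + a * t) * x i (a / (1 + a * t))"
  using sl2_triple.s'_epE[OF sl2]
    sl2_triple.s_alt[OF sl2] sl2_triple.bold_expand[OF sl2] sl2_triple.epE_expand[OF sl2]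
    sl2_triple.epF_expand[OF sl2] sl2_triple.al_exp[OF sl2] sl2_triple.epE_epF[OF sl2]
  unfolding x_def y_def by (simp_all only: sl2_s)

lemma conj_imp_commute: "g * a * g' = b \<Longrightarrow> g' * g = 1 \<Longrightarrow> g * a = b * (g::'a)"
  by (metis mult.assoc mult_1_right)

context
  fixes i j assumes i: "i \<in> I" and j: "j \<in> I" and ij: "i \<noteq> j"
begin

text \<open>e_j, \<open>v1\<close>, \<open>v2\<close> form the \<alpha>_i-string through \<alpha>_j.
  By the Serre relations it has at most three members, and \<open>v2\<close> is nonzero only if the
  Cartan integer is -2.\<close>

definition v1 where "v1 = comm (e i) (e j)"
definition v2 where "v2 = comm (e i) v1"

lemma cartan_cases: "cartan_B n i j \<in> {0, -1, -2}"
  using ij by (auto simp: cartan_B_def)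

lemma v1_zero: "cartan_B n i j = 0 \<Longrightarrow> v1 = 0"
  using ee[of i j] i j ij by (simp add: v1_def I_def)

lemma v2_zero: "cartan_B n i j \<noteq> - 2 \<Longrightarrow> v2 = 0"
  using ee[of i j] i j ij cartan_cases by (auto simp: v1_def v2_def I_def comm_zero_right numeral_2_eq_2)

lemma v3: "comm (e i) v2 = 0"
proof -
  have "nat (1 - cartan_B n i j) \<in> {1, 2, 3}" using cartan_cases by auto
  then show ?thesis
    using ee[of i j] i j ij by (auto simp: v1_def v2_def I_def comm_zero_right numeral_eq_Suc)
qed

lemma fv0: "comm (f i) (e j) = 0"
  using ef[of j i] i j ij comm_anti[of "f i" "e j"] by (simp add: I_def)

lemma fe: "comm (f i) (e i) = - h i"
  using ef[of i i] i comm_anti[of "f i" "e i"] by (simp add: I_def)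

lemma fv1: "comm (f i) v1 = - (of_int (cartan_B n i j) *\<^sub>C e j)"
  unfolding v1_def comm_jacobi[of "f i"] fv0 fe comm_minus_left comm_zero_right
  using he[of i j] i j by (simp add: I_def)

lemma hv1: "comm (h i) v1 = (2 + of_int (cartan_B n i j)) *\<^sub>C v1"
  unfolding v1_def comm_jacobi[of "h i"]
  using he[of i i] he[of i j] i j by (simp add: I_def cartan_B_def scl_add_left)

lemma fv2: "comm (f i) v2 = - ((2 + 2 * of_int (cartan_B n i j)) *\<^sub>C v1)"
  unfolding v2_def comm_jacobi[of "f i" "e i"] fe fv1 comm_minus_right comm_scl_right
proof -
  have "(2 + 2 * of_int (cartan_B n i j)) *\<^sub>C v1 = (2 + of_int (cartan_B n i j)) *\<^sub>C v1 + of_int (cartan_B n i j) *\<^sub>C v1"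
    by (subst scl_add_left[symmetric]) (simp add: algebra_simps)
  then show "comm (- h i) v1 + - (of_int (cartan_B n i j) *\<^sub>C comm (e i) (e j)) = - ((2 + 2 * of_int (cartan_B n i j)) *\<^sub>C v1)"
    by (simp add: v1_def comm_minus_left hv1[unfolded v1_def])
qed

lemma x_v: "x i t * e j * x i (- t) = e j + t *\<^sub>C v1 + (t^2/2) *\<^sub>C v2"
  "x i t * v1 * x i (- t) = v1 + t *\<^sub>C v2"
  "x i t * v2 * x i (- t) = v2"
  unfolding x_def
  using ep_string[of "e i" "e j" v1 v2 t] ep_string[of "e i" v1 v2 0 t] ep_commute_elt[of "e i" v2 t] v3
  by (simp_all add: v1_def v2_def comm_zero_right)

lemma y_v: "y i t * e j * y i (- t) = e j"
  "y i t * v1 * y i (- t) = v1 - (t * of_int (cartan_B n i j)) *\<^sub>C e j"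
  "y i t * v2 * y i (- t) = v2 - (t * (2 + 2 * of_int (cartan_B n i j))) *\<^sub>C v1
     + (t^2 * (1 + of_int (cartan_B n i j)) * of_int (cartan_B n i j)) *\<^sub>C e j"
proof -
  show "y i t * e j * y i (- t) = e j"
    unfolding y_def by (rule ep_commute_elt) (rule fv0)
  show "y i t * v1 * y i (- t) = v1 - (t * of_int (cartan_B n i j)) *\<^sub>C e j"
    unfolding y_def using ep_string[OF fv1, of 0 t] fv0 by (simp add: comm_minus_right comm_zero_right)
  show "y i t * v2 * y i (- t) = v2 - (t * (2 + 2 * of_int (cartan_B n i j))) *\<^sub>C v1
     + (t^2 * (1 + of_int (cartan_B n i j)) * of_int (cartan_B n i j)) *\<^sub>C e j"
    unfolding y_def
    using ep_string[OF fv2, of "((2 + 2 * of_int (cartan_B n i j)) * of_int (cartan_B n i j)) *\<^sub>C e j" t] fv0 fv1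
    by (simp add: comm_minus_right algebra_simps)
qed

lemma sb_expand_conj: "sb i * a * sb' i = x i (-1) * (y i 1 * (x i (-1) * a * x i (-(-1))) * y i (-1)) * x i (-(-1))"
  by (simp add: sb_def sb'_def mult.assoc)

lemma conj_lin: "g * (a + b) * g' = g * a * g' + g * b * (g'::'a)" "g * (a - b) * g' = g * a * g' - g * b * (g'::'a)"
  "g * (- a) * g' = - (g * a * g')"
  by (simp_all add: algebra_simps)

text \<open>This and the next three lemmas: the lift of s_i reverses the string, with the signs
  needed for the braid relations.\<close>

lemma sb_e0: "cartan_B n i j = 0 \<Longrightarrow> sb i * e j * sb' i = e j"
  unfolding sb_expand_conj x_v using v1_zero v2_zero by (simp add: y_v x_v(1)[of "-1", simplified])

lemma sb_e1: assumes c: "cartan_B n i j = - 1" shows "sb i * e j * sb' i = - v1"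
proof -
  have v2: "v2 = 0" using v2_zero c by simp
  have "sb i * e j * sb' i = x i (-1) * (y i 1 * (e j - v1) * y i (-1)) * x i (-(-1))"
    unfolding sb_expand_conj x_v(1) v2 by simp
  also have "y i 1 * (e j - v1) * y i (-1) = - v1"
    unfolding conj_lin y_v c by simp
  also have "x i (-1) * (- v1) * x i (-(-1)) = - v1"
    unfolding conj_lin x_v v2 by simp
  finally show ?thesis .
qed

lemma sb_v1: assumes c: "cartan_B n i j = - 1" shows "sb i * v1 * sb' i = e j"
proof -
  have v2: "v2 = 0" using v2_zero c by simp
  have "sb i * v1 * sb' i = x i (-1) * (y i 1 * v1 * y i (-1)) * x i (-(-1))"
    unfolding sb_expand_conj x_v v2 by simp
  also have "y i 1 * v1 * y i (-1) = v1 + e j"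
    unfolding y_v c by simp
  also have "x i (-1) * (v1 + e j) * x i (-(-1)) = e j"
    unfolding conj_lin x_v v2 by simp
  finally show ?thesis .
qed

lemma sb_v1': assumes c: "cartan_B n i j = - 2" shows "sb i * v1 * sb' i = - v1"
proof -
  have "sb i * v1 * sb' i = x i (-1) * (y i 1 * (v1 - v2) * y i (-1)) * x i (-(-1))"
    unfolding sb_expand_conj x_v by simp
  also have "y i 1 * (v1 - v2) * y i (-1) = - v1 - v2"
  proof -
    have "2 *\<^sub>C v1 = v1 + v1" using scl_add_left[of 1 1] by simp
    then show ?thesis unfolding conj_lin y_v c by simp
  qed
  also have "x i (-1) * (- v1 - v2) * x i (-(-1)) = - v1"
    unfolding conj_lin x_v by simp
  finally show ?thesis .
qed

definition W where "W = {a *\<^sub>C e j + b *\<^sub>C v1 + c *\<^sub>C v2 | a b c. True}"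

lemma W_I: "a *\<^sub>C e j + b *\<^sub>C v1 + c *\<^sub>C v2 \<in> W"
  unfolding W_def by blast

lemma W_x: "w \<in> W \<Longrightarrow> x i t * w * x i (- t) \<in> W"
proof -
  assume "w \<in> W"
  then obtain a b c where w: "w = a *\<^sub>C e j + b *\<^sub>C v1 + c *\<^sub>C v2" by (auto simp: W_def)
  have "x i t * w * x i (- t) = a *\<^sub>C e j + (a * t + b) *\<^sub>C v1 + (a * (t^2/2) + b * t + c) *\<^sub>C v2"
    unfolding w conj_lin scl_conj x_v by (simp add: scl_add_left scl_add_right)
  then show ?thesis using W_I by simp
qed

lemma W_y: "w \<in> W \<Longrightarrow> y i t * w * y i (- t) \<in> W"
proof -
  assume "w \<in> W"
  then obtain a b c where w: "w = a *\<^sub>C e j + b *\<^sub>C v1 + c *\<^sub>C v2" by (auto simp: W_def)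
  let ?A = "of_int (cartan_B n i j) :: complex"
  have "y i t * w * y i (- t) = (a - b * (t * ?A) + c * (t^2 * (1 + ?A) * ?A)) *\<^sub>C e j + (b - c * (t * (2 + 2 * ?A))) *\<^sub>C v1 + c *\<^sub>C v2"
    unfolding w conj_lin scl_conj y_v by (simp add: scl_add_left scl_add_right scl_diff_left scl_diff_right)
  then show ?thesis using W_I by simp
qed

end

lemma v1_anti: "i \<in> I \<Longrightarrow> j \<in> I \<Longrightarrow> i \<noteq> j \<Longrightarrow> v1 i j = - v1 j i"
  by (simp add: v1_def comm_anti[of "e i" "e j"])

lemma cartan_adj:
  "i \<in> I \<Longrightarrow> Suc i \<in> I \<Longrightarrow> cartan_B n i (Suc i) = -1"
  "i \<in> I \<Longrightarrow> Suc i < n \<Longrightarrow> cartan_B n (Suc i) i = -1"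
  "cartan_B n n (n - 1) = -2"
  using n2 by (auto simp: cartan_B_def I_def)

lemma conj_conj: "g * (k * a * k') * g' = (g * k) * a * (k' * (g'::'a))"
  by (simp add: mult.assoc)

text \<open>s_i s_(i+1) takes \<alpha>_i to \<alpha>_(i+1). What matters is that e_i goes to e_(i+1)
  with coefficient exactly 1: the signs of \<open>sb_e1\<close> and \<open>v1_anti\<close>
  cancel.\<close>

lemma braid3_e:
  assumes "i \<in> I" "Suc i < n"
  shows "sb i * sb (Suc i) * e i * (sb' (Suc i) * sb' i) = e (Suc i)"
    "sb (Suc i) * sb i * e (Suc i) * (sb' i * sb' (Suc i)) = e i"
proof -
  have S: "Suc i \<in> I" "i \<noteq> Suc i" using assms by (auto simp: I_def)
  have "sb i * sb (Suc i) * e i * (sb' (Suc i) * sb' i) = sb i * (sb (Suc i) * e i * sb' (Suc i)) * sb' i"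
    by (rule conj_conj[symmetric])
  also have "sb (Suc i) * e i * sb' (Suc i) = v1 i (Suc i)"
    using sb_e1[of "Suc i" i] S assms cartan_adj(2) v1_anti[of i "Suc i"] by simp
  also have "sb i * v1 i (Suc i) * sb' i = e (Suc i)"
    using sb_v1[of i "Suc i"] S assms cartan_adj(1) by simp
  finally show "sb i * sb (Suc i) * e i * (sb' (Suc i) * sb' i) = e (Suc i)" .
  have "sb (Suc i) * sb i * e (Suc i) * (sb' i * sb' (Suc i)) = sb (Suc i) * (sb i * e (Suc i) * sb' i) * sb' (Suc i)"
    by (rule conj_conj[symmetric])
  also have "sb i * e (Suc i) * sb' i = v1 (Suc i) i"
    using sb_e1[of i "Suc i"] S assms cartan_adj(1) v1_anti[of i "Suc i"] by simp
  also have "sb (Suc i) * v1 (Suc i) i * sb' (Suc i) = e i"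
    using sb_v1[of "Suc i" i] S assms cartan_adj(2) by simp
  finally show "sb (Suc i) * sb i * e (Suc i) * (sb' i * sb' (Suc i)) = e i" .
qed

lemma braid4_e: "sb (n-1) * sb n * sb (n-1) * e n * (sb' (n-1) * sb' n * sb' (n-1)) = e n"
proof -
  define m where "m = n - 1"
  have m: "m \<in> I" "n \<in> I" "m \<noteq> n" "Suc m = n" using n2 by (auto simp: I_def m_def)
  have c: "cartan_B n m n = -1" "cartan_B n n m = -2"
    using cartan_adj(1)[of m] cartan_adj(3) m by (simp_all add: m_def)
  have "sb m * sb n * sb m * e n * (sb' m * sb' n * sb' m) = sb m * (sb n * (sb m * e n * sb' m) * sb' n) * sb' m"
    by (simp add: mult.assoc)
  also have "sb m * e n * sb' m = v1 n m"
    using sb_e1[OF m(1,2,3) c(1)] v1_anti[OF m(1,2,3)] by simp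
  also have "sb n * v1 n m * sb' n = v1 m n"
    using sb_v1'[OF m(2,1) _ c(2)] m(3) v1_anti[OF m(1,2,3)] by simp
  also have "sb m * v1 m n * sb' m = e n"
    by (rule sb_v1[OF m(1,2,3) c(1)])
  finally show ?thesis by (simp add: m_def)
qed

text \<open>The Chevalley involution. It fixes the lifts, so that every conjugation formula for the
  e_i gives one for the f_i.\<close>

lemma dual: "chevalley_B scl n (\<lambda>i. - f i) (\<lambda>i. - e i) (\<lambda>i. - h i)"
proof unfold_locales
  have "(comm (- a) ^^ k) (- b) \<in> {(comm a ^^ k) b, - ((comm a ^^ k) b)}" for a b :: 'a and k
    by (induction k) (auto simp: comm_minus_left comm_minus_right)
  then have neg: "(comm a ^^ k) b = 0 \<Longrightarrow> (comm (- a) ^^ k) (- b) = 0" for a b :: 'a and k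
    by (metis empty_iff insert_iff neg_equal_0_iff_equal)
  fix i j assume ij: "i \<in> {1..n}" "j \<in> {1..n}"
  show "comm (- h i) (- h j) = 0"
    using hh[OF ij] by (simp add: comm_minus_left comm_minus_right)
  show "comm (- h i) (- f j) = of_int (cartan_B n i j) *\<^sub>C - f j"
    using hf[OF ij] by (simp add: comm_minus_left comm_minus_right)
  show "comm (- h i) (- e j) = - (of_int (cartan_B n i j) *\<^sub>C - e j)"
    using he[OF ij] by (simp add: comm_minus_left comm_minus_right)
  show "comm (- f i) (- e j) = (if i = j then - h i else 0)"
    using ef[OF ij(2,1)] comm_anti[of "f i" "e j"] by (simp add: comm_minus_left comm_minus_right)
  show "(comm (- f i) ^^ nat (1 - cartan_B n i j)) (- f j) = 0" if "i \<noteq> j"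
    by (rule neg[OF ff[OF ij that]])
  show "(comm (- e i) ^^ nat (1 - cartan_B n i j)) (- e j) = 0" if "i \<noteq> j"
    by (rule neg[OF ee[OF ij that]])
qed (rule n2)

lemma dual_sb:
  assumes "i \<in> I"
  shows "chevalley_B.sb scl (\<lambda>i. - f i) (\<lambda>i. - e i) i = sb i"
    "chevalley_B.sb' scl (\<lambda>i. - f i) (\<lambda>i. - e i) i = sb' i"
proof -
  interpret d: chevalley_B scl n "\<lambda>i. - f i" "\<lambda>i. - e i" "\<lambda>i. - h i" by (rule dual)
  show s: "d.sb i = sb i"
    unfolding d.sb_def d.x_def d.y_def sb_alt[OF assms] x_def y_def by (simp add: ep_neg)
  have "d.sb' i * sb i = 1" using d.sb_inv(2)[of i] by (simp add: s)
  then show "d.sb' i = sb' i"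
    by (rule inverse_unique_mult[OF sb_inv(1)])
qed

text \<open>The lift of s_i is built from e_i and f_i alone, so whatever conjugates these to e_j and
  f_j conjugates the lifts. All braid relations are instances.\<close>

lemma commute_sb:
  assumes "g * g' = 1" "g' * g = 1" "g * e i * g' = e j" "g * f i * g' = f j"
  shows "g * sb i = sb j * g"
proof -
  have "g * x i t * g' = x j t" "g * y i t * g' = y j t" for t
    using assms by (simp_all add: x_def y_def ep_conj)
  then have c: "g * x i t = x j t * g" "g * y i t = y j t * g" for t
    using assms(2) by (metis conj_imp_commute)+
  then have "g * (x i t * z) = x j t * (g * z)" "g * (y i t * z) = y j t * (g * z)" for t z
    by (metis mult.assoc)+
  with c show ?thesis by (simp add: sb_def mult.assoc)
qed

lemma braid_far:
  assumes "1 \<le> i" "Suc i < j" "j \<le> n"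
  shows "sb i * sb j = sb j * sb i"
proof -
  interpret d: chevalley_B scl n "\<lambda>i. - f i" "\<lambda>i. - e i" "\<lambda>i. - h i" by (rule dual)
  have I: "i \<in> I" "j \<in> I" "i \<noteq> j" "cartan_B n i j = 0" using assms by (auto simp: I_def cartan_B_def)
  have "sb i * e j * sb' i = e j" using sb_e0 I by simp
  moreover have "sb i * f j * sb' i = f j"
    using d.sb_e0[of i j] I unfolding d.I_def I_def by (simp add: dual_sb I_def)
  ultimately show ?thesis by (intro commute_sb) simp_all
qed

lemma braid3:
  assumes "1 \<le> i" "Suc i < n"
  shows "sb i * sb (Suc i) * sb i = sb (Suc i) * sb i * sb (Suc i)"
proof -
  interpret d: chevalley_B scl n "\<lambda>i. - f i" "\<lambda>i. - e i" "\<lambda>i. - h i" by (rule dual)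
  have I: "i \<in> I" "Suc i \<in> I" using assms by (auto simp: I_def)
  have dI: "i \<in> d.I" using assms by (auto simp: d.I_def)
  have "sb i * sb (Suc i) * e i * (sb' (Suc i) * sb' i) = e (Suc i)" using braid3_e I assms by simp
  moreover have "sb i * sb (Suc i) * f i * (sb' (Suc i) * sb' i) = f (Suc i)"
    using d.braid3_e(1)[OF dI assms(2)] I by (simp add: dual_sb)
  ultimately have "(sb i * sb (Suc i)) * sb i = sb (Suc i) * (sb i * sb (Suc i))"
    by (intro commute_sb) (simp_all add: mult.assoc)
  then show ?thesis by (simp add: mult.assoc)
qed

lemma braid4: "sb (n-1) * sb n * sb (n-1) * sb n = sb n * sb (n-1) * sb n * sb (n-1)"
proof -
  interpret d: chevalley_B scl n "\<lambda>i. - f i" "\<lambda>i. - e i" "\<lambda>i. - h i" by (rule dual)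
  have I: "n - 1 \<in> I" "n \<in> I" using n2 by (auto simp: I_def)
  have "sb (n-1) * sb n * sb (n-1) * f n * (sb' (n-1) * sb' n * sb' (n-1)) = f n"
    using d.braid4_e I by (simp add: dual_sb)
  then have "(sb (n-1) * sb n * sb (n-1)) * sb n = sb n * (sb (n-1) * sb n * sb (n-1))"
    using braid4_e by (intro commute_sb) (simp_all add: mult.assoc)
  then show ?thesis by (simp add: mult.assoc)
qed

definition lift where "lift r = prod_list (map sb r)"

lemma lift_simps [simp]: "lift [] = 1" "lift (i # r) = sb i * lift r" "lift (r @ r') = lift r * lift r'"
  by (simp_all add: lift_def)

lemma lift_unique:
  "redu n r \<Longrightarrow> redu n r' \<Longrightarrow> wact n r = wact n r' \<Longrightarrow> lift r = lift r'"
  unfolding lift_def using n2 by (intro matsumoto) (auto intro: braid_far braid3 braid4 simp del: One_nat_def)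

end


section \<open>Unipotent subgroups, minimal parabolics and the torus\<close>

context chevalley_B
begin

definition U where "U = gen (\<Union>i\<in>I. range (x i))"
definition Um where "Um = gen (\<Union>i\<in>I. range (y i))"
definition G where "G = gen ((\<Union>i\<in>I. range (x i)) \<union> (\<Union>i\<in>I. range (y i)))"
definition Sg where "Sg i = gen (range (x i) \<union> range (y i))"

lemma U_I [intro]: "i \<in> I \<Longrightarrow> x i t \<in> U" "1 \<in> U" "u \<in> U \<Longrightarrow> v \<in> U \<Longrightarrow> u * v \<in> U"
  and Um_I [intro]: "i \<in> I \<Longrightarrow> y i t \<in> Um" "1 \<in> Um" "u \<in> Um \<Longrightarrow> v \<in> Um \<Longrightarrow> u * v \<in> Um"
  and G_I [intro]: "i \<in> I \<Longrightarrow> x i t \<in> G" "i \<in> I \<Longrightarrow> y i t \<in> G" "1 \<in> G" "u \<in> G \<Longrightarrow> v \<in> G \<Longrightarrow> u * v \<in> G"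
  and Sg_I [intro]: "x i t \<in> Sg i" "y i t \<in> Sg i" "1 \<in> Sg i" "u \<in> Sg i \<Longrightarrow> v \<in> Sg i \<Longrightarrow> u * v \<in> Sg i"
  unfolding U_def Um_def G_def Sg_def by (blast intro: gen_base gen_mult gen_one)+

lemma U_G: "u \<in> U \<Longrightarrow> u \<in> G" and Um_G: "v \<in> Um \<Longrightarrow> v \<in> G"
  unfolding U_def Um_def G_def
  using gen_mono[of "\<Union>i\<in>I. range (x i)" "(\<Union>i\<in>I. range (x i)) \<union> (\<Union>i\<in>I. range (y i))"]
    gen_mono[of "\<Union>i\<in>I. range (y i)" "(\<Union>i\<in>I. range (x i)) \<union> (\<Union>i\<in>I. range (y i))"] by auto

lemma Sg_G: "i \<in> I \<Longrightarrow> m \<in> Sg i \<Longrightarrow> m \<in> G"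
  unfolding Sg_def G_def
  using gen_mono[of "range (x i) \<union> range (y i)" "(\<Union>i\<in>I. range (x i)) \<union> (\<Union>i\<in>I. range (y i))"] by blast

lemma sb_Sg [intro]: "sb i \<in> Sg i" "sb' i \<in> Sg i"
  by (auto simp: sb_def sb'_def)

lemma sb_G [intro]: "i \<in> I \<Longrightarrow> sb i \<in> G" "i \<in> I \<Longrightarrow> sb' i \<in> G"
  using Sg_G by blast+

lemma U_inverse: "u \<in> U \<Longrightarrow> \<exists>v\<in>U. u * v = 1 \<and> v * u = 1"
  unfolding U_def
proof (rule gen_inverse)
  fix a assume "a \<in> (\<Union>i\<in>I. range (x i))"
  then obtain i t where i: "i \<in> I" "a = x i t" by blast
  show "\<exists>b\<in>(\<Union>i\<in>I. range (x i)). a * b = 1 \<and> b * a = 1"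
    using i by (intro bexI[of _ "x i (- t)"]) auto
qed

lemma G_inverse: "u \<in> G \<Longrightarrow> \<exists>v\<in>G. u * v = 1 \<and> v * u = 1"
  unfolding G_def
proof (rule gen_inverse)
  fix a assume "a \<in> (\<Union>i\<in>I. range (x i)) \<union> (\<Union>i\<in>I. range (y i))"
  then obtain i t where i: "i \<in> I" "a = x i t \<or> a = y i t" by blast
  then have "a * x i (- t) = 1 \<and> x i (- t) * a = 1 \<or> a * y i (- t) = 1 \<and> y i (- t) * a = 1" by auto
  then show "\<exists>b\<in>(\<Union>i\<in>I. range (x i)) \<union> (\<Union>i\<in>I. range (y i)). a * b = 1 \<and> b * a = 1"
    using i(1) by blast
qed

lemma Sg_inverse: "u \<in> Sg i \<Longrightarrow> \<exists>v\<in>Sg i. u * v = 1 \<and> v * u = 1"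
  unfolding Sg_def
proof (rule gen_inverse)
  fix a assume "a \<in> range (x i) \<union> range (y i)"
  then obtain t where "a = x i t \<or> a = y i t" by blast
  then have "a * x i (- t) = 1 \<and> x i (- t) * a = 1 \<or> a * y i (- t) = 1 \<and> y i (- t) * a = 1" by auto
  then show "\<exists>b\<in>range (x i) \<union> range (y i). a * b = 1 \<and> b * a = 1" by blast
qed

text \<open>Since the root strings have length at most three, their exponentials are products of conjugates
  of the \<open>x\<^sub>j\<close>.  Together with \<open>W\<close> being stable under the \<open>SL\<^sub>2\<close> of the root \<open>\<alpha>\<^sub>i\<close> this shows that
  conjugation by this \<open>SL\<^sub>2\<close> maps \<open>x\<^sub>j\<close> into \<open>U\<close>.\<close>

lemma x_ep_e: assumes "i \<in> I" "j \<in> I" "i \<noteq> j"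
  shows "ep (e j + a *\<^sub>C v1 i j + (a^2/2) *\<^sub>C v2 i j) t \<in> U"
proof -
  have "ep (e j + a *\<^sub>C v1 i j + (a^2/2) *\<^sub>C v2 i j) t = x i a * x j t * x i (- a)"
    unfolding x_v(1)[OF assms, symmetric] by (simp add: ep_conj x_def)
  then show ?thesis using assms by auto
qed

lemma v1_v0: assumes "i \<in> I" "j \<in> I" "i \<noteq> j" "cartan_B n j i \<noteq> - 2"
  shows "comm (e j) (v1 i j) = 0"
proof -
  have "comm (e j) (v1 j i) = 0" using v2_zero[of j i] assms by (simp add: v2_def)
  then show ?thesis using v1_anti[of i j] assms by (simp add: comm_minus_right)
qed

lemma v2_v0: assumes "i \<in> I" "j \<in> I" "i \<noteq> j" "cartan_B n j i \<noteq> - 2"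
  shows "comm (e j) (v2 i j) = 0" "comm (v1 i j) (v2 i j) = 0"
proof -
  have c: "comm (e j) (v1 i j) = 0" by (rule v1_v0[OF assms])
  have ji: "comm (e j) (e i) = - v1 i j" using comm_anti[of "e j" "e i"] assms by (simp add: v1_def)
  have "comm (e j) (v2 i j) = comm (comm (e j) (e i)) (v1 i j) + comm (e i) (comm (e j) (v1 i j))"
    unfolding v2_def[OF assms(1,2,3)] by (rule comm_jacobi)
  also have "\<dots> = 0" by (simp add: c comm_zero_right ji comm_minus_left comm_self)
  finally show z: "comm (e j) (v2 i j) = 0" .
  have "0 = comm (e i) (comm (e j) (v2 i j))" by (simp add: z comm_zero_right)
  also have "\<dots> = comm (v1 i j) (v2 i j) + comm (e j) (comm (e i) (v2 i j))"
    unfolding comm_jacobi[of "e i"] by (simp add: v1_def[OF assms(1,2,3)])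
  finally show "comm (v1 i j) (v2 i j) = 0" using v3[OF assms(1,2,3)] by (simp add: comm_zero_right)
qed

lemma comm_sym0: "comm a b = 0 \<Longrightarrow> comm b a = (0::'a)"
  using comm_anti[of a b] by simp

text \<open>The condition on the Cartan integer makes e_j, \<open>v1\<close> and \<open>v2\<close>
  commute, so the exponential of a conjugate of e_j splits into three factors.\<close>

lemma ep_v_short:
  assumes ij: "i \<in> I" "j \<in> I" "i \<noteq> j" "cartan_B n j i \<noteq> - 2"
  shows "ep (v1 i j) t \<in> U" "ep (v2 i j) t \<in> U"
proof -
  have Z: "ep (v1 i j) (a * b) * ep (v2 i j) (a^2/2 * b) \<in> U" for a b
  proof -
    have "ep (e j + a *\<^sub>C v1 i j + (a^2/2) *\<^sub>C v2 i j) b = ep (e j) b * ep (v1 i j) (a * b) * ep (v2 i j) (a^2/2 * b)"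
      by (subst ep_sum, simp add: comm_add_left v2_v0[OF ij],
          subst ep_sum, simp add: v1_v0[OF ij], simp add: ep_scl)
    then have "ep (v1 i j) (a * b) * ep (v2 i j) (a^2/2 * b) =
        x j (- b) * ep (e j + a *\<^sub>C v1 i j + (a^2/2) *\<^sub>C v2 i j) b"
      by (simp add: mult.assoc x_def)
    also have "\<dots> \<in> U" using x_ep_e[OF ij(1-3)] ij by auto
    finally show ?thesis .
  qed
  \<comment> \<open>Multiplying the elements for a = 1 and a = -1 cancels the \<open>v1\<close>
    parts and adds the \<open>v2\<close> parts.\<close>
  have v2: "ep (v2 i j) b \<in> U" for b
  proof -
    have "(ep (v1 i j) (1 * b) * ep (v2 i j) (1^2/2 * b)) * (ep (v1 i j) (-1 * b) * ep (v2 i j) ((-1)^2/2 * b)) \<in> U"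
      using Z[of 1 b] Z[of "-1" b] by blast
    also have "(ep (v1 i j) (1 * b) * ep (v2 i j) (1^2/2 * b)) * (ep (v1 i j) (-1 * b) * ep (v2 i j) ((-1)^2/2 * b))
      = ep (v1 i j) b * (ep (v2 i j) (b/2) * ep (v1 i j) (- b)) * ep (v2 i j) (b/2)"
      by (simp add: mult.assoc)
    also have "ep (v2 i j) (b/2) * ep (v1 i j) (- b) = ep (v1 i j) (- b) * ep (v2 i j) (b/2)"
      using comm_sym0[OF v2_v0(2)[OF ij]] by (rule ep_comm)
    also have "ep (v1 i j) b * (ep (v1 i j) (- b) * ep (v2 i j) (b/2)) * ep (v2 i j) (b/2) = ep (v2 i j) b"
      by (simp add: mult.assoc ep_add)
    finally show ?thesis .
  qed
  then show "ep (v2 i j) t \<in> U" .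
  have "ep (v1 i j) t = (ep (v1 i j) (1 * t) * ep (v2 i j) (1^2/2 * t)) * ep (v2 i j) (- (t / 2))"
    by (simp add: mult.assoc)
  also have "\<dots> \<in> U" using Z[of 1 t] v2 by blast
  finally show "ep (v1 i j) t \<in> U" .
qed

lemma cartan_not_both: "i \<noteq> j \<Longrightarrow> cartan_B n i j = -2 \<Longrightarrow> cartan_B n j i \<noteq> -2"
  by (auto simp: cartan_B_def split: if_splits)

lemma ep_v1_U:
  assumes ij: "i \<in> I" "j \<in> I" "i \<noteq> j"
  shows "ep (v1 i j) t \<in> U"
proof (cases "cartan_B n j i = - 2")
  case True
  then have "cartan_B n i j \<noteq> - 2" using cartan_not_both[of j i] ij by simp
  then have "ep (v1 j i) (- t) \<in> U" using ep_v_short(1)[of j i] ij by simp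
  then show ?thesis using v1_anti[OF ij] by (simp add: ep_neg)
next
  case False
  then show ?thesis using ep_v_short(1) ij by simp
qed

lemma ep_W_U:
  assumes ij: "i \<in> I" "j \<in> I" "i \<noteq> j" and w: "w \<in> W i j"
  shows "ep w t \<in> U"
proof -
  obtain a b c where w: "w = a *\<^sub>C e j + b *\<^sub>C v1 i j + c *\<^sub>C v2 i j" using w W_def[OF ij] by auto
  show ?thesis
  proof (cases "cartan_B n i j = -2")
    case True
    then have "cartan_B n j i \<noteq> -2" by (rule cartan_not_both[OF ij(3)])
    note v = v1_v0[OF ij this] v2_v0[OF ij this] ep_v_short[OF ij this]
    have "ep w t = ep (e j) (a * t) * ep (v1 i j) (b * t) * ep (v2 i j) (c * t)"
      unfolding w
      by (subst ep_sum, simp add: comm_add_left v,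
          subst ep_sum, simp add: v, simp add: ep_scl)
    then show ?thesis using v ij by (auto simp flip: x_def)
  next
    case False
    then have v2: "v2 i j = 0" using v2_zero ij by simp
    show ?thesis
    proof (cases "a = 0")
      case True
      then show ?thesis unfolding w v2 using ep_v1_U[OF ij] by (simp add: ep_scl)
    next
      case False
      \<comment> \<open>This is a multiple of the conjugate of e_j by x_i(b/a); the quadratic term
        may be added because \<open>v2\<close> is zero here.\<close>
      have "w = a *\<^sub>C (e j + (b / a) *\<^sub>C v1 i j + ((b / a)^2/2) *\<^sub>C v2 i j)"
        unfolding w v2 using False by (simp add: scl_add_right)
      then show ?thesis using x_ep_e[OF ij] by (simp add: ep_scl)
    qed
  qed
qed

lemma conj_W:
  assumes ij: "i \<in> I" "j \<in> I" "i \<noteq> j"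
  shows "m \<in> Sg i \<Longrightarrow> m * m' = 1 \<Longrightarrow> m' * m = 1 \<Longrightarrow> w \<in> W i j \<Longrightarrow> m * w * m' \<in> W i j"
  unfolding Sg_def
proof (induction m arbitrary: m' rule: gen.induct)
  case gen_one
  then show ?case by simp
next
  case (gen_left a u)
  then obtain u' where u': "u' \<in> Sg i" "u * u' = 1" "u' * u = 1" using Sg_inverse[of u i] by (auto simp: Sg_def)
  obtain t where "a = x i t \<or> a = y i t" using gen_left.hyps by blast
  then obtain a' where a': "a * a' = 1" "a' * a = 1" "\<And>w. w \<in> W i j \<Longrightarrow> a * w * a' \<in> W i j"
    using W_x[OF ij] W_y[OF ij] by (metis x_inv(1,2) y_inv(1,2))
  have "(a * u) * (u' * a') = 1" using a' u' by (metis mult.assoc mult.left_neutral)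
  then have "m' = u' * a'" using inverse_unique_mult gen_left.prems by metis
  then have "a * u * w * m' = a * (u * w * u') * a'" by (simp add: mult.assoc)
  then show ?case using a' gen_left.IH[OF u'(2,3)] gen_left.prems by simp
qed

text \<open>The unipotent radical of the minimal parabolic of \<alpha>_i, described as the part of U
  that stays in U under conjugation by the whole SL_2 of \<alpha>_i. An inverse is expressed by a
  second variable m'.\<close>

definition N where "N i = {u \<in> U. \<forall>m\<in>Sg i. \<forall>m'. m * m' = 1 \<longrightarrow> m' * m = 1 \<longrightarrow> m * u * m' \<in> U}"

lemma N_U: "u \<in> N i \<Longrightarrow> u \<in> U"
  by (simp add: N_def)

lemma x_N: assumes ij: "i \<in> I" "j \<in> I" "i \<noteq> j" shows "x j t \<in> N i"
  unfolding N_def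
proof (intro CollectI conjI ballI allI impI)
  show "x j t \<in> U" using ij by blast
  fix m m' assume m: "m \<in> Sg i" "m * m' = 1" "m' * m = 1"
  have "e j \<in> W i j" using W_I[OF ij, of 1 0 0] by simp
  then have "m * e j * m' \<in> W i j" by (rule conj_W[OF ij m])
  then show "m * x j t * m' \<in> U" using ep_W_U[OF ij] m by (simp add: x_def ep_conj)
qed

lemma N_one: "1 \<in> N i"
  by (auto simp: N_def)

lemma N_mult: "u \<in> N i \<Longrightarrow> v \<in> N i \<Longrightarrow> u * v \<in> N i"
  unfolding N_def by (auto simp flip: conj_mult)

lemma N_conj:
  assumes "u \<in> N i" "k \<in> Sg i" "k * k' = 1" "k' * k = 1"
  shows "k * u * k' \<in> N i"
  unfolding N_def
proof (intro CollectI conjI ballI allI impI)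
  show "k * u * k' \<in> U" using assms by (auto simp: N_def)
  fix m m' assume m: "m \<in> Sg i" "m * m' = 1" "m' * m = 1"
  have "(m * k) * (k' * m') = 1" "(k' * m') * (m * k) = 1"
    using assms m by (metis mult.assoc mult.left_neutral)+
  then have "(m * k) * u * (k' * m') \<in> U" using assms(1,2) m(1) by (auto simp: N_def)
  then show "m * (k * u * k') * m' \<in> U" by (simp add: mult.assoc)
qed

text \<open>A generator x_j with j distinct from i is moved past x_i(a) at the price of a
  conjugation, under which \<open>N i\<close> is stable.\<close>

lemma U_decomp:
  assumes "u \<in> U" "i \<in> I"
  obtains a v where "v \<in> N i" "u = x i a * v"
  using assms(1) unfolding U_def
proof (induction u arbitrary: thesis rule: gen.induct)
  case gen_one
  then show ?case using N_one[of i] gen_one[of 1 0] by simp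
next
  case (gen_left b u)
  then obtain a v where v: "v \<in> N i" "u = x i a * v" by blast
  obtain j t where j: "j \<in> I" "b = x j t" using gen_left.hyps by blast
  show ?case
  proof (cases "j = i")
    case True
    then show ?thesis using v j gen_left.prems[of v "t + a"] by (simp add: x_add_assoc)
  next
    case False
    then have "x i (- a) * x j t * x i a \<in> N i"
      using x_N[OF assms(2) j(1)] N_conj[of "x j t" i "x i (- a)" "x i a"] by auto
    then have "x i (- a) * x j t * x i a * v \<in> N i" using v(1) by (rule N_mult)
    moreover have "b * u = x i a * (x i (- a) * x j t * x i a * v)" by (simp add: v j mult.assoc)
    ultimately show ?thesis using gen_left.prems by blast
  qed
qed

lemma U_decomp':
  assumes "u \<in> U" "i \<in> I"
  obtains a v where "v \<in> N i" "u = v * x i a"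
proof -
  obtain a v where "v \<in> N i" "u = x i a * v" using U_decomp[OF assms] .
  moreover have "x i a * v * x i (- a) \<in> N i" using N_conj[of v i "x i a" "x i (-a)"] \<open>v \<in> N i\<close> by auto
  ultimately show ?thesis using that[of "x i a * v * x i (- a)" a] by (simp add: mult.assoc)
qed

subsection \<open>The torus\<close>

text \<open>The torus is parametrised by logarithms, so that \<Lambda>_k takes the value exp (z k);
  \<open>rt i z\<close> is the differential of \<alpha>_i.\<close>

definition tor where "tor z = exp (\<Sum>j\<in>I. z j *\<^sub>C h j)"
definition rt where "rt i z = (\<Sum>j\<in>I. z j * of_int (cartan_B n j i))"

lemma comm_sum_left: "comm (\<Sum>j\<in>S. g j) a = (\<Sum>j\<in>S. comm (g j) a)"
  by (simp add: comm_def sum_distrib_left sum_distrib_right sum_subtractf)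

lemma comm_sum_right: "comm a (\<Sum>j\<in>S. g j) = (\<Sum>j\<in>S. comm a (g j))"
  by (simp add: comm_def sum_distrib_left sum_distrib_right sum_subtractf)

lemma tor_add: "tor z * tor w = tor (\<lambda>j. z j + w j)"
proof -
  have "comm (\<Sum>j\<in>I. z j *\<^sub>C h j) (\<Sum>j\<in>I. w j *\<^sub>C h j) = 0"
    by (simp add: comm_sum_left comm_sum_right hh I_def)
  then have "exp (\<Sum>j\<in>I. z j *\<^sub>C h j) * exp (\<Sum>j\<in>I. w j *\<^sub>C h j) = exp ((\<Sum>j\<in>I. z j *\<^sub>C h j) + (\<Sum>j\<in>I. w j *\<^sub>C h j))"
    by (simp add: exp_add_commuting comm_eq_0_iff)
  then show ?thesis by (simp add: tor_def scl_add_left sum.distrib)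
qed

lemma tor_zero: "tor (\<lambda>j. 0) = 1"
  by (simp add: tor_def)

lemma tor_inv [simp]: "tor z * tor (\<lambda>j. - z j) = 1" "tor (\<lambda>j. - z j) * tor z = 1"
  by (simp_all add: tor_add tor_zero)

lemma tor_e: assumes "i \<in> I"
  shows "comm (\<Sum>j\<in>I. z j *\<^sub>C h j) (e i) = rt i z *\<^sub>C e i"
    "comm (\<Sum>j\<in>I. z j *\<^sub>C h j) (f i) = - (rt i z *\<^sub>C f i)"
  using assms by (simp_all add: comm_sum_left he hf I_def rt_def scl_sum_left sum_negf)

lemma tor_x: "i \<in> I \<Longrightarrow> tor z * x i t = x i (exp (rt i z) * t) * tor z"
  and tor_y: "i \<in> I \<Longrightarrow> tor z * y i t = y i (exp (- rt i z) * t) * tor z"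
proof -
  define S where "S = (\<Sum>j\<in>I. z j *\<^sub>C h j)"
  have t: "tor z = ep S 1" "tor (\<lambda>j. - z j) = ep S (-1)"
    by (simp_all add: tor_def S_def ep_def sum_negf)
  assume i: "i \<in> I"
  have "ep S 1 * e i * ep S (- 1) = exp (1 * rt i z) *\<^sub>C e i"
    by (rule ep_eigen) (simp add: S_def tor_e i)
  then have "tor z * x i t * tor (\<lambda>j. - z j) = x i (exp (rt i z) * t)"
    by (simp add: x_def ep_conj t ep_scl)
  then show "tor z * x i t = x i (exp (rt i z) * t) * tor z" by (rule conj_imp_commute) simp
  have "ep S 1 * f i * ep S (- 1) = exp (1 * (- rt i z)) *\<^sub>C f i"
    by (rule ep_eigen) (simp add: S_def tor_e i)
  then have "tor z * y i t * tor (\<lambda>j. - z j) = y i (exp (- rt i z) * t)"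
    by (simp add: y_def ep_conj t ep_scl)
  then show "tor z * y i t = y i (exp (- rt i z) * t) * tor z" by (rule conj_imp_commute) simp
qed

lemma al_tor: "i \<in> I \<Longrightarrow> al i t = tor (\<lambda>j. if j = i then Ln t else 0)"
proof -
  assume "i \<in> I"
  then have "(\<Sum>j\<in>I. (if j = i then Ln t else 0) *\<^sub>C h j) = Ln t *\<^sub>C h i"
    by (subst sum.remove[of I i]) (auto simp: I_def)
  then show ?thesis by (simp add: al_def tor_def ep_def)
qed

text \<open>exp(r w) for a cocharacter w in orthonormal coordinates: the coefficient of w at the
  coroot h_j is \<Lambda>_j(w). In this form the Weyl group acts through \<open>sr\<close>.\<close>

definition tau where "tau r w = tor (\<lambda>j. r * Lam n j w)"

lemma rt_tau: "i \<in> I \<Longrightarrow> rt i (\<lambda>j. r * Lam n j w) = r * of_int (alpha n i w)"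
  using Lam_cartan[OF n2, of i w] by (simp add: rt_def I_def mult.assoc flip: sum_distrib_left)

lemma tau_x: "i \<in> I \<Longrightarrow> tau r w * x i t = x i (exp (r * of_int (alpha n i w)) * t) * tau r w"
  and tau_y: "i \<in> I \<Longrightarrow> tau r w * y i t = y i (exp (- (r * of_int (alpha n i w))) * t) * tau r w"
  unfolding tau_def using tor_x tor_y by (simp_all add: rt_tau)

lemma tau_inv [simp]: "tau r w * tau (- r) w = 1" "tau (- r) w * tau r w = 1"
  "tau r w * (tau (- r) w * z) = z" "tau (- r) w * (tau r w * z) = z"
  by (simp_all add: tau_def flip: mult.assoc)

lemma sb_h: assumes i: "i \<in> I" and j: "j \<in> I"
  shows "sb i * h j * sb' i = h j - of_int (cartan_B n j i) *\<^sub>C h i"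
proof -
  \<comment> \<open>The component of h_j on which \<alpha>_i vanishes. It commutes with e_i and f_i,
    hence with the lift.\<close>
  define K where "K = h j - (of_int (cartan_B n j i) / 2) *\<^sub>C h i"
  have "comm K (e i) = 0" "comm K (f i) = 0"
    using he[of j i] he[of i i] hf[of j i] hf[of i i] i j
    by (simp_all add: K_def comm_diff_left I_def cartan_B_def[of n i i])
  then have "x i t * K * x i (- t) = K" "y i t * K * y i (- t) = K" for t
    unfolding x_def y_def by (auto intro!: ep_commute_elt comm_sym0)
  then have c: "x i t * K = K * x i t" "y i t * K = K * y i t" for t
    by (metis conj_imp_commute x_inv(2) y_inv(2))+
  then have "x i t * (K * z) = K * (x i t * z)" "y i t * (K * z) = K * (y i t * z)" for t z
    by (metis mult.assoc)+
  with c have "sb i * K = K * sb i"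
    by (simp add: sb_def mult.assoc)
  then have K: "sb i * K * sb' i = K" by (simp add: mult.assoc)
  have H: "sb i * h i * sb' i = - h i"
    using sl2_triple.conj_s_H[OF sl2[OF i]] by (simp add: sl2_s[OF i])
  have "sb i * h j * sb' i = sb i * (K + (of_int (cartan_B n j i) / 2) *\<^sub>C h i) * sb' i"
    by (simp add: K_def)
  also have "\<dots> = sb i * K * sb' i + (of_int (cartan_B n j i) / 2) *\<^sub>C (sb i * h i * sb' i)"
    by (simp add: distrib_left distrib_right)
  also have "\<dots> = K - (of_int (cartan_B n j i) / 2) *\<^sub>C h i"
    unfolding K H by simp
  also have "\<dots> = h j - (of_int (cartan_B n j i) / 2 + of_int (cartan_B n j i) / 2) *\<^sub>C h i"
    unfolding K_def scl_add_left by simp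
  finally show ?thesis by simp
qed

lemma sb_tor: assumes i: "i \<in> I"
  shows "sb i * tor z = tor (\<lambda>j. z j - (if i = j then rt i z else 0)) * sb i"
proof -
  have "sb i * (\<Sum>j\<in>I. z j *\<^sub>C h j) * sb' i = (\<Sum>j\<in>I. z j *\<^sub>C (h j - of_int (cartan_B n j i) *\<^sub>C h i))"
    by (simp add: sum_distrib_left sum_distrib_right sb_h[OF i, unfolded mult.assoc] mult.assoc)
  also have "\<dots> = (\<Sum>j\<in>I. z j *\<^sub>C h j) - rt i z *\<^sub>C h i"
    by (simp add: scl_diff_right sum_subtractf rt_def scl_sum_left)
  also have "\<dots> = (\<Sum>j\<in>I. (z j - (if i = j then rt i z else 0)) *\<^sub>C h j)"
  proof -
    have "(\<Sum>j\<in>I. (if i = j then rt i z else 0) *\<^sub>C h j) = rt i z *\<^sub>C h i"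
      using i by (subst sum.remove[of I i]) (auto simp: I_def)
    then show ?thesis by (simp add: scl_diff_left sum_subtractf)
  qed
  finally have "sb i * tor z * sb' i = tor (\<lambda>j. z j - (if i = j then rt i z else 0))"
    by (simp add: tor_def exp_conj)
  then show ?thesis by (rule conj_imp_commute) simp
qed

lemma sb_tau: assumes i: "i \<in> I"
  shows "sb i * tau r w = tau r (sr n i w) * sb i"
proof -
  have "(\<Sum>j\<in>I. (r * Lam n j w - (if i = j then r * of_int (alpha n i w) else 0)) *\<^sub>C h j)
     = (\<Sum>j\<in>I. (r * Lam n j (sr n i w)) *\<^sub>C h j)"
    using i by (intro sum.cong) (auto simp: Lam_sr I_def algebra_simps)
  then show ?thesis
    unfolding tau_def sb_tor[OF i] rt_tau[OF i] by (simp add: tor_def)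
qed

lemma sb'_tau: assumes i: "i \<in> I"
  shows "sb' i * tau r w = tau r (sr n i w) * sb' i"
proof -
  have "sb' i * (tau r w * sb i) = sb' i * (sb i * tau r (sr n i w))"
    by (subst sb_tau[OF i]) simp
  then have "sb' i * tau r w * sb i = tau r (sr n i w)" by (simp add: mult.assoc)
  then show ?thesis by (rule conj_imp_commute) simp
qed

end


section \<open>Principal minors\<close>

text \<open>The assumptions extract from a principal minor continuity for density arguments,
  holomorphy along x_i(t) for Liouville's theorem, and the values on the big cell.\<close>

locale minors = chevalley_B scl n e f h
  for scl :: "complex \<Rightarrow> 'a::{real_normed_algebra_1,banach} \<Rightarrow> 'a" (infixr "*\<^sub>C" 75)
  and n :: nat and e f h :: "nat \<Rightarrow> 'a" +
  fixes D :: "nat \<Rightarrow> 'a \<Rightarrow> complex"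
  assumes D_cont: "k \<in> I \<Longrightarrow> continuous_on G (D k)"
    and D_holo: "k \<in> I \<Longrightarrow> i \<in> I \<Longrightarrow> a \<in> G \<Longrightarrow> b \<in> G \<Longrightarrow> (\<lambda>t. D k (a * x i t * b)) holomorphic_on UNIV"
    and D_cell: "k \<in> I \<Longrightarrow> u \<in> Um \<Longrightarrow> v \<in> U \<Longrightarrow> D k (u * tor z * v) = exp (z k)"
begin

lemma ep_h_Sg: assumes "i \<in> I" shows "ep (h i) z \<in> Sg i"
proof -
  have "ep (h i) z = x i (exp z) * y i (- exp (- z)) * x i (exp z) * sb i"
    using sl2_triple.epH_exp[OF sl2[OF assms], of z] by (simp only: sl2_s[OF assms] x_def y_def)
  then show ?thesis by auto
qed

lemma al_Sg: "i \<in> I \<Longrightarrow> al i t \<in> Sg i"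
  unfolding al_def by (rule ep_h_Sg)

lemma al_G: "i \<in> I \<Longrightarrow> al i t \<in> G"
  using al_Sg Sg_G by blast

lemma tor_G: "tor z \<in> G"
proof -
  have "S \<subseteq> I \<Longrightarrow> exp (\<Sum>j\<in>S. z j *\<^sub>C h j) \<in> G" if "finite S" for S
    using that
  proof (induction S rule: finite_induct)
    case (insert j S)
    have "comm (h j) (\<Sum>j\<in>S. z j *\<^sub>C h j) = 0"
      using insert.prems hh by (auto simp: comm_sum_right I_def intro!: sum.neutral)
    then have "exp (z j *\<^sub>C h j + (\<Sum>j\<in>S. z j *\<^sub>C h j)) = ep (h j) (z j) * exp (\<Sum>j\<in>S. z j *\<^sub>C h j)"
      unfolding ep_def by (intro exp_add_commuting) (simp add: comm_eq_0_iff)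
    then show ?case using insert ep_h_Sg[of j "z j"] Sg_G[of j] by auto
  qed auto
  then show ?thesis by (simp add: tor_def I_def)
qed

lemma tau_G [intro]: "tau r w \<in> G"
  by (simp add: tau_def tor_G)

text \<open>The big cell.\<close>

definition Om where "Om = {u * tor z * v | u z v. u \<in> Um \<and> v \<in> U}"

lemma Om_G: "g \<in> Om \<Longrightarrow> g \<in> G"
  by (auto simp: Om_def intro!: tor_G intro: U_G Um_G)

lemma OmE:
  assumes "g \<in> Om"
  obtains u z v where "g = u * tor z * v" "u \<in> Um" "v \<in> U"
  using assms by (auto simp: Om_def)

text \<open>The last factor in U is written as v' x_i(a) with v' in \<open>N i\<close>. The Gauss
  decomposition in SL_2 turns x_i(a) y_i(t) around, and v' can pass the resulting elements of
  SL_2.\<close>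

lemma Om_y:
  assumes "g \<in> Om" and i: "i \<in> I"
  shows "\<exists>a. \<forall>t. 1 + a * t \<noteq> 0 \<longrightarrow> g * y i t \<in> Om"
proof -
  obtain u z v where g: "g = u * tor z * v" and u: "u \<in> Um" and v: "v \<in> U" using assms(1) by (rule OmE)
  obtain a v' where v': "v' \<in> N i" "v = v' * x i a" using U_decomp'[OF v i] .
  have "g * y i t \<in> Om" if t: "1 + a * t \<noteq> 0" for t
  proof -
    define w where "w = 1 + a * t"
    define m where "m = y i (t / w) * al i w"
    have "m \<in> Sg i" unfolding m_def using al_Sg[OF i] by blast
    then obtain m' where m': "m' \<in> Sg i" "m * m' = 1" "m' * m = 1" using Sg_inverse by blast
    then have "m' * v' * m \<in> N i" using N_conj[OF v'(1), of m' m] by simp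
    then have V: "m' * v' * m * x i (a / w) \<in> U" using N_U i by blast
    have "v * y i t = v' * (x i a * y i t)" by (simp add: v' mult.assoc)
    also have "x i a * y i t = m * x i (a / w)" using x_y[OF i t] by (simp add: m_def w_def)
    also have "v' * (m * x i (a / w)) = (m * m') * v' * m * x i (a / w)" using m' by (simp add: mult.assoc)
    finally have e: "g * y i t = u * (tor z * y i (t / w)) * al i w * (m' * v' * m * x i (a / w))"
      by (simp add: g m_def mult.assoc)
    obtain s where s: "tor z * y i (t / w) = y i s * tor z" using tor_y[OF i] by blast
    have "tor z * al i w = tor (\<lambda>j. z j + (if j = i then Ln w else 0))"
      by (simp add: al_tor[OF i] tor_add)
    then have "g * y i t = (u * y i s) * tor (\<lambda>j. z j + (if j = i then Ln w else 0)) * (m' * v' * m * x i (a / w))"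
      by (simp add: e s mult.assoc)
    moreover have "u * y i s \<in> Um" using u i by blast
    ultimately show ?thesis using V unfolding Om_def by blast
  qed
  then show ?thesis by blast
qed

lemma closure_mult_right:
  assumes "\<And>g. g \<in> S \<Longrightarrow> g * a \<in> closure S" "w \<in> closure S"
  shows "w * (a::'a) \<in> closure S"
proof -
  have "(\<lambda>g. g * a) ` closure S \<subseteq> closure S"
    by (rule image_closure_subset) (use assms(1) in \<open>auto intro!: continuous_intros\<close>)
  then show ?thesis using assms(2) by blast
qed

text \<open>Right multiplication by any generator maps the cell into its closure: x_i preserves the
  cell, and an exceptional parameter t of y_i is a limit of the good parameters t + 1/(k+1).\<close>

lemma Om_dense: assumes "g \<in> G" shows "g \<in> closure Om"
proof -
  have "\<forall>w\<in>closure Om. w * g \<in> closure Om"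
    using assms unfolding G_def
  proof induction
    case (gen_left a u)
    have "w * a \<in> closure Om" if w: "w \<in> closure Om" for w
      using gen_left.hyps(1)
    proof
      assume "a \<in> (\<Union>i\<in>I. range (x i))"
      then obtain i t where a: "i \<in> I" "a = x i t" by blast
      have st: "g * a \<in> Om" if g: "g \<in> Om" for g
      proof -
        from g obtain u z v where g: "g = u * tor z * v" and u: "u \<in> Um" and v: "v \<in> U" by (rule OmE)
        have "g * a = u * tor z * (v * a)" by (simp add: g mult.assoc)
        moreover have "v * a \<in> U" using v a by blast
        ultimately show ?thesis using u unfolding Om_def by blast
      qed
      show ?thesis by (rule closure_mult_right[OF subsetD[OF closure_subset st] w])
    next
      assume "a \<in> (\<Union>i\<in>I. range (y i))"
      then obtain i t where a: "i \<in> I" "a = y i t" by blast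
      have st: "g * a \<in> closure Om" if g: "g \<in> Om" for g
      proof -
        obtain c where c: "\<And>t. 1 + c * t \<noteq> 0 \<Longrightarrow> g * y i t \<in> Om" using Om_y[OF g a(1)] by blast
        show ?thesis
        proof (cases "1 + c * t = 0")
          case False
          then show ?thesis using c a closure_subset by blast
        next
          case True
          define s where "s k = t + of_real (inverse (real (Suc k)))" for k
          have c0: "c \<noteq> 0" using True by auto
          have "1 + c * s k = c * of_real (inverse (real (Suc k)))" for k
            using True by (simp add: s_def distrib_left flip: add.assoc)
          then have "1 + c * s k \<noteq> 0" for k using c0 by (simp del: of_nat_Suc)
          then have "g * y i (s k) \<in> Om" for k using c by blast
          moreover have "s \<longlonglongrightarrow> t + of_real 0"
            unfolding s_def by (intro tendsto_intros LIMSEQ_inverse_real_of_nat)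
          then have "(\<lambda>k. g * y i (s k)) \<longlonglongrightarrow> g * y i t"
            unfolding y_def by (intro tendsto_intros tendsto_ep) simp
          ultimately show ?thesis unfolding a(2) closure_sequential
            by (intro exI[of _ "\<lambda>k. g * y i (s k)"]) simp
        qed
      qed
      show ?thesis by (rule closure_mult_right[OF st w])
    qed
    then show ?case using gen_left.IH by (simp flip: mult.assoc)
  qed simp
  moreover have "1 \<in> Om"
    unfolding Om_def using tor_zero by (intro CollectI exI[of _ 1] exI[of _ "\<lambda>j. 0"]) auto
  ultimately show ?thesis using closure_subset[of Om] by force
qed

lemma ext_eq:
  fixes F F' :: "'a \<Rightarrow> complex"
  assumes "continuous_on G F" "continuous_on G F'" "\<And>g. g \<in> Om \<Longrightarrow> F g = F' g" "g \<in> G"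
  shows "F g = F' g"
proof -
  obtain s where s: "\<And>k. s k \<in> Om" "s \<longlonglongrightarrow> g" using Om_dense[OF assms(4)] by (auto simp: closure_sequential)
  have "(\<lambda>k. F (s k)) \<longlonglongrightarrow> F g" "(\<lambda>k. F' (s k)) \<longlonglongrightarrow> F' g"
    using assms(1,2,4) s Om_G unfolding continuous_on_sequentially o_def by blast+
  moreover have "F' (s k) = F (s k)" for k using assms(3) s(1) by simp
  ultimately show ?thesis using LIMSEQ_unique by simp
qed

lemma D_cont': assumes "k \<in> I" "a \<in> G" "b \<in> G" shows "continuous_on G (\<lambda>g. D k (a * g * b))"
  by (rule continuous_on_compose2[OF D_cont[OF assms(1)]]) (use assms in \<open>auto intro!: continuous_intros\<close>)

lemma D_lim:
  assumes "k \<in> I" "\<And>r. g r \<in> G" "g0 \<in> G" "(g \<longlongrightarrow> g0) F"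
  shows "((\<lambda>r. D k (g r)) \<longlongrightarrow> D k g0) F"
  by (rule continuous_on_tendsto_compose[OF D_cont[OF assms(1)] assms(4,3)]) (simp add: assms(2))

lemma tor_Um: "u \<in> Um \<Longrightarrow> \<exists>u'\<in>Um. tor z * u = u' * tor z"
  unfolding Um_def
proof (induction u rule: gen.induct)
  case gen_one
  then show ?case by (intro bexI[of _ 1]) auto
next
  case (gen_left a u)
  then obtain u' where u': "u' \<in> Um" "tor z * u = u' * tor z" by (auto simp: Um_def)
  obtain i t where a: "i \<in> I" "a = y i t" using gen_left.hyps by blast
  obtain s where s: "tor z * y i t = y i s * tor z" using tor_y[OF a(1)] by blast
  have "tor z * (a * u) = (y i s * u') * tor z"
    by (simp add: a s u' mult.assoc flip: s u'(2)) (simp add: s flip: mult.assoc)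
  moreover have "y i s * u' \<in> Um" using a u' by blast
  ultimately show ?case by (auto simp: Um_def)
qed

lemma tor_U: "v \<in> U \<Longrightarrow> \<exists>v'\<in>U. v * tor z = tor z * v'"
  unfolding U_def
proof (induction v rule: gen.induct)
  case gen_one
  then show ?case by (intro bexI[of _ 1]) auto
next
  case (gen_left a u)
  then obtain u' where u': "u' \<in> U" "u * tor z = tor z * u'" by (auto simp: U_def)
  obtain i t where a: "i \<in> I" "a = x i t" using gen_left.hyps by blast
  have s: "x i t * tor z = tor z * x i (exp (- rt i z) * t)"
    using tor_x[OF a(1), of z "exp (- rt i z) * t"] by (simp add: exp_minus flip: mult.assoc)
  have "(a * u) * tor z = a * (u * tor z)" by (simp add: mult.assoc)
  also have "\<dots> = (x i t * tor z) * u'" by (simp add: u' a mult.assoc)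
  also have "\<dots> = tor z * (x i (exp (- rt i z) * t) * u')" by (simp add: s mult.assoc)
  finally have "(a * u) * tor z = tor z * (x i (exp (- rt i z) * t) * u')" .
  moreover have "x i (exp (- rt i z) * t) * u' \<in> U" using a u' by blast
  ultimately show ?case by (auto simp: U_def)
qed

context
  fixes k assumes k: "k \<in> I"
begin

lemma D_one: "D k 1 = 1"
  using D_cell[OF k, of 1 1 "\<lambda>j. 0"] by (auto simp: tor_zero)

text \<open>As for the torus covariances below, the identity is evident on the cell and extends by
  density.\<close>

lemma D_right_U: assumes "v \<in> U" "g \<in> G" shows "D k (g * v) = D k g"
proof -
  have "D k (1 * g * v) = D k (1 * g * 1)"
  proof (rule ext_eq[OF D_cont'[OF k] D_cont'[OF k] _ assms(2)])
    fix g assume "g \<in> Om"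
    then obtain u z w where g: "g = u * tor z * w" "u \<in> Um" "w \<in> U" by (rule OmE)
    have "D k (u * tor z * (w * v)) = D k (u * tor z * w)"
      using D_cell[OF k] g assms by auto
    then show "D k (1 * g * v) = D k (1 * g * 1)" by (simp add: g mult.assoc)
  qed (use assms U_G in auto)
  then show ?thesis by simp
qed

lemma D_left_tor: assumes "g \<in> G" shows "D k (tor z * g) = exp (z k) * D k g"
proof -
  have "D k (tor z * g * 1) = exp (z k) * D k (1 * g * 1)"
  proof (rule ext_eq[OF D_cont'[OF k] continuous_on_mult[OF continuous_on_const D_cont'[OF k]] _ assms])
    fix g assume "g \<in> Om"
    then obtain u z' w where g: "g = u * tor z' * w" "u \<in> Um" "w \<in> U" by (rule OmE)
    obtain u' where u': "u' \<in> Um" "tor z * u = u' * tor z" using tor_Um g by blast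
    have "tor z * g = (tor z * u) * tor z' * w" by (simp only: g(1) mult.assoc)
    also have "\<dots> = u' * (tor z * tor z') * w" by (simp only: u'(2) mult.assoc)
    finally have e: "tor z * g = u' * tor (\<lambda>j. z j + z' j) * w" by (simp only: tor_add)
    have "D k (tor z * g) = exp (z k + z' k)" unfolding e by (rule D_cell[OF k u'(1) g(3)])
    moreover have "D k g = exp (z' k)" unfolding g(1) by (rule D_cell[OF k g(2,3)])
    ultimately show "D k (tor z * g * 1) = exp (z k) * D k (1 * g * 1)"
      by (simp only: mult_1_left mult_1_right exp_add)
  qed (rule tor_G G_I(3))+
  then show ?thesis by simp
qed

lemma D_right_tor: assumes "g \<in> G" shows "D k (g * tor z) = exp (z k) * D k g"
proof -
  have "D k (1 * g * tor z) = exp (z k) * D k (1 * g * 1)"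
  proof (rule ext_eq[OF D_cont'[OF k] continuous_on_mult[OF continuous_on_const D_cont'[OF k]] _ assms])
    fix g assume "g \<in> Om"
    then obtain u z' w where g: "g = u * tor z' * w" "u \<in> Um" "w \<in> U" by (rule OmE)
    obtain w' where w': "w' \<in> U" "w * tor z = tor z * w'" using tor_U g by blast
    have "g * tor z = u * tor z' * (w * tor z)" by (simp only: g(1) mult.assoc)
    also have "\<dots> = u * (tor z' * tor z) * w'" by (simp only: w'(2) mult.assoc)
    finally have e: "g * tor z = u * tor (\<lambda>j. z' j + z j) * w'" by (simp only: tor_add)
    have "D k (g * tor z) = exp (z' k + z k)" unfolding e by (rule D_cell[OF k g(2) w'(1)])
    moreover have "D k g = exp (z' k)" unfolding g(1) by (rule D_cell[OF k g(2,3)])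
    ultimately show "D k (1 * g * tor z) = exp (z k) * D k (1 * g * 1)"
      by (simp only: mult_1_left mult_1_right exp_add mult.commute)
  qed (rule tor_G G_I(3))+
  then show ?thesis by (simp only: mult_1_left mult_1_right)
qed

lemma D_left_tau: "g \<in> G \<Longrightarrow> D k (tau r w * g) = exp (r * Lam n k w) * D k g"
  unfolding tau_def by (rule D_left_tor[where z = "\<lambda>j. r * Lam n j w"])

lemma D_right_tau: "g \<in> G \<Longrightarrow> D k (g * tau r w) = exp (r * Lam n k w) * D k g"
  unfolding tau_def by (rule D_right_tor[where z = "\<lambda>j. r * Lam n j w"])

lemma D_conj_tau: "g \<in> G \<Longrightarrow> D k (tau r w * g * tau (- r) w) = D k g"
proof -
  assume g: "g \<in> G"
  have "D k (tau r w * g * tau (- r) w) = exp (- r * Lam n k w) * (exp (r * Lam n k w) * D k g)"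
    unfolding D_right_tau[OF G_I(4)[OF tau_G g]] D_left_tau[OF g] ..
  then show ?thesis by (simp add: exp_minus)
qed

end

text \<open>Closed under products. The contracted elements play the part of the unipotent group
  spanned by the roots negative on w, without a description of that group by generators.\<close>

definition contr where "contr w g \<longleftrightarrow>
  ((\<lambda>r. tau (of_real r) w * g * tau (- of_real r) w) \<longlongrightarrow> 1) (at_top :: real filter)"

lemma contr_one: "contr w 1"
  by (simp add: contr_def)

lemma contr_mult: "contr w g \<Longrightarrow> contr w g' \<Longrightarrow> contr w (g * g')"
proof -
  assume "contr w g" "contr w g'"
  then have "((\<lambda>r. (tau (of_real r) w * g * tau (- of_real r) w) * (tau (of_real r) w * g' * tau (- of_real r) w))
     \<longlongrightarrow> 1 * 1) (at_top :: real filter)"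
    unfolding contr_def by (rule tendsto_mult)
  then show ?thesis unfolding contr_def by (simp add: mult.assoc)
qed

lemma lim_exp_neg: "c < 0 \<Longrightarrow> ((\<lambda>r. exp (of_real r * of_int c) * (t::complex)) \<longlongrightarrow> 0) at_top"
proof -
  assume c: "c < 0"
  have l: "((\<lambda>r. exp (r * real_of_int c) * norm t) \<longlongrightarrow> 0) at_top"
  proof -
    have "filterlim (\<lambda>r. (- real_of_int c) * r) at_top at_top"
      by (rule filterlim_tendsto_pos_mult_at_top[OF tendsto_const _ filterlim_ident]) (use c in simp)
    then have "filterlim (\<lambda>r. exp ((- real_of_int c) * r)) at_top at_top"
      by (rule filterlim_compose[OF exp_at_top])
    then have "((\<lambda>r. inverse (exp ((- real_of_int c) * r)) * norm t) \<longlongrightarrow> 0 * norm t) at_top"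
      by (intro tendsto_mult tendsto_inverse_0_at_top tendsto_const)
    then show ?thesis by (simp add: mult.commute flip: exp_minus)
  qed
  have "((\<lambda>r. exp (of_real r * of_int c) * (t::complex)) \<longlongrightarrow> 0) at_top"
    by (rule Lim_null_comparison[OF _ l]) (simp add: norm_mult)
  then show ?thesis .
qed

lemma lim_x: "(g \<longlongrightarrow> 0) F \<Longrightarrow> ((\<lambda>r. x i (g r)) \<longlongrightarrow> 1) F"
  and lim_y: "(g \<longlongrightarrow> 0) F \<Longrightarrow> ((\<lambda>r. y i (g r)) \<longlongrightarrow> 1) F"
  unfolding x_def y_def using tendsto_ep[of g 0] by simp_all

lemma contr_y: "i \<in> I \<Longrightarrow> alpha n i w > 0 \<Longrightarrow> contr w (y i t)"
proof -
  assume i: "i \<in> I" and a: "alpha n i w > 0"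
  have "tau (of_real r) w * y i t * tau (- of_real r) w = y i (exp (of_real r * of_int (- alpha n i w)) * t)" for r :: real
    by (simp add: tau_y[OF i] mult.assoc)
  then show ?thesis unfolding contr_def using a by (simp only:) (intro lim_y lim_exp_neg, simp)
qed

lemma contr_x: "i \<in> I \<Longrightarrow> alpha n i w < 0 \<Longrightarrow> contr w (x i t)"
proof -
  assume i: "i \<in> I" and a: "alpha n i w < 0"
  have "tau (of_real r) w * x i t * tau (- of_real r) w = x i (exp (of_real r * of_int (alpha n i w)) * t)" for r :: real
    by (simp add: tau_x[OF i] mult.assoc)
  then show ?thesis unfolding contr_def using a by (simp only:) (intro lim_x lim_exp_neg, simp)
qed

lemma contr_Um: "u \<in> Um \<Longrightarrow> contr (rho n) u"
  unfolding Um_def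
proof (induction u rule: gen.induct)
  case (gen_left a u)
  then obtain i t where "i \<in> I" "a = y i t" by blast
  then show ?case using contr_mult[OF contr_y gen_left.IH] n2 by simp
qed (rule contr_one)

lemma neg_rho_alpha: "alpha n i (\<lambda>j. - rho n j) = - 1"
  by (simp add: alpha_def rho_def)

lemma contr_U: "u \<in> U \<Longrightarrow> contr (\<lambda>j. - rho n j) u"
  unfolding U_def
proof (induction u rule: gen.induct)
  case (gen_left a u)
  then obtain i t where "i \<in> I" "a = x i t" by blast
  then show ?case using contr_mult[OF contr_x gen_left.IH] by (simp add: neg_rho_alpha)
qed (rule contr_one)

lemma D_contr:
  assumes k: "k \<in> I" and "g \<in> G" "contr w g"
  shows "D k g = 1"
proof -
  have "((\<lambda>r. D k (tau (of_real r) w * g * tau (- of_real r) w)) \<longlongrightarrow> D k 1) (at_top :: real filter)"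
    by (rule D_lim[OF k]) (use assms in \<open>auto simp: contr_def\<close>)
  then have "((\<lambda>r::real. D k g) \<longlongrightarrow> 1) at_top"
    using D_conj_tau[OF k assms(2)] D_one[OF k] by simp
  then show ?thesis using tendsto_unique[OF _ _ tendsto_const] by (metis trivial_limit_at_top_linorder)
qed

text \<open>E acts like an element of \<open>Um\<close>: for u in \<open>Um\<close> the product E *
  u is again contracted by \<rho>, so its minor is 1. It applies to conjugates of x_i and y_i by
  lifts.\<close>

lemma D_left_contr:
  assumes k: "k \<in> I" and E: "E \<in> G" "contr (rho n) E" and g: "g \<in> G"
  shows "D k (E * g) = D k g"
proof -
  have mem: "E * u \<in> G" if "u \<in> Um" for u using E(1) Um_G[OF that] by blast
  have "D k (E * g * 1) = D k (1 * g * 1)"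
  proof (rule ext_eq[OF D_cont'[OF k] D_cont'[OF k] _ g])
    fix g assume "g \<in> Om"
    then obtain u z v where g: "g = u * tor z * v" "u \<in> Um" "v \<in> U" by (rule OmE)
    have "D k (E * g * 1) = D k ((E * u) * tor z * v)" by (simp add: g mult.assoc)
    also have "\<dots> = D k ((E * u) * tor z)"
      by (rule D_right_U[OF k g(3)]) (use mem[OF g(2)] tor_G in blast)
    also have "\<dots> = exp (z k) * D k (E * u)"
      by (rule D_right_tor[OF k mem[OF g(2)]])
    also have "D k (E * u) = 1"
      by (rule D_contr[OF k mem[OF g(2)] contr_mult[OF E(2) contr_Um[OF g(2)]]])
    finally show "D k (E * g * 1) = D k (1 * g * 1)" using D_cell[OF k g(2,3)] by (simp add: g)
  qed (use E in auto)
  then show ?thesis by simp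
qed

end


context minors
begin

lemma continuous_y: "continuous_on UNIV (y i)"
  unfolding continuous_on_def y_def by (intro ballI tendsto_ep tendsto_ident_at)

text \<open>\<open>x\<^sub>i(t) = y\<^sub>i(t\<^sup>-\<^sup>1) \<alpha>\<^sub>i\<^sup>\<or>(t) s y\<^sub>i(t\<^sup>-\<^sup>1)\<close> with \<open>s\<close> the inverse of \<open>sb i\<close>, so the entire function
  \<open>t \<mapsto> D k (z x\<^sub>i(t) g)\<close> has polynomial growth.\<close>

lemma row_polynomial:
  assumes k: "k \<in> I" and i: "i \<in> I" and z: "z \<in> G" and g: "g \<in> G"
    and Y: "\<And>t g. g \<in> G \<Longrightarrow> D k (z * (y i t * g)) = D k (z * g)"
    and A: "\<And>t g. t \<noteq> 0 \<Longrightarrow> g \<in> G \<Longrightarrow> D k (z * (al i t * g)) = t ^ m * D k (z * g)"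
  obtains c where "\<And>t. D k (z * (x i t * g)) = (\<Sum>j\<le>m. c j * t ^ j)"
    "c 0 = D k (z * g)" "c m = D k (z * (sb' i * g))"
proof -
  define q where "q t = D k (z * (x i t * g))" for t
  define p where "p s = D k (z * (sb' i * (y i s * g)))" for s
  have yg: "y i s * g \<in> G" for s by (rule G_I(4)[OF G_I(2)[OF i] g])
  have syg: "sb' i * (y i s * g) \<in> G" for s by (rule G_I(4)[OF sb_G(2)[OF i] yg])
  have qp: "q t = t ^ m * p (inverse t)" if t: "t \<noteq> 0" for t
  proof -
    have "x i t * g = y i (inverse t) * (al i t * (sb' i * (y i (inverse t) * g)))"
      unfolding x_expand[OF i t] by (simp only: mult.assoc)
    then have "q t = D k (z * (y i (inverse t) * (al i t * (sb' i * (y i (inverse t) * g)))))"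
      unfolding q_def by (simp only:)
    also have "\<dots> = D k (z * (al i t * (sb' i * (y i (inverse t) * g))))"
      by (rule Y[OF G_I(4)[OF al_G[OF i] syg]])
    also have "\<dots> = t ^ m * p (inverse t)" unfolding p_def by (rule A[OF t syg])
    finally show ?thesis .
  qed
  have holo: "q holomorphic_on UNIV"
    using D_holo[OF k i z g] unfolding q_def mult.assoc .
  have cont: "continuous_on UNIV p"
    unfolding p_def
  proof (rule continuous_on_compose2[OF D_cont[OF k]])
    show "continuous_on UNIV (\<lambda>s. z * (sb' i * (y i s * g)))"
      by (intro continuous_on_mult continuous_on_const continuous_y)
    show "range (\<lambda>s. z * (sb' i * (y i s * g))) \<subseteq> G"
      using G_I(4)[OF z syg] by blast
  qed
  have "compact (p ` cball 0 1)"
    using cont by (intro compact_continuous_image) (auto intro: continuous_on_subset)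
  then obtain B where B: "\<And>s. s \<in> cball 0 1 \<Longrightarrow> norm (p s) \<le> B"
    using compact_imp_bounded[of "p ` cball 0 1"] unfolding bounded_iff by blast
  define c where "c j = (deriv ^^ j) q 0 / fact j" for j
  have qpoly: "q t = (\<Sum>j\<le>m. c j * t ^ j)" for t
    unfolding c_def
  proof (rule Liouville_polynomial[OF holo, of 1 B])
    fix t :: complex assume t: "1 \<le> norm t"
    then have t0: "t \<noteq> 0" by auto
    have "norm (p (inverse t)) \<le> B"
      using t by (intro B) (simp add: norm_inverse inverse_le_1_iff del: inverse_eq_divide)
    then show "norm (q t) \<le> B * norm t ^ m"
      unfolding qp[OF t0] norm_mult norm_power by (subst mult.commute) (rule mult_right_mono, simp_all)
  qed
  have c0: "c 0 = D k (z * g)" by (simp add: c_def q_def)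
  have peq: "p s = (\<Sum>j\<le>m. c j * s ^ (m - j))" if s: "s \<noteq> 0" for s
  proof -
    have "p s = s ^ m * q (inverse s)"
      using qp[of "inverse s"] s by (simp add: power_inverse)
    also have "\<dots> = (\<Sum>j\<le>m. c j * (s ^ m * inverse s ^ j))"
      unfolding qpoly sum_distrib_left by (simp only: ac_simps)
    also have "\<dots> = (\<Sum>j\<le>m. c j * s ^ (m - j))"
      using s by (intro sum.cong refl) (simp add: power_diff power_inverse divide_inverse)
    finally show ?thesis .
  qed
  \<comment> \<open>The formula for nonzero s extends to s = 0 by continuity, where only the term j
    = m survives. This identifies the leading coefficient.\<close>
  have "(p \<longlongrightarrow> p 0) (at 0)"
    using cont by (simp add: continuous_on_def)
  moreover have "((\<lambda>s. \<Sum>j\<le>m. c j * s ^ (m - j)) \<longlongrightarrow> (\<Sum>j\<le>m. c j * 0 ^ (m - j))) (at (0::complex))"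
    by (intro tendsto_intros)
  moreover have "eventually (\<lambda>s. (\<Sum>j\<le>m. c j * s ^ (m - j)) = p s) (at 0)"
    unfolding eventually_at_filter by (simp add: peq)
  ultimately have "p 0 = (\<Sum>j\<le>m. c j * 0 ^ (m - j))"
    using tendsto_unique[OF at_neq_bot] Lim_transform_eventually by blast
  also have "\<dots> = (\<Sum>j\<in>{m}. c j * 0 ^ (m - j))"
    by (rule sum.mono_neutral_right) auto
  finally have "c m = D k (z * (sb' i * g))" by (simp add: p_def)
  then show ?thesis using that[of c] qpoly c0 unfolding q_def by blast
qed

text \<open>The flag selects the lift of s_i or its inverse. Both are needed because the second
  family of minors is computed from the inverse of the product; the inverse of \<open>sl b p\<close>
  is \<open>sl\<close> of the reversed word with the other flag.\<close>

definition sg where "sg b i = (if b then sb i else sb' i)"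
definition sl where "sl b p = prod_list (map (sg b) p)"

lemma sl_simps [simp]: "sl b [] = 1" "sl b (i # p) = sg b i * sl b p" "sl b (p @ p') = sl b p * sl b p'"
  by (simp_all add: sl_def)

lemma sl_lift: "sl True p = lift p"
proof -
  have "sg True = sb" by (simp add: sg_def fun_eq_iff)
  then show ?thesis by (simp add: sl_def lift_def)
qed

lemma sg_inv [simp]: "sg b i * sg (\<not> b) i = 1" "sg b i * (sg (\<not> b) i * z) = z"
  by (simp_all add: sg_def)

lemma sl_inv: "sl b p * sl (\<not> b) (rev p) = 1"
proof (induction p)
  case (Cons i p)
  have "sl b (i # p) * sl (\<not> b) (rev (i # p)) = sg b i * (sl b p * sl (\<not> b) (rev p)) * sg (\<not> b) i"
    by (simp add: mult.assoc)
  then show ?case by (simp only: Cons mult_1_right sg_inv)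
qed simp

lemma sl_inv': "sl (\<not> b) (rev p) * sl b p = 1"
  using sl_inv[of "\<not> b" "rev p"] by simp

lemma sg_Sg: "sg b i \<in> Sg i"
  by (auto simp: sg_def)

lemma sg_G: "i \<in> I \<Longrightarrow> sg b i \<in> G"
  using sg_Sg Sg_G by blast

lemma sl_G: "set p \<subseteq> I \<Longrightarrow> sl b p \<in> G"
  by (induction p) (auto intro: G_I(4) sg_G)

lemma sg_tau: "i \<in> I \<Longrightarrow> sg b i * tau r w = tau r (sr n i w) * sg b i"
  by (simp add: sg_def sb_tau sb'_tau)

lemma sl_tau: "set p \<subseteq> I \<Longrightarrow> sl b p * tau r w = tau r (wact n p w) * sl b p"
proof (induction p)
  case (Cons i p)
  have "sl b (i # p) * tau r w = sg b i * (sl b p * tau r w)" by (simp add: mult.assoc)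
  also have "\<dots> = (sg b i * tau r (wact n p w)) * sl b p" using Cons by (simp add: mult.assoc)
  also have "\<dots> = tau r (wact n (i # p) w) * sl b (i # p)" using Cons.prems by (simp add: sg_tau mult.assoc)
  finally show ?case .
qed simp

text \<open>A lift conjugates \<open>tau r w\<close> to the torus element of the Weyl translate of
  w, so contraction is transported by the Weyl action.\<close>

lemma contr_sl:
  assumes p: "set p \<subseteq> I" and c: "contr (wact n p w) g"
  shows "contr w (sl b (rev p) * g * sl (\<not> b) p)"
proof -
  let ?S = "sl b (rev p)" and ?T = "sl (\<not> b) p" and ?w = "wact n p w"
  have 1: "tau r w * ?S = ?S * tau r ?w" for r
    using sl_tau[of "rev p" b r ?w] p by simp
  have 2: "?T * tau r w = tau r ?w * ?T" for r
    using sl_tau[OF p] .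
  have ST: "?S * ?T = 1" using sl_inv[of b "rev p"] by simp
  have "tau r w * (?S * g * ?T) * tau (- r) w = ?S * (tau r ?w * g * tau (- r) ?w) * ?T" for r
  proof -
    have "tau r w * (?S * g * ?T) * tau (- r) w = (tau r w * ?S) * g * (?T * tau (- r) w)" by (simp only: mult.assoc)
    then show ?thesis unfolding 1 2 by (simp only: mult.assoc)
  qed
  moreover have "((\<lambda>r. ?S * (tau (of_real r) ?w * g * tau (- of_real r) ?w) * ?T) \<longlongrightarrow> ?S * 1 * ?T) (at_top :: real filter)"
    using c unfolding contr_def by (intro tendsto_mult tendsto_const)
  ultimately show ?thesis unfolding contr_def by (simp add: ST)
qed

lemma sr_neg: "sr n i (\<lambda>j. - w j) = (\<lambda>j. - sr n i w j)"
  by (auto simp: sr_def)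

lemma wact_neg: "wact n p (\<lambda>j. - w j) = (\<lambda>j. - wact n p w j)"
  by (induction p) (simp_all add: sr_neg)

lemma alpha_neg: "alpha n i (\<lambda>j. - w j) = - alpha n i w"
  by (simp add: alpha_def)

lemma contr_sl_x:
  assumes "set p \<subseteq> I" "i \<in> I" "alpha n i (wact n p w) > 0"
  shows "contr (\<lambda>j. - w j) (sl b (rev p) * x i t * sl (\<not> b) p)"
  using assms by (intro contr_sl contr_x) (simp_all add: wact_neg alpha_neg)

text \<open>The functional on the fundamental representation of weight \<open>\<Lambda>\<^sub>k\<close> dual to the extremal vector of
  weight \<open>p \<Lambda>\<^sub>k\<close>, evaluated on the image of the highest weight vector under \<open>g\<close>.\<close>

definition rw where "rw k p g = D k (sl False (rev p) * g)"

lemma rw_Cons: "rw k (i # p) g = rw k p (sb' i * g)"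
  by (simp add: rw_def sg_def mult.assoc)

lemma rw_Nil: "rw k [] g = D k g"
  by (simp add: rw_def)

text \<open>The coroots in orthonormal coordinates: \<epsilon>_i - \<epsilon>_(i+1) for i < n, and 2
  \<epsilon>_n.\<close>

definition coroot where "coroot i = (\<lambda>l. if l = i then (if i < n then 1 else 2) else if i < n \<and> l = Suc i then - 1 else (0::int))"

lemma alpha_coroot: "i \<in> I \<Longrightarrow> alpha n i (coroot i) = 2"
  by (auto simp: alpha_def coroot_def I_def)

lemma Lam_coroot:
  assumes "i \<in> I" "j \<in> I"
  shows "Lam n j (coroot i) = (if j = i then 1 else 0)"
proof -
  have "(\<Sum>l=1..m. coroot i l) = (if i \<le> m then (if i < n then 1 else 2) else 0) - (if i < n \<and> Suc i \<le> m then 1 else 0)" for m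
    using assms(1) by (induction m) (auto simp: coroot_def I_def)
  then show ?thesis using assms by (auto simp: Lam_def I_def)
qed

lemma al_tau: assumes "i \<in> I" shows "al i t = tau (Ln t) (coroot i)"
proof -
  have "(\<Sum>j\<in>I. (if j = i then Ln t else 0) *\<^sub>C h j) = (\<Sum>j\<in>I. (Ln t * Lam n j (coroot i)) *\<^sub>C h j)"
    by (rule sum.cong) (auto simp: Lam_coroot assms)
  then show ?thesis unfolding al_tor[OF assms] tau_def tor_def by simp
qed

context
  fixes k p assumes k: "k \<in> I" and p: "set p \<subseteq> I"
begin

lemma p': "sl False (rev p) \<in> G" "sl True p \<in> G"
  using p by (simp_all add: sl_G)

lemma rw_tau: "g \<in> G \<Longrightarrow> rw k p (tau r w * g) = exp (r * Lam n k (wact n (rev p) w)) * rw k p g"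
proof -
  assume g: "g \<in> G"
  have "sl False (rev p) * (tau r w * g) = tau r (wact n (rev p) w) * (sl False (rev p) * g)"
    using sl_tau[of "rev p" False r w] p by (simp flip: mult.assoc)
  then show ?thesis unfolding rw_def using D_left_tau[OF k G_I(4)[OF p'(1) g]] by simp
qed

lemma rw_al:
  assumes "i \<in> I" "Lam n k (wact n (rev p) (coroot i)) = of_int m" "t \<noteq> 0" "g \<in> G"
  shows "rw k p (al i t * g) = t powi m * rw k p g"
proof -
  have "exp (Ln t * of_int m) = exp (Ln t) powi m"
    unfolding exp_power_int by (simp only: mult.commute)
  then show ?thesis unfolding al_tau[OF assms(1)] rw_tau[OF assms(4)] assms(2) using assms(3) by simp
qed

text \<open>Conjugation by the lift of p turns contraction by p \<rho> into contraction by \<rho>,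
  which \<open>D_left_contr\<close> handles.\<close>

lemma rw_contr: "E \<in> G \<Longrightarrow> contr (wact n p (rho n)) E \<Longrightarrow> g \<in> G \<Longrightarrow> rw k p (E * g) = rw k p g"
proof -
  assume E: "E \<in> G" "contr (wact n p (rho n)) E" and g: "g \<in> G"
  have "rw k p (E * g) = D k ((sl False (rev p) * E * sl True p) * (sl False (rev p) * g))"
  proof -
    have "sl True p * sl False (rev p) = 1" using sl_inv[of True p] by simp
    then have "(sl False (rev p) * E * sl True p) * (sl False (rev p) * g) = sl False (rev p) * (E * g)"
      by (metis mult.assoc mult_1_left)
    then show ?thesis by (simp only: rw_def)
  qed
  also have "\<dots> = D k (sl False (rev p) * g)"
    using contr_sl[OF p E(2), of False] by (intro D_left_contr[OF k]) (simp_all add: G_I(4) p' E g)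
  finally show ?thesis by (simp only: rw_def)
qed

lemma rw_y: "i \<in> I \<Longrightarrow> alpha n i (wact n p (rho n)) > 0 \<Longrightarrow> g \<in> G \<Longrightarrow> rw k p (y i t * g) = rw k p g"
  by (intro rw_contr contr_y G_I(2))

lemma rw_x: "i \<in> I \<Longrightarrow> alpha n i (wact n p (rho n)) < 0 \<Longrightarrow> g \<in> G \<Longrightarrow> rw k p (x i t * g) = rw k p g"
  by (intro rw_contr contr_x G_I(1))

context
  fixes i assumes i: "i \<in> I" and pos: "alpha n i (wact n p (rho n)) > 0"
begin

lemma rw_polynomial:
  assumes "Lam n k (wact n (rev p) (coroot i)) = of_nat m" "g \<in> G"
  obtains c where "\<And>t. rw k p (x i t * g) = (\<Sum>j\<le>m. c j * t ^ j)"
    "c 0 = rw k p g" "c m = rw k (i # p) g"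
proof -
  have Y: "D k (sl False (rev p) * (y i t * g)) = D k (sl False (rev p) * g)" if "g \<in> G" for t g
    using rw_y[OF i pos that] unfolding rw_def .
  have A: "D k (sl False (rev p) * (al i t * g)) = t ^ m * D k (sl False (rev p) * g)" if "t \<noteq> 0" "g \<in> G" for t g
    using rw_al[OF i _ that, of "int m"] assms(1) unfolding rw_def by simp
  obtain c where "\<And>t. D k (sl False (rev p) * (x i t * g)) = (\<Sum>j\<le>m. c j * t ^ j)"
    "c 0 = D k (sl False (rev p) * g)" "c m = D k (sl False (rev p) * (sb' i * g))"
    using row_polynomial[OF k i p'(1) assms(2) Y A] by blast
  then show ?thesis using that[of c] unfolding rw_Cons unfolding rw_def by blast
qed

lemma rw_x0: "Lam n k (wact n (rev p) (coroot i)) = 0 \<Longrightarrow> g \<in> G \<Longrightarrow> rw k p (x i t * g) = rw k p g"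
proof -
  assume "Lam n k (wact n (rev p) (coroot i)) = 0" and g: "g \<in> G"
  then have "Lam n k (wact n (rev p) (coroot i)) = of_nat 0" by simp
  from rw_polynomial[OF this g] obtain c where "\<And>t. rw k p (x i t * g) = (\<Sum>j\<le>0. c j * t ^ j)"
    "c 0 = rw k p g" by blast
  then show ?thesis by simp
qed

lemma rw_x1: "Lam n k (wact n (rev p) (coroot i)) = 1 \<Longrightarrow> g \<in> G \<Longrightarrow>
    rw k p (x i t * g) = rw k p g + t * rw k (i # p) g"
proof -
  assume "Lam n k (wact n (rev p) (coroot i)) = 1" and g: "g \<in> G"
  then have "Lam n k (wact n (rev p) (coroot i)) = of_nat 1" by simp
  from rw_polynomial[OF this g] obtain c where "\<And>t. rw k p (x i t * g) = (\<Sum>j\<le>1. c j * t ^ j)"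
    "c 0 = rw k p g" "c 1 = rw k (i # p) g" by blast
  then show ?thesis by (simp add: mult.commute)
qed

lemma rw_x2: "Lam n k (wact n (rev p) (coroot i)) = 2 \<Longrightarrow> g \<in> G \<Longrightarrow>
    \<exists>M. \<forall>t. rw k p (x i t * g) = rw k p g + t * M + t^2 * rw k (i # p) g"
proof -
  assume "Lam n k (wact n (rev p) (coroot i)) = 2" and g: "g \<in> G"
  then have "Lam n k (wact n (rev p) (coroot i)) = of_nat 2" by simp
  from rw_polynomial[OF this g] obtain c where "\<And>t. rw k p (x i t * g) = (\<Sum>j\<le>2. c j * t ^ j)"
    "c 0 = rw k p g" "c 2 = rw k (i # p) g" by blast
  then show ?thesis by (intro exI[of _ "c 1"]) (simp add: mult.commute numeral_2_eq_2)
qed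

text \<open>In the Bruhat form of y_i(t), the inverse lift turns the leading x_i into a y_i, which
  the upper functional ignores. So y_i(t) on the lower functional is x_i(1/t) on the upper one,
  scaled by the weight.\<close>

lemma rw_y_lower:
  assumes w: "Lam n k (wact n (rev p) (coroot i)) = of_nat m" and t: "t \<noteq> 0" and g: "g \<in> G"
  shows "rw k (i # p) (y i t * g) = t ^ m * rw k p (x i (inverse t) * g)"
proof -
  have it: "inverse t \<noteq> 0" using t by simp
  have xg: "x i (inverse t) * g \<in> G" by (rule G_I(4)[OF G_I(1)[OF i] g])
  have sal: "sb' i * (al i (inverse t) * sb i) = al i t"
    using sl2_triple.s_al[OF sl2[OF i] t] by (simp add: sl2_s[OF i])
       (metis sb_inv(4))
  have "sb' i * (y i t * g) = sb' i * (x i (inverse t) * al i (inverse t) * sb i * x i (inverse t) * g)"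
    unfolding y_expand[OF i t] by (simp only: mult.assoc)
  also have "\<dots> = (sb' i * x i (inverse t)) * (al i (inverse t) * sb i) * (x i (inverse t) * g)"
    by (simp only: mult.assoc)
  also have "\<dots> = y i (- inverse t) * ((sb' i * (al i (inverse t) * sb i)) * (x i (inverse t) * g))"
    unfolding sb'_x[OF i] by (simp only: mult.assoc)
  finally have e: "sb' i * (y i t * g) = y i (- inverse t) * (al i t * (x i (inverse t) * g))"
    unfolding sal .
  have "rw k (i # p) (y i t * g) = rw k p (al i t * (x i (inverse t) * g))"
    unfolding rw_Cons e by (rule rw_y[OF i pos G_I(4)[OF al_G[OF i] xg]])
  also have "\<dots> = t ^ m * rw k p (x i (inverse t) * g)"
    using rw_al[OF i, of "int m" t] w t xg by simp
  finally show ?thesis .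
qed

lemma rw_y1: assumes w: "Lam n k (wact n (rev p) (coroot i)) = 1" and g: "g \<in> G"
  shows "rw k (i # p) (y i t * g) = rw k (i # p) g + t * rw k p g"
proof (cases "t = 0")
  case False
  then show ?thesis using rw_y_lower[of 1 t g] rw_x1[OF w g, of "inverse t"] w g by (simp add: field_simps)
qed simp

end

end

end


section \<open>Characters of U and Bruhat multiplication\<close>

context minors
begin

text \<open>On \<open>U\<close> the minor \<open>chi k\<close> is the character attached to the simple root \<open>\<alpha>\<^sub>k\<close>.\<close>

definition chi where "chi k u = D k (u * sb k)"

lemma rho_pos: "alpha n i (wact n [] (rho n)) > 0"
  using n2 by simp

lemma D_x: assumes k: "k \<in> I" and j: "j \<in> I" and g: "g \<in> G"
  shows "D k (x j t * g) = (if j = k then D k g + t * D k (sb' k * g) else D k g)"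
proof (cases "j = k")
  case True
  then show ?thesis
    using rw_x1[OF k _ k rho_pos, of g t] g Lam_coroot[OF k k] by (simp add: rw_Nil rw_Cons)
next
  case False
  then show ?thesis
    using rw_x0[OF k _ j rho_pos, of g t] g Lam_coroot[OF j k] by (simp add: rw_Nil)
qed

text \<open>Moving a torus element through the lift gives two values for its effect, exp(-1) on the
  left and exp(1) on the right.\<close>

lemma D_sb: assumes k: "k \<in> I" shows "D k (sb k) = 0"
proof -
  have L: "Lam n k (sr n k (coroot k)) = - 1"
    using Lam_sr[of k n k "coroot k"] k Lam_coroot[OF k k] alpha_coroot[OF k] by (simp add: I_def)
  have "D k (tau 1 (sr n k (coroot k)) * sb k) = D k (sb k * tau 1 (coroot k))"
    by (simp only: sb_tau[OF k])
  then have "exp (- 1) * D k (sb k) = exp 1 * D k (sb k)"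
    by (simp add: D_left_tau[OF k] D_right_tau[OF k] sb_G k L Lam_coroot)
  moreover have "exp (- 1) \<noteq> (exp 1 :: complex)"
    by (metis exp_of_real exp_inj_iff neg_equal_iff_equal of_real_eq_iff of_real_1 of_real_minus one_neq_neg_one)
  ultimately show ?thesis by (metis mult_cancel_right)
qed

text \<open>U is contracted by -\<rho>, so its conjugates by the lift of s_k are contracted by -s_k
  \<rho>.\<close>

lemma D_conj_sb: assumes k: "k \<in> I" and u: "u \<in> U" shows "D k (sb' k * (u * sb k)) = 1"
proof -
  have c: "contr (\<lambda>j. - rho n j) u" by (rule contr_U[OF u])
  have "contr (\<lambda>j. - sr n k (rho n) j) (sl False (rev [k]) * u * sl (\<not> False) [k])"
    by (rule contr_sl) (use k c in \<open>simp_all add: wact_neg sr_neg\<close>)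
  then have "contr (\<lambda>j. - sr n k (rho n) j) (sb' k * (u * sb k))"
    by (simp add: sg_def mult.assoc)
  moreover have "sb' k * (u * sb k) \<in> G"
    by (intro G_I(4) sb_G k U_G u)
  ultimately show ?thesis using D_contr[OF k] by blast
qed

context
  fixes k assumes k: "k \<in> I"
begin

lemma chi_one: "chi k 1 = 0"
  by (simp add: chi_def D_sb k)

lemma chi_Cons: assumes "j \<in> I" "u \<in> U" shows "chi k (x j t * u) = (if j = k then t else 0) + chi k u"
proof -
  have "u * sb k \<in> G" by (intro G_I(4) sb_G k U_G assms)
  then show ?thesis
    using D_x[OF k assms(1), of "u * sb k" t] D_conj_sb[OF k assms(2)] by (simp add: chi_def mult.assoc)
qed

lemma chi_x: "j \<in> I \<Longrightarrow> chi k (x j t) = (if j = k then t else 0)"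
  using chi_Cons[of j 1 t] chi_one U_I(2) by simp

lemma chi_mult: "u \<in> U \<Longrightarrow> v \<in> U \<Longrightarrow> chi k (u * v) = chi k u + chi k v"
proof -
  assume u: "u \<in> U" and v: "v \<in> U"
  have "u \<in> gen (\<Union>i\<in>I. range (x i)) \<Longrightarrow> chi k (u * v) = chi k u + chi k v" for u
  proof (induction u rule: gen.induct)
    case (gen_left a u)
    then obtain i t where a: "i \<in> I" "a = x i t" by blast
    have "u \<in> U" using gen_left.hyps by (simp add: U_def)
    then have "u * v \<in> U" using v by blast
    then show ?case using gen_left.IH chi_Cons[OF a(1), of u t] chi_Cons[OF a(1), of "u * v" t] \<open>u \<in> U\<close>
      by (simp add: a mult.assoc)
  qed (simp add: chi_one)
  then show ?thesis using u by (simp add: U_def)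
qed

lemma chi_char:
  assumes F: "F 1 = 0" "\<And>j t u. j \<in> I \<Longrightarrow> u \<in> U \<Longrightarrow> F (x j t * u) = (if j = k then t else 0) + F u"
    and u: "u \<in> U"
  shows "F u = chi k u"
proof -
  have "u \<in> gen (\<Union>i\<in>I. range (x i)) \<Longrightarrow> F u = chi k u"
  proof (induction u rule: gen.induct)
    case (gen_left a u)
    then obtain i t where a: "i \<in> I" "a = x i t" by blast
    have "u \<in> U" using gen_left.hyps by (simp add: U_def)
    then show ?case using gen_left.IH chi_Cons[OF a(1)] F(2)[OF a(1)] by (simp add: a)
  qed (simp add: chi_one F)
  then show ?thesis using u by (simp add: U_def)
qed

lemma chi_N: "v \<in> N k \<Longrightarrow> chi k v = 0"
proof -
  assume v: "v \<in> N k"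
  have "sb' k * v * sb k \<in> U" using v sb_Sg by (auto simp: N_def)
  moreover have "chi k v = D k (sb k * (sb' k * v * sb k))" by (simp add: chi_def mult.assoc)
  ultimately show ?thesis using D_right_U[OF k] sb_G[OF k] D_sb[OF k] by simp
qed

text \<open>With \<open>chi_N\<close>, the radical \<open>N k\<close> is the kernel of the
  character.\<close>

lemma chi_zero_N: assumes "u \<in> U" "chi k u = 0" shows "u \<in> N k"
proof -
  obtain a v where v: "v \<in> N k" "u = x k a * v" using U_decomp[OF assms(1) k] .
  then have "chi k u = a" using chi_Cons[OF k N_U[OF v(1)], of a] chi_N[OF v(1)] by simp
  then show ?thesis using v assms by simp
qed

text \<open>\<alpha>_k takes the value 1 on -s_k \<rho>. Under the contraction the character is
  multiplied by exp(r), while the minor converges to D(sb_k) = 0; so it must vanish.\<close>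

lemma chi_contr:
  assumes E: "E \<in> U" "contr (\<lambda>j. - sr n k (rho n) j) E"
  shows "chi k E = 0"
proof -
  define w where "w = (\<lambda>j. - sr n k (rho n) j)"
  define g where "g r = tau (of_real r) w * E * tau (- of_real r) w * sb k" for r :: real
  have EG: "E \<in> G" "E * sb k \<in> G" by (intro G_I(4) sb_G k U_G E)+
  have w: "sr n k w = (\<lambda>j. - rho n j)" by (simp add: w_def sr_neg)
  have L: "Lam n k w - Lam n k (sr n k w) = 1"
  proof -
    have "Lam n k (sr n k w) = Lam n k w - of_int (alpha n k w)"
      using Lam_sr[of k n k w] k by (simp add: I_def)
    moreover have "alpha n k w = - alpha n k (sr n k (rho n))" by (simp only: w_def alpha_neg)
    ultimately show ?thesis using n2 by simp
  qed
  have "D k (g r) = exp (of_real r) * chi k E" for r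
  proof -
    have "sb k * tau (- of_real r) (sr n k w) = tau (- of_real r) w * sb k" by (simp add: sb_tau[OF k])
    then have "g r = tau (of_real r) w * ((E * sb k) * tau (- of_real r) (sr n k w))"
      unfolding g_def by (simp only: mult.assoc)
    then have "D k (g r) = exp (of_real r * Lam n k w) * (exp (- of_real r * Lam n k (sr n k w)) * chi k E)"
      using D_left_tau[OF k G_I(4)[OF EG(2) tau_G]] D_right_tau[OF k EG(2)] by (simp only: chi_def)
    also have "\<dots> = exp (of_real r * (Lam n k w - Lam n k (sr n k w))) * chi k E"
      by (simp add: right_diff_distrib exp_diff exp_minus divide_inverse)
    finally show ?thesis by (simp add: L)
  qed
  moreover have "((\<lambda>r. D k (g r)) \<longlongrightarrow> D k (1 * sb k)) at_top"
  proof (rule D_lim[OF k])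
    show "(g \<longlongrightarrow> 1 * sb k) at_top"
      unfolding g_def using E(2) unfolding contr_def w_def by (intro tendsto_mult tendsto_const)
    show "g r \<in> G" for r unfolding g_def by (intro G_I(4) tau_G EG(1) sb_G k)
    show "1 * sb k \<in> G" using sb_G(1)[OF k] by simp
  qed
  ultimately have "((\<lambda>r. exp (of_real r) * chi k E) \<longlongrightarrow> 0) (at_top :: real filter)"
    by (simp add: D_sb[OF k])
  then have l: "((\<lambda>r. norm (exp (of_real r) * chi k E)) \<longlongrightarrow> 0) (at_top :: real filter)"
    by (rule tendsto_norm_zero)
  have "norm (chi k E) \<le> 0"
  proof (rule tendsto_le[OF _ l tendsto_const[of "norm (chi k E)"]])
    show "eventually (\<lambda>r. norm (chi k E) \<le> norm (exp (of_real r) * chi k E)) (at_top :: real filter)"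
      using eventually_ge_at_top[of 0]
    proof eventually_elim
      case (elim r)
      then have "1 * norm (chi k E) \<le> exp r * norm (chi k E)" by (intro mult_right_mono) auto
      then show ?case by (simp add: norm_mult)
    qed
  qed simp
  then show ?thesis by simp
qed

end

lemma set_I: "redu n p \<Longrightarrow> set p \<subseteq> I"
  by (simp add: redu_def I_def)

text \<open>For a reduced word i # p the root p^(-1) \<alpha>_i is positive. Letters are added at
  the right end of p: since i # p followed by j is reduced, the element so far is contracted by -s_j
  \<rho>, thus lies in \<open>N j\<close>, and conjugation by the lift of s_j keeps it in U.\<close>

lemma sl_conj_U:
  assumes "redu n (i # p)"
  shows "sl b (rev p) * x i t * sl (\<not> b) p \<in> U"
  using assms
proof (induction p rule: rev_induct)
  case Nil
  then have "i \<in> I" using redu_Cons I_def by auto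
  then show ?case by auto
next
  case (snoc j p)
  define E where "E = sl b (rev p) * x i t * sl (\<not> b) p"
  have r: "redu n (i # p)" using snoc.prems redu_append[of n "i # p" "[j]"] by simp
  have E: "E \<in> U" unfolding E_def by (rule snoc.IH[OF r])
  have I: "i \<in> I" "j \<in> I" "set p \<subseteq> I" using set_I[OF snoc.prems] by auto
  have "alpha n i (wact n p (sr n j (rho n))) > 0"
    using snoc.prems by (simp add: redu_Cons)
  then have "contr (\<lambda>l. - sr n j (rho n) l) E"
    unfolding E_def by (rule contr_sl_x[OF I(3,1)])
  then have "E \<in> N j" using chi_zero_N[OF I(2) E] chi_contr[OF I(2) E] by blast
  moreover have "sg b j * sg (\<not> b) j = 1" "sg (\<not> b) j * sg b j = 1" using sg_inv(1)[of b j] sg_inv(1)[of "\<not> b" j] by auto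
  ultimately have "sg b j * E * sg (\<not> b) j \<in> U" using sg_Sg by (auto simp: N_def)
  moreover have "sl b (rev (p @ [j])) * x i t * sl (\<not> b) (p @ [j]) = sg b j * E * sg (\<not> b) j"
    by (simp add: E_def mult.assoc)
  ultimately show ?case by simp
qed

definition xs_prod where "xs_prod b ws = prod_list (map (\<lambda>(i, s, t). x i s * sg b i * x i t) ws)"

lemma xs_prod_simps [simp]: "xs_prod b [] = 1"
  "xs_prod b ((i, s, t) # ws) = x i s * sg b i * x i t * xs_prod b ws"
  "xs_prod b (ws @ ws') = xs_prod b ws * xs_prod b ws'"
  by (simp_all add: xs_prod_def)

text \<open>Bruhat decomposition of products of factors \<open>x\<^sub>i(s) sg\<^sub>i x\<^sub>i(t)\<close>, multiplying from the right to the
  left; a new factor changes \<open>v\<close> by a root subgroup element, hence does not change \<open>chi k v\<close> unless the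
  root is \<open>\<alpha>\<^sub>k\<close>.\<close>

lemma xs_prod_step:
  assumes red: "redu n (i # p)" and u: "u \<in> U" and v: "v \<in> U"
  obtains u' E where "u' \<in> U" "E \<in> U" "x i s * sg b i * x i t * (u * sl b p * v) = u' * sl b (i # p) * (E * v)"
    "\<And>k. k \<in> I \<Longrightarrow> alpha n i (wact n p (sr n k (rho n))) > 0 \<Longrightarrow> chi k E = 0"
proof -
  have I: "i \<in> I" "set p \<subseteq> I" using set_I[OF red] by auto
  have "x i t * u \<in> U" using I u by blast
  then obtain a w where w: "w \<in> N i" "x i t * u = w * x i a" using U_decomp'[OF _ I(1)] by blast
  have s: "sg b i * sg (\<not> b) i = 1" "sg (\<not> b) i * sg b i = 1"
    using sg_inv(1)[of b i] sg_inv(1)[of "\<not> b" i] by auto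
  then have w': "sg b i * w * sg (\<not> b) i \<in> U" using w(1) sg_Sg by (auto simp: N_def)
  define E where "E = sl (\<not> b) (rev p) * x i a * sl b p"
  have E: "E \<in> U" using sl_conj_U[OF red, of "\<not> b"] by (simp add: E_def)
  have "x i s * sg b i * x i t * (u * sl b p * v) = x i s * sg b i * (x i t * u) * sl b p * v"
    by (simp only: mult.assoc)
  also have "\<dots> = x i s * sg b i * w * ((sg (\<not> b) i * sg b i) * (x i a * (sl b p * v)))"
    unfolding w(2) s by (simp only: mult.assoc mult_1_left)
  also have "x i a * (sl b p * v) = sl b p * sl (\<not> b) (rev p) * (x i a * (sl b p * v))"
    by (simp only: sl_inv mult_1_left)
  also have "x i s * sg b i * w * ((sg (\<not> b) i * sg b i) * (sl b p * sl (\<not> b) (rev p) * (x i a * (sl b p * v))))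
     = (x i s * (sg b i * w * sg (\<not> b) i)) * sl b (i # p) * (E * v)"
    unfolding E_def by (simp only: mult.assoc sl_simps)
  finally have e: "x i s * sg b i * x i t * (u * sl b p * v) = (x i s * (sg b i * w * sg (\<not> b) i)) * sl b (i # p) * (E * v)" .
  have "x i s * (sg b i * w * sg (\<not> b) i) \<in> U" using I w' by blast
  moreover have "chi k E = 0" if "k \<in> I" "alpha n i (wact n p (sr n k (rho n))) > 0" for k
    using contr_sl_x[OF I(2,1) that(2), of "\<not> b" a] by (intro chi_contr[OF that(1) E]) (simp add: E_def)
  ultimately show ?thesis using that E e by blast
qed

lemma xs_prod_decomp:
  assumes "redu n (map fst ws @ p)" and u: "u \<in> U" and v: "v \<in> U" and k: "k \<in> I"
    and "\<And>q i q'. map fst ws = q @ i # q' \<Longrightarrow> alpha n i (wact n (q' @ p) (sr n k (rho n))) > 0"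
  shows "\<exists>u'\<in>U. \<exists>v'\<in>U. xs_prod b ws * (u * sl b p * v) = u' * sl b (map fst ws @ p) * v' \<and> chi k v' = chi k v"
  using assms(1,5)
proof (induction ws)
  case Nil
  then show ?case using u v by auto
next
  case (Cons a ws)
  obtain i s t where a: "a = (i, s, t)" by (cases a)
  have red: "redu n (i # (map fst ws @ p))" using Cons.prems(1) by (simp add: a)
  then have "redu n (map fst ws @ p)" by (simp add: redu_Cons)
  moreover have "alpha n j (wact n (q' @ p) (sr n k (rho n))) > 0" if "map fst ws = q @ j # q'" for q j q'
    by (rule Cons.prems(2)[of "i # q"]) (use that in \<open>simp add: a\<close>)
  ultimately obtain u' v' where IH: "u' \<in> U" "v' \<in> U" "chi k v' = chi k v"
    "xs_prod b ws * (u * sl b p * v) = u' * sl b (map fst ws @ p) * v'" using Cons.IH by blast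
  obtain u'' E where E: "u'' \<in> U" "E \<in> U"
    "x i s * sg b i * x i t * (u' * sl b (map fst ws @ p) * v') = u'' * sl b (i # (map fst ws @ p)) * (E * v')"
    "\<And>k. k \<in> I \<Longrightarrow> alpha n i (wact n (map fst ws @ p) (sr n k (rho n))) > 0 \<Longrightarrow> chi k E = 0"
    using xs_prod_step[OF red IH(1,2)] by metis
  have "chi k E = 0" using Cons.prems(2)[of "[]" i "map fst ws"] k by (intro E(4)) (simp_all add: a)
  then have c: "chi k (E * v') = chi k v" using chi_mult[OF k E(2) IH(2)] IH(3) by simp
  have "xs_prod b (a # ws) * (u * sl b p * v) = x i s * sg b i * x i t * (xs_prod b ws * (u * sl b p * v))"
    by (simp only: a xs_prod_simps mult.assoc)
  also have "\<dots> = u'' * sl b (map fst (a # ws) @ p) * (E * v')"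
    unfolding IH(4) E(3) by (simp add: a)
  finally show ?case using E(1,2) IH(2) c by blast
qed

text \<open>Inverting a product of factors x_i(s) sg_i x_i(t) reverses their order, exchanges and
  negates s and t, and flips the kind of lift.\<close>

definition xs_rev where "xs_rev ws = rev (map (\<lambda>(i, s, t). (i, - t, - s)) ws)"

lemma xs_rev_simps [simp]: "xs_rev [] = []" "xs_rev ((i, s, t) # ws) = xs_rev ws @ [(i, - t, - s)]"
  "map fst (xs_rev ws) = rev (map fst ws)" "xs_rev (ws @ ws') = xs_rev ws' @ xs_rev ws"
  by (auto simp: xs_rev_def rev_map split: prod.splits intro!: map_cong)

lemma xs_prod_rev': "xs_prod b ws * xs_prod (\<not> b) (xs_rev ws) = 1"
proof (induction ws rule: rev_induct)
  case (snoc a ws)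
  obtain i s t where a: "a = (i, s, t)" by (cases a)
  show ?case using snoc by (simp add: a mult.assoc)
qed simp

end


context minors
begin

section \<open>The vector representation\<close>

lemma exp_int_neq: "a \<noteq> b \<Longrightarrow> exp (of_int a) \<noteq> (exp (of_int b) :: complex)"
  by (metis exp_inj_iff exp_of_real of_int_eq_iff of_real_eq_iff of_real_of_int_eq)

text \<open>A coefficient between extremal vectors of different weights vanishes: a torus element w
  that separates the weights scales it in two ways.\<close>

lemma rw_weight_zero:
  assumes k: "k \<in> I" and p: "set p \<subseteq> I" "set q \<subseteq> I"
    and w: "Lam n k (wact n (rev p) w) = of_int a" "Lam n k (wact n (rev q) w) = of_int b" "a \<noteq> b"
  shows "rw k p (sl True q) = 0"
proof -
  have "rw k p (tau 1 w * sl True q) = rw k p (sl True q * tau 1 (wact n (rev q) w))"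
    by (simp add: sl_tau p)
  moreover have "rw k p (tau 1 w * sl True q) = exp (of_int a) * rw k p (sl True q)"
    using rw_tau[OF k p(1) sl_G[OF p(2)], where r = 1 and w = w] w(1) by simp
  moreover have "rw k p (sl True q * tau 1 (wact n (rev q) w)) = exp (of_int b) * rw k p (sl True q)"
    using D_right_tau[OF k G_I(4)[OF p'(1)[OF k p(1)] sl_G[OF p(2)]], where r = 1 and w = "wact n (rev q) w"] w(2)
    by (simp add: rw_def mult.assoc)
  ultimately show ?thesis using exp_int_neq[OF w(3)] by (metis mult_cancel_right)
qed

text \<open>For equal weights, conjugating u by the torus leaves the coefficient unchanged while
  contracting u to 1.\<close>

lemma rw_U_const:
  assumes k: "k \<in> I" and p: "set p \<subseteq> I" "set q \<subseteq> I"
    and w: "\<And>w. Lam n k (wact n (rev p) w) = Lam n k (wact n (rev q) w)" and u: "u \<in> U"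
  shows "rw k p (u * sl True q) = rw k p (sl True q)"
proof -
  define w where "w = (\<lambda>j. - rho n j)"
  define g where "g r = tau (of_real r) w * u * tau (- of_real r) w * sl True q" for r :: real
  have uG: "u * sl True q \<in> G" by (intro G_I(4) U_G u sl_G p)
  have "rw k p (g r) = rw k p (u * sl True q)" for r
  proof -
    have t: "tau (- of_real r) w * sl True q = sl True q * tau (- of_real r) (wact n (rev q) w)"
      by (simp add: sl_tau p)
    have "g r = tau (of_real r) w * ((u * sl True q) * tau (- of_real r) (wact n (rev q) w))"
      unfolding g_def mult.assoc t ..
    then have "rw k p (g r) = exp (of_real r * Lam n k (wact n (rev p) w)) *
        rw k p ((u * sl True q) * tau (- of_real r) (wact n (rev q) w))"
      using rw_tau[OF k p(1) G_I(4)[OF uG tau_G]] by simp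
    also have "rw k p ((u * sl True q) * tau (- of_real r) (wact n (rev q) w))
      = exp (- of_real r * Lam n k (wact n (rev q) w)) * rw k p (u * sl True q)"
      using D_right_tau[OF k G_I(4)[OF p'(1)[OF k p(1)] uG], where r = "- of_real r" and w = "wact n (rev q) w"]
      by (simp only: rw_def mult.assoc)
    finally show ?thesis unfolding w[of w] by (simp add: exp_minus)
  qed
  moreover have "((\<lambda>r. rw k p (g r)) \<longlongrightarrow> rw k p (1 * sl True q)) at_top"
    unfolding rw_def
  proof (rule D_lim[OF k])
    have "(g \<longlongrightarrow> 1 * sl True q) at_top"
      unfolding g_def using contr_U[OF u] unfolding contr_def w_def by (intro tendsto_mult tendsto_const)
    then show "((\<lambda>r. sl False (rev p) * g r) \<longlongrightarrow> sl False (rev p) * (1 * sl True q)) at_top"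
      by (intro tendsto_mult tendsto_const)
    show "sl False (rev p) * g r \<in> G" for r unfolding g_def
      by (intro G_I(4) tau_G U_G u sl_G) (use p in auto)
    show "sl False (rev p) * (1 * sl True q) \<in> G"
      by (intro G_I(3,4) sl_G) (use p in auto)
  qed
  ultimately have "((\<lambda>r::real. rw k p (u * sl True q)) \<longlongrightarrow> rw k p (sl True q)) at_top" by simp
  then show ?thesis by (simp add: tendsto_const_iff)
qed

lemma rw_append: "rw k (q @ p) (sl True q * g) = rw k p g"
proof -
  have "sl False (rev q) * (sl True q * g) = g"
    using sl_inv[of False "rev q"] by (simp flip: mult.assoc)
  then show ?thesis by (simp add: rw_def mult.assoc)
qed

lemma I1: "1 \<in> I" "n \<in> I" "n - 1 \<in> I"
  using n2 by (auto simp: I_def)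

lemma Lam_1: "Lam n 1 w = of_int (w 1)"
  using n2 by (simp add: Lam_def)

text \<open>\<open>pj j\<close> is the word j-1, ..., 1 taking \<epsilon>_1 to \<epsilon>_j, and
  \<open>pb j\<close> the word j, ..., n, ..., 1 taking \<epsilon>_1 to -\<epsilon>_j.\<close>

definition pj where "pj j = rev [1..<j]"
definition pb where "pb j = [j..<n+1] @ pj n"

lemma pj_Suc: "1 \<le> j \<Longrightarrow> pj (Suc j) = j # pj j"
  by (simp add: pj_def)

lemma pb_Suc: "j < n \<Longrightarrow> pb j = j # pb (Suc j)"
  by (simp add: pb_def upt_rec)

lemma pb_n: "pb n = n # pj n"
  by (simp add: pb_def)

lemma set_pj: "j \<le> n \<Longrightarrow> set (pj j) \<subseteq> I" and set_pb: "1 \<le> j \<Longrightarrow> set (pb j) \<subseteq> I"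
  by (auto simp: pj_def pb_def I_def)

lemma wact_pj: "1 \<le> j \<Longrightarrow> j \<le> n \<Longrightarrow> wact n (pj j) z l = (if l < 1 \<or> j < l then z l else if l = j then z 1 else z (Suc l))"
  unfolding pj_def by (rule wact_down)

lemma wact_pb: "1 \<le> j \<Longrightarrow> j \<le> n \<Longrightarrow> 1 \<le> l \<Longrightarrow> l \<le> n \<Longrightarrow>
    wact n (pb j) z l = (if l < j then z (Suc l) else if l = j then - z 1 else z l)"
proof -
  assume j: "1 \<le> j" "j \<le> n" and l: "1 \<le> l" "l \<le> n"
  have e: "wact n (pb j) z = wact n [j..<n+1] (wact n (pj n) z)" unfolding pb_def by (rule wact_simps(3))
  have p: "wact n (pj n) z m = (if m = n then z 1 else z (Suc m))" if "1 \<le> m" "m \<le> n" for m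
    using wact_pj[of n z m] that by simp
  show ?thesis
    unfolding e wact_up[OF j] using j l p[of l] p[of n] p[of "l - 1"]
    by (cases "l - 1 = n") (simp_all add: not_less)
qed

lemma wt_pj: "1 \<le> j \<Longrightarrow> j \<le> n \<Longrightarrow> Lam n 1 (wact n (rev (pj j)) w) = of_int (w j)"
  using wact_pj[of j "wact n (rev (pj j)) w" j] by (simp add: Lam_1[unfolded One_nat_def])

lemma wt_pb: "1 \<le> j \<Longrightarrow> j \<le> n \<Longrightarrow> Lam n 1 (wact n (rev (pb j)) w) = of_int (- w j)"
  using wact_pb[of j j "wact n (rev (pb j)) w"] by (simp add: Lam_1[unfolded One_nat_def])

lemma alpha_pj: assumes "i \<in> I" "1 \<le> j" "j \<le> n"
  shows "Suc i \<noteq> j \<Longrightarrow> alpha n i (wact n (pj j) (rho n)) > 0"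
    "Suc i = j \<Longrightarrow> alpha n i (wact n (pj j) (rho n)) < 0"
  using assms by (auto simp: alpha_def wact_pj rho_def I_def)

lemma alpha_pb: assumes "i \<in> I" "1 \<le> j" "j \<le> n"
  shows "i \<noteq> j \<Longrightarrow> alpha n i (wact n (pb j) (rho n)) > 0"
    "i = j \<Longrightarrow> alpha n i (wact n (pb j) (rho n)) < 0"
  using assms by (auto simp: alpha_def wact_pb rho_def I_def)

text \<open>The coordinates of \<open>g v\<^sub>1\<close> at \<open>v\<^sub>j\<close> and \<open>v\<^sub>j\<close> with a bar; that at \<open>v\<^sub>0\<close> is not extremal
  and is obtained from the action of \<open>x\<^sub>n\<close> in \<open>R0\<close> below.\<close>

definition R where "R j g = (if j = 0 then 0 else rw 1 (pj j) g)"
definition Rb where "Rb j g = rw 1 (pb j) g"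

context
  fixes i j g assumes i: "i \<in> I" and j: "1 \<le> j" "j \<le> n" and g: "g \<in> G"
begin

lemma R_y: "Suc i \<noteq> j \<Longrightarrow> R j (y i t * g) = R j g"
  using rw_y[OF I1(1) set_pj[OF j(2)] i alpha_pj(1)[OF i j] g] j by (simp add: R_def)

lemma R_x: "i \<noteq> j \<Longrightarrow> R j (x i t * g) = R j g"
proof (cases "Suc i = j")
  case True
  then show ?thesis using rw_x[OF I1(1) set_pj[OF j(2)] i alpha_pj(2)[OF i j] g] j by (simp add: R_def)
next
  case False
  assume "i \<noteq> j"
  then have "coroot i j = 0" using False by (auto simp: coroot_def)
  then show ?thesis
    using rw_x0[OF I1(1) set_pj[OF j(2)] i alpha_pj(1)[OF i j False] _ g] wt_pj[OF j] j by (simp add: R_def)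
qed

lemma R_al: "t \<noteq> 0 \<Longrightarrow> R j (al i t * g) = t powi (coroot i j) * R j g"
  using rw_al[OF I1(1) set_pj[OF j(2)] i wt_pj[OF j] _ g] j by (simp add: R_def)

lemma Rb_y: "i \<noteq> j \<Longrightarrow> Rb j (y i t * g) = Rb j g"
  using rw_y[OF I1(1) set_pb[OF j(1)] i alpha_pb(1)[OF i j] g] j by (simp add: Rb_def)

lemma Rb_al: "t \<noteq> 0 \<Longrightarrow> Rb j (al i t * g) = t powi (- coroot i j) * Rb j g"
  using rw_al[OF I1(1) set_pb[OF j(1)] i wt_pb[OF j] _ g] j by (simp add: Rb_def)

lemma Rb_x: "Suc i \<noteq> j \<Longrightarrow> Rb j (x i t * g) = Rb j g"
proof (cases "i = j")
  case True
  then show ?thesis using rw_x[OF I1(1) set_pb[OF j(1)] i alpha_pb(2)[OF i j] g] j by (simp add: Rb_def)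
next
  case False
  assume "Suc i \<noteq> j"
  then have "coroot i j = 0" using False by (auto simp: coroot_def)
  then show ?thesis
    using rw_x0[OF I1(1) set_pb[OF j(1)] i alpha_pb(1)[OF i j False] _ g] wt_pb[OF j] j by (simp add: Rb_def)
qed

end

lemma R_x1: assumes "1 \<le> j" "j < n" "g \<in> G" shows "R j (x j t * g) = R j g + t * R (Suc j) g"
proof -
  have j: "j \<in> I" "1 \<le> j" "j \<le> n" "coroot j j = 1" using assms by (auto simp: I_def coroot_def)
  then show ?thesis
    using rw_x1[OF I1(1) set_pj[OF j(3)] j(1) alpha_pj(1)[OF j(1-3)] _ assms(3)] wt_pj[OF j(2,3)] assms
    by (simp add: R_def pj_Suc)
qed

lemma R_y1: assumes "1 \<le> j" "j < n" "g \<in> G" shows "R (Suc j) (y j t * g) = R (Suc j) g + t * R j g"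
proof -
  have j: "j \<in> I" "1 \<le> j" "j \<le> n" "coroot j j = 1" using assms by (auto simp: I_def coroot_def)
  then show ?thesis
    using rw_y1[OF I1(1) set_pj[OF j(3)] j(1) alpha_pj(1)[OF j(1-3)] _ assms(3)] wt_pj[OF j(2,3)] assms
    by (simp add: R_def pj_Suc)
qed

lemma Rb_y1: assumes "1 \<le> j" "j < n" "g \<in> G" shows "Rb j (y j t * g) = Rb j g + t * Rb (Suc j) g"
proof -
  have j: "j \<in> I" "1 \<le> Suc j" "Suc j \<le> n" "- coroot j (Suc j) = 1" using assms by (auto simp: I_def coroot_def)
  then have "Lam n 1 (wact n (rev (pb (Suc j))) (coroot j)) = 1"
    using wt_pb[OF j(2,3), of "coroot j"] by (simp only: of_int_1)
  then show ?thesis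
    using rw_y1[OF I1(1) set_pb[OF j(2)] j(1) alpha_pb(1)[OF j(1-3)] _ assms(3)] assms
    by (simp add: Rb_def pb_Suc)
qed

text \<open>The linear coefficient of the quadratic polynomial R n (x n t * g) in t, isolated at t =
  1 by subtracting the constant and the leading coefficient.\<close>

definition R0 where "R0 g = R n (x n 1 * g) - R n g - Rb n g"

lemma n_pos: "1 \<le> n" using n2 by simp

lemma R_x2: assumes g: "g \<in> G" shows "R n (x n t * g) = R n g + t * R0 g + t^2 * Rb n g"
proof -
  have c: "coroot n n = 2" by (simp add: coroot_def)
  obtain M where M: "\<And>t. R n (x n t * g) = R n g + t * M + t^2 * Rb n g"
    using rw_x2[OF I1(1) set_pj[OF order_refl] I1(2) alpha_pj(1)[OF I1(2) n_pos order_refl] _ g]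
      wt_pj[OF n_pos order_refl, of "coroot n"] c n2
    unfolding R_def Rb_def pb_n by auto
  have "R0 g = M" using M[of 1] by (simp add: R0_def)
  then show ?thesis using M by simp
qed

lemma Rb_y2: assumes g: "g \<in> G" shows "Rb n (y n t * g) = Rb n g + t * R0 g + t^2 * R n g"
proof (cases "t = 0")
  case False
  have c: "coroot n n = 2" by (simp add: coroot_def)
  have "Lam n 1 (wact n (rev (pj n)) (coroot n)) = of_nat 2"
    using wt_pj[OF n_pos order_refl, of "coroot n"] c by simp
  then have "Rb n (y n t * g) = t^2 * R n (x n (inverse t) * g)"
    using rw_y_lower[OF I1(1) set_pj[OF order_refl] I1(2) alpha_pj(1)[OF I1(2) n_pos order_refl] _ False g] n2
    by (simp add: R_def Rb_def pb_n)
  also have "\<dots> = Rb n g + t * R0 g + t^2 * R n g"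
    unfolding R_x2[OF g] using False by (simp add: power2_eq_square field_simps)
  finally show ?thesis .
qed simp

text \<open>Compare \<open>Rb_y2\<close> for the parameter 1 + t with its two successive
  applications; the factor 2 is the cross term of (1 + t)^2. It becomes the coefficient 2 of the
  theorem.\<close>

lemma R0_y: assumes g: "g \<in> G" shows "R0 (y n t * g) = R0 g + 2 * t * R n g"
proof -
  have yg: "y n t * g \<in> G" by (intro G_I(2,4) I1 g)
  have "Rb n (y n 1 * (y n t * g)) = Rb n (y n (1 + t) * g)" by (simp add: y_add_assoc)
  then show ?thesis
    unfolding Rb_y2[OF yg] Rb_y2[OF g] R_y[OF I1(2) n_pos order_refl g, of t, simplified]
    by (simp add: power2_eq_square algebra_simps)
qed

text \<open>v_0 has weight zero: the torus rescales the parameter of x_n by the inverse of the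
  factor it contributes to the coordinate at v_n.\<close>

lemma R0_tau: assumes g: "g \<in> G" shows "R0 (tau r w * g) = R0 g"
proof -
  define E where "E = exp (r * of_int (w n))"
  have E: "E \<noteq> 0" "exp (- (r * of_int (w n))) = inverse E" by (simp_all add: E_def exp_minus)
  have a: "alpha n n w = w n" by (simp add: alpha_def)
  have "tau r w * x n (inverse E) = x n 1 * tau r w"
    using tau_x[OF I1(2), of r w "inverse E"] E(1) by (simp add: a flip: E_def)
  then have x: "x n 1 * (tau r w * g) = tau r w * (x n (inverse E) * g)"
    by (metis mult.assoc)
  have xg: "x n (inverse E) * g \<in> G" by (intro G_I(1,4) I1 g)
  have "R n (tau r w * g') = E * R n g'" "Rb n (tau r w * g') = inverse E * Rb n g'" if "g' \<in> G" for g'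
    using rw_tau[OF I1(1) set_pj[OF order_refl] that, of r w] wt_pj[OF n_pos order_refl, of w] n2
      rw_tau[OF I1(1) set_pb[OF n_pos] that, of r w] wt_pb[OF n_pos order_refl, of w] E(2)
    by (simp_all add: R_def Rb_def flip: E_def)
  note t = this[OF g] this[OF xg]
  show ?thesis
    unfolding R0_def[of "tau r w * g"] x t R_x2[OF g] using E(1)
    by (simp add: field_simps power2_eq_square)
qed

section \<open>Action of one factor of the product on the coordinates\<close>

definition BY where "BY i c = y i c * al i (inverse c)"

lemma BY_expand: "i \<in> I \<Longrightarrow> c \<noteq> 0 \<Longrightarrow> BY i c = x i (inverse c) * sg True i * x i c"
  unfolding BY_def sg_def by (simp add: bold_expand)

lemma BY_G: "i \<in> I \<Longrightarrow> BY i c \<in> G"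
  unfolding BY_def by (intro G_I(2,4) al_G)

lemma powi_inverse: "inverse (c::complex) powi m = c powi (- m)"
  by (simp add: power_int_minus power_int_inverse)

context
  fixes i and c :: complex and g assumes i: "i \<in> I" and c: "c \<noteq> 0" and g: "g \<in> G"
begin

lemma alg: "al i (inverse c) * g \<in> G"
  by (intro G_I(4) al_G i g)

lemma ic: "inverse c \<noteq> 0" using c by simp

lemma R_BY: assumes j: "1 \<le> j" "j \<le> n"
  shows "R j (BY i c * g) = (if Suc i = j then c * R j g + R i g else if i = j then (if j = n then inverse c ^ 2 else inverse c) * R j g else R j g)"
proof (cases "Suc i = j")
  case True
  then have i': "1 \<le> i" "i < n" "i \<le> n" using i j by (auto simp: I_def)
  have cr: "coroot i i = 1" "coroot i j = -1" using True i' by (auto simp: coroot_def)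
  have "R j (BY i c * g) = R j (al i (inverse c) * g) + c * R i (al i (inverse c) * g)"
    using R_y1[OF i'(1,2) alg, of c] True by (simp add: BY_def mult.assoc)
  also have "\<dots> = c * R j g + R i g"
    using R_al[OF i j g ic] R_al[OF i i'(1,3) g ic] c by (simp add: cr powi_inverse)
  finally show ?thesis using True by simp
next
  case False
  have "R j (BY i c * g) = R j (al i (inverse c) * g)"
    using R_y[OF i j alg False] by (simp add: BY_def mult.assoc)
  also have "\<dots> = inverse c powi coroot i j * R j g"
    by (rule R_al[OF i j g ic])
  finally show ?thesis using False j by (auto simp: coroot_def)
qed

lemma Rb_BY: assumes j: "1 \<le> j" "j \<le> n"
  shows "Rb j (BY i c * g) = (if i = j then (if j = n then c ^ 2 * Rb j g + c * R0 g + R n g else c * Rb j g + Rb (Suc j) g)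
     else if Suc i = j then inverse c * Rb j g else Rb j g)"
proof (cases "i = j")
  case True
  show ?thesis
  proof (cases "j = n")
    case True
    have cr: "coroot n n = 2" by (simp add: coroot_def)
    have i': "i = n" using True \<open>i = j\<close> by simp
    have "Rb n (BY n c * g) = Rb n (al n (inverse c) * g) + c * R0 (al n (inverse c) * g) + c^2 * R n (al n (inverse c) * g)"
      using Rb_y2[OF alg, of c] by (simp add: BY_def mult.assoc i')
    also have "R0 (al n (inverse c) * g) = R0 g"
      unfolding al_tau[OF I1(2)] by (rule R0_tau[OF g])
    also have "Rb n (al n (inverse c) * g) = c^2 * Rb n g"
      using Rb_al[OF I1(2) n_pos order_refl g ic] by (simp add: cr powi_inverse)
    also have "R n (al n (inverse c) * g) = inverse c ^ 2 * R n g"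
      using R_al[OF I1(2) n_pos order_refl g ic] by (simp add: cr)
    finally show ?thesis using True \<open>i = j\<close> c by (simp add: power_inverse)
  next
    case False
    then have j': "1 \<le> j" "j < n" "Suc j \<le> n" "1 \<le> Suc j" using j by auto
    have cr: "coroot j j = 1" "coroot j (Suc j) = -1" using j' by (auto simp: coroot_def)
    have "Rb j (BY i c * g) = Rb j (al j (inverse c) * g) + c * Rb (Suc j) (al j (inverse c) * g)"
      using Rb_y1[OF j'(1,2) alg, of c] True by (simp add: BY_def mult.assoc)
    also have "\<dots> = c * Rb j g + Rb (Suc j) g"
      using Rb_al[OF i j g ic] Rb_al[OF i j'(4,3) g ic] c True by (simp add: cr powi_inverse)
    finally show ?thesis using True False by simp
  qed
next
  case False
  have "Rb j (BY i c * g) = Rb j (al i (inverse c) * g)"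
    using Rb_y[OF i j alg False] by (simp add: BY_def mult.assoc)
  also have "\<dots> = inverse c powi (- coroot i j) * Rb j g"
    by (rule Rb_al[OF i j g ic])
  finally show ?thesis using False j by (auto simp: coroot_def)
qed

end

lemma R0_BY_n: assumes c: "c \<noteq> 0" and g: "g \<in> G"
  shows "R0 (BY n c * g) = R0 g + 2 * inverse c * R n g"
proof -
  have cr: "coroot n n = 2" by (simp add: coroot_def)
  have "R0 (BY n c * g) = R0 (al n (inverse c) * g) + 2 * c * R n (al n (inverse c) * g)"
    using R0_y[OF alg[OF I1(2) c g], of c] by (simp add: BY_def mult.assoc)
  also have "R0 (al n (inverse c) * g) = R0 g"
    unfolding al_tau[OF I1(2)] by (rule R0_tau[OF g])
  also have "R n (al n (inverse c) * g) = inverse c ^ 2 * R n g"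
    using R_al[OF I1(2) n_pos order_refl g, of "inverse c"] c by (simp add: cr)
  finally show ?thesis using c by (simp add: power2_eq_square)
qed

lemma x_y_commute: "i \<in> I \<Longrightarrow> j \<in> I \<Longrightarrow> i \<noteq> j \<Longrightarrow> x i s * y j t = y j t * x i s"
  unfolding x_def y_def using ef[of i j] by (intro ep_comm) (simp add: I_def)

text \<open>R0 is defined through x_n(1), which must be moved past the factor: it commutes with y_i
  and is rescaled by the torus part only for i = n - 1. In that case the scalings of the three
  coordinates compensate.\<close>

lemma R0_BY: assumes i: "i \<in> I" "i \<noteq> n" and c: "c \<noteq> 0" and g: "g \<in> G"
  shows "R0 (BY i c * g) = R0 g"
proof -
  define a where "a = coroot i n"
  have a: "a = (if Suc i = n then -1 else 0)" using i by (auto simp: a_def coroot_def I_def)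
  have al: "alpha n n (coroot i) = a" by (simp add: alpha_def a_def)
  define s where "s = exp (Ln (inverse c) * of_int (- a))"
  have s: "s = (if Suc i = n then inverse c else 1)" using c by (simp add: s_def a)
  have "al i (inverse c) * x n s = x n (exp (Ln (inverse c) * of_int a) * s) * al i (inverse c)"
    unfolding al_tau[OF i(1)] by (subst tau_x[OF I1(2)]) (simp add: al)
  also have "exp (Ln (inverse c) * of_int a) * s = 1" by (simp add: s_def flip: exp_add)
  finally have e: "x n 1 * al i (inverse c) = al i (inverse c) * x n s" by simp
  have "x n 1 * BY i c = BY i c * x n s"
    unfolding BY_def using x_y_commute[OF I1(2) i(1)] i(2) e by (metis mult.assoc)
  then have b: "x n 1 * (BY i c * g) = BY i c * (x n s * g)" by (metis mult.assoc)
  have xg: "x n s * g \<in> G" by (intro G_I(1,4) I1 g)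
  show ?thesis
  proof (cases "Suc i = n")
    case True
    then have i': "1 \<le> i" "i \<le> n" "n \<noteq> i" using i by (auto simp: I_def)
    have "c * R n (x n s * g) = c * R n g + R0 g + inverse c * Rb n g"
      unfolding R_x2[OF g, of s] using c True by (simp add: s power2_eq_square field_simps)
    moreover have "Rb n (BY i c * g) = inverse c * Rb n g"
      using Rb_BY[OF i(1) c g n_pos order_refl] True i(2) by simp
    moreover have "R n (BY i c * (x n s * g)) = c * R n (x n s * g) + R i (x n s * g)"
      "R n (BY i c * g) = c * R n g + R i g"
      using R_BY[OF i(1) c xg n_pos order_refl] R_BY[OF i(1) c g n_pos order_refl] True by simp_all
    ultimately show ?thesis
      unfolding R0_def[of "BY i c * g"] b using R_x[OF I1(2) i'(1,2) g i'(3), of s] by simp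
  next
    case False
    then show ?thesis
      unfolding R0_def[of "BY i c * g"] b
      using R_BY[OF i(1) c xg n_pos order_refl] R_BY[OF i(1) c g n_pos order_refl] Rb_BY[OF i(1) c g n_pos order_refl] i(2)
      by (simp add: s R0_def)
  qed
qed

end


section \<open>Action of a block and of products of blocks\<close>

context minors
begin

definition tail where "tail cc a = prod_list (map (\<lambda>i. BY i (cc i)) [a..<n+1])"

definition ee where "ee cc j = (if j = n then inverse (cc j) ^ 2 else inverse (cc j) :: complex)"

context
  fixes cc :: "nat \<Rightarrow> complex" and g assumes cc: "\<And>i. i \<in> I \<Longrightarrow> cc i \<noteq> 0" and g: "g \<in> G"
begin

lemma tail_Suc: "a \<le> n \<Longrightarrow> tail cc a * g = BY a (cc a) * (tail cc (Suc a) * g)"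
  by (simp add: tail_def upt_rec mult.assoc del: upt_Suc)

lemma tail_end: "tail cc (n+1) = 1"
  by (simp add: tail_def)

lemma tail_G: "1 \<le> a \<Longrightarrow> tail cc a \<in> G"
proof -
  assume a: "1 \<le> a"
  have "set l \<subseteq> I \<Longrightarrow> prod_list (map (\<lambda>i. BY i (cc i)) l) \<in> G" for l
    by (induction l) (auto intro!: G_I(3,4) BY_G)
  moreover have "set [a..<n+1] \<subseteq> I" using a by (auto simp: I_def)
  ultimately show ?thesis unfolding tail_def by blast
qed

lemma tail_g: "1 \<le> a \<Longrightarrow> tail cc a * g \<in> G"
  by (intro G_I(4) tail_G g)

lemma R_skip:
  assumes "1 \<le> j" "j \<le> n" "a \<le> b" "b \<le> n + 1" "1 \<le> a" "\<And>i. a \<le> i \<Longrightarrow> i < b \<Longrightarrow> i \<noteq> j \<and> Suc i \<noteq> j"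
  shows "R j (tail cc a * g) = R j (tail cc b * g)"
  using assms(3,5,6)
proof (induction rule: inc_induct)
  case (step m)
  have m: "m \<in> I" using step assms(4) by (simp add: I_def)
  have "R j (tail cc m * g) = R j (BY m (cc m) * (tail cc (Suc m) * g))"
    using step assms(4) by (subst tail_Suc) auto
  also have "\<dots> = R j (tail cc (Suc m) * g)"
    using R_BY[OF m cc[OF m] tail_g assms(1,2), of "Suc m"] step.prems(2)[of m] step.hyps by simp
  finally show ?case using step by simp
qed simp

lemma Rb_skip:
  assumes "1 \<le> j" "j \<le> n" "a \<le> b" "b \<le> n + 1" "1 \<le> a" "\<And>i. a \<le> i \<Longrightarrow> i < b \<Longrightarrow> i \<noteq> j \<and> Suc i \<noteq> j"
  shows "Rb j (tail cc a * g) = Rb j (tail cc b * g)"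
  using assms(3,5,6)
proof (induction rule: inc_induct)
  case (step m)
  have m: "m \<in> I" using step assms(4) by (simp add: I_def)
  have "Rb j (tail cc m * g) = Rb j (BY m (cc m) * (tail cc (Suc m) * g))"
    using step assms(4) by (subst tail_Suc) auto
  also have "\<dots> = Rb j (tail cc (Suc m) * g)"
    using Rb_BY[OF m cc[OF m] tail_g assms(1,2), of "Suc m"] step.prems(2)[of m] step.hyps by simp
  finally show ?case using step by simp
qed simp

lemma R0_skip: "1 \<le> a \<Longrightarrow> a \<le> n \<Longrightarrow> R0 (tail cc a * g) = R0 (tail cc n * g)"
proof (rotate_tac 1, induction rule: inc_induct)
  case (step m)
  have m: "m \<in> I" "m \<noteq> n" using step by (auto simp: I_def)
  have "R0 (tail cc m * g) = R0 (BY m (cc m) * (tail cc (Suc m) * g))"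
    using step by (subst tail_Suc) auto
  also have "\<dots> = R0 (tail cc (Suc m) * g)"
    by (rule R0_BY[OF m cc[OF m(1)] tail_g]) simp
  finally show ?case using step by simp
qed simp

lemma R_tail_high: "1 \<le> j \<Longrightarrow> j < a \<Longrightarrow> a \<le> n + 1 \<Longrightarrow> R j (tail cc a * g) = R j g"
  using R_skip[of j a "n+1"] by (simp add: tail_end[simplified])

lemma R_tail_same: "1 \<le> j \<Longrightarrow> j \<le> n \<Longrightarrow> R j (tail cc j * g) = ee cc j * R j g"
  using R_BY[of j "cc j" "tail cc (Suc j) * g" j] cc[of j] tail_g[of "Suc j"] R_tail_high[of j "Suc j"] tail_Suc[of j]
  by (simp add: I_def ee_def)

text \<open>In a block only the factors j - 1 and j touch coordinate j. The former adds coordinate j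
  - 1, which the later factors of the block leave alone.\<close>

lemma R_blk:
  assumes j: "1 \<le> j" "j \<le> n"
  shows "R j (tail cc 1 * g) = (if j = 1 then 1 else cc (j - 1)) * ee cc j * R j g + R (j - 1) g"
proof (cases "j = 1")
  case True
  then show ?thesis using R_tail_same[OF j] by (simp add: R_def[of 0])
next
  case False
  define i where "i = j - 1"
  have i: "i \<in> I" "Suc i = j" "1 \<le> i" "i \<le> n" using False j by (auto simp: i_def I_def)
  have "R j (tail cc 1 * g) = R j (tail cc i * g)"
    using i j by (intro R_skip) auto
  also have "\<dots> = R j (BY i (cc i) * (tail cc j * g))"
    using tail_Suc[OF i(4)] i(2) by simp
  also have "\<dots> = cc i * R j (tail cc j * g) + R i (tail cc j * g)"
    using R_BY[OF i(1) cc[OF i(1)] tail_g[OF j(1)] j] i(2) by simp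
  also have "R j (tail cc j * g) = ee cc j * R j g" by (rule R_tail_same[OF j])
  also have "R i (tail cc j * g) = R i g" using i j by (intro R_tail_high) auto
  finally show ?thesis using False by (simp add: i_def mult.assoc)
qed

text \<open>Factor j mixes coordinate j with j + 1 on the barred side, factor j + 1 mixes further,
  and factor n ends in v_0 and v_n. A single block thus runs through the whole barred half.\<close>

lemma Rb_tail_same:
  assumes j: "1 \<le> j" "j \<le> n"
  shows "Rb j (tail cc j * g) = (\<Sum>l=j..<n. cc l * Rb l g) + cc n ^ 2 * Rb n g + cc n * R0 g + R n g"
  using j(2,1)
proof (induction rule: inc_induct)
  case base
  have "Rb n (tail cc n * g) = Rb n (BY n (cc n) * (tail cc (n+1) * g))"
    using tail_Suc[of n] by simp
  then show ?case
    using Rb_BY[OF I1(2) cc[OF I1(2)] g n_pos order_refl] by (simp add: tail_end[simplified])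
next
  case (step m)
  have m: "m \<in> I" "1 \<le> m" "m \<le> n" "m \<noteq> n" using step j by (auto simp: I_def)
  have "Rb m (tail cc m * g) = Rb m (BY m (cc m) * (tail cc (Suc m) * g))"
    using tail_Suc[of m] m by simp
  also have "\<dots> = cc m * Rb m (tail cc (Suc m) * g) + Rb (Suc m) (tail cc (Suc m) * g)"
    using Rb_BY[OF m(1) cc[OF m(1)] tail_g m(2,3), of "Suc m"] m(4) by simp
  also have "Rb m (tail cc (Suc m) * g) = Rb m g"
    using Rb_skip[of m "Suc m" "n+1"] m by (simp add: tail_end[simplified])
  finally show ?case
    using step m by (simp add: sum.atLeast_Suc_lessThan)
qed

lemma Rb_blk:
  assumes j: "1 \<le> j" "j \<le> n"
  shows "Rb j (tail cc 1 * g) = (if j = 1 then 1 else inverse (cc (j - 1))) *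
    ((\<Sum>l=j..<n. cc l * Rb l g) + cc n ^ 2 * Rb n g + cc n * R0 g + R n g)"
proof (cases "j = 1")
  case True
  then show ?thesis using Rb_tail_same[OF j] by simp
next
  case False
  define i where "i = j - 1"
  have i: "i \<in> I" "Suc i = j" "1 \<le> i" "i \<le> n" using False j by (auto simp: i_def I_def)
  have "Rb j (tail cc 1 * g) = Rb j (tail cc i * g)"
    using i j by (intro Rb_skip) auto
  also have "\<dots> = Rb j (BY i (cc i) * (tail cc j * g))"
    using tail_Suc[OF i(4)] i(2) by simp
  also have "\<dots> = inverse (cc i) * Rb j (tail cc j * g)"
    using Rb_BY[OF i(1) cc[OF i(1)] tail_g[OF j(1)] j] i(2) by auto
  finally show ?thesis using False Rb_tail_same[OF j] by (simp add: i_def)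
qed

lemma R0_blk: "R0 (tail cc 1 * g) = R0 g + 2 * inverse (cc n) * R n g"
proof -
  have "R0 (tail cc 1 * g) = R0 (BY n (cc n) * (tail cc (n+1) * g))"
    using R0_skip[of 1] tail_Suc[of n] n_pos by simp
  then show ?thesis using R0_BY_n[OF cc[OF I1(2)] g] by (simp add: tail_end[simplified])
qed

end

lemma R_base:
  assumes "1 \<le> q" "q \<le> n" "1 \<le> j" "j \<le> n"
  shows "R j (sl True (pj q)) = (if j = q then 1 else 0)" "Rb j (sl True (pj q)) = 0"
proof -
  have S: "rw 1 (pj q) (sl True (pj q)) = 1"
    using rw_append[of 1 "pj q" "[]" 1] D_one[OF I1(1)] by (simp add: rw_Nil)
  have "rw 1 (pj j) (sl True (pj q)) = 0" if "j \<noteq> q"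
    by (rule rw_weight_zero[OF I1(1) set_pj set_pj, where w = "\<lambda>l. if l = q then 1 else 0" and a = 0 and b = 1])
       (use wt_pj[of j "\<lambda>l. if l = q then 1 else 0"] wt_pj[of q "\<lambda>l. if l = q then 1 else 0"] assms that in auto)
  then show "R j (sl True (pj q)) = (if j = q then 1 else 0)"
    using S assms by (auto simp: R_def)
  show "Rb j (sl True (pj q)) = 0"
    unfolding Rb_def
    by (rule rw_weight_zero[OF I1(1) set_pb set_pj, where w = "\<lambda>l. if l = q then 1 else 0" and a = "if j = q then -1 else 0" and b = 1])
       (use wt_pb[of j "\<lambda>l. if l = q then 1 else 0"] wt_pj[of q "\<lambda>l. if l = q then 1 else 0"] assms in auto)
qed

lemma sl_pj_G: "q \<le> n \<Longrightarrow> sl True (pj q) \<in> G"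
  by (intro sl_G set_pj)

lemma R0_right_tau: assumes g: "g \<in> G" shows "R0 (g * tau r w) = exp (r * of_int (w 1)) * R0 g"
proof -
  have L: "Lam n 1 w = of_int (w 1)" using Lam_1 .
  have "rw 1 p (g' * tau r w) = exp (r * of_int (w 1)) * rw 1 p g'" if "set p \<subseteq> I" "g' \<in> G" for p g'
    using D_right_tau[OF I1(1) G_I(4)[OF p'(1)[OF I1(1) that(1)] that(2)], where r = r and w = w]
    by (simp only: rw_def mult.assoc L)
  from this[OF set_pj[OF order_refl] g] this[OF set_pj[OF order_refl] G_I(4)[OF G_I(1)[OF I1(2)] g]]
    this[OF set_pb[OF n_pos] g]
  show ?thesis
    using n2 by (simp add: R0_def R_def Rb_def mult.assoc right_diff_distrib)
qed

text \<open>v_0 has weight zero and v_q has weight \<epsilon>_q; a torus element that separates them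
  forces the coordinate to vanish.\<close>

lemma R0_base: assumes q: "1 \<le> q" "q \<le> n" shows "R0 (sl True (pj q)) = 0"
proof -
  define w :: "nat \<Rightarrow> int" where "w = (\<lambda>l. if l = q then 1 else 0)"
  have w1: "wact n (rev (pj q)) w 1 = 1"
    using wt_pj[OF q, of w] by (simp add: Lam_1[unfolded One_nat_def] w_def)
  have "R0 (sl True (pj q)) = R0 (tau 1 w * sl True (pj q))"
    using R0_tau[OF sl_pj_G[OF q(2)]] by simp
  also have "tau 1 w * sl True (pj q) = sl True (pj q) * tau 1 (wact n (rev (pj q)) w)"
    using set_pj[OF q(2)] by (simp add: sl_tau)
  also have "R0 \<dots> = exp 1 * R0 (sl True (pj q))"
    using R0_right_tau[OF sl_pj_G[OF q(2)], of 1] w1 by simp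
  finally have "exp (of_int 0) * R0 (sl True (pj q)) = exp (of_int 1) * R0 (sl True (pj q))" by simp
  then show ?thesis using exp_int_neq[of 0 1] by (metis mult_cancel_right zero_neq_one)
qed

context
  fixes c :: "int \<Rightarrow> nat \<Rightarrow> complex" and q :: nat and M :: int
  assumes q: "1 \<le> q" "q \<le> n"
begin

text \<open>The blocks with superscripts M - d + 1, ..., M applied to v_q. Blocks are added on the
  left, so the superscript falls.\<close>

fun S where
  "S 0 = sl True (pj q)"
| "S (Suc d) = tail (c (M - int d)) 1 * S d"

definition nz where "nz d \<longleftrightarrow> (\<forall>t<d. \<forall>i\<in>I. c (M - int t) i \<noteq> 0)"

lemma nz_Suc: "nz (Suc d) \<Longrightarrow> nz d" "nz (Suc d) \<Longrightarrow> i \<in> I \<Longrightarrow> c (M - int d) i \<noteq> 0"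
  by (auto simp: nz_def)

lemma S_G: "nz d \<Longrightarrow> S d \<in> G"
proof (induction d)
  case 0
  then show ?case using sl_pj_G[OF q(2)] by simp
next
  case (Suc d)
  then show ?case using tail_g[OF nz_Suc(2)[OF Suc.prems] Suc.IH[OF nz_Suc(1)[OF Suc.prems]], where a = 1] by simp
qed

text \<open>The coefficient with which the block of superscript M - t leaves v_(q+t) in place
  instead of moving it on.\<close>

definition term_E where "term_E t = (if q + t = 1 then 1 else c (M - int t) (q + t - 1)) * ee (c (M - int t)) (q + t)"

text \<open>A block raises an unbarred index by at most one, and does so with coefficient 1.\<close>

lemma R_S:
  "nz d \<Longrightarrow> 1 \<le> j \<Longrightarrow> j \<le> n \<Longrightarrow> q + d \<le> j \<Longrightarrow> R j (S d) = (if j = q + d then 1 else 0)"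
proof (induction d arbitrary: j)
  case 0
  then show ?case using R_base(1)[OF q] by simp
next
  case (Suc d)
  have "R j (S (Suc d)) = (if j = 1 then 1 else c (M - int d) (j - 1)) * ee (c (M - int d)) j * R j (S d) + R (j - 1) (S d)"
    using R_blk[OF nz_Suc(2)[OF Suc.prems(1)] S_G[OF nz_Suc(1)[OF Suc.prems(1)]] Suc.prems(2,3)] by simp
  also have "R j (S d) = 0" using Suc.IH[OF nz_Suc(1)[OF Suc.prems(1)], of j] Suc.prems by simp
  also have "R (j - 1) (S d) = (if j = q + Suc d then 1 else 0)"
    using Suc.IH[OF nz_Suc(1)[OF Suc.prems(1)], of "j - 1"] Suc.prems q by auto
  finally show ?case by simp
qed

text \<open>To end one short of the greatest index, exactly one of the d blocks must leave the index
  in place; t records which.\<close>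

lemma R_S_stationary:
  "nz d \<Longrightarrow> q + d \<le> n + 1 \<Longrightarrow> R (q + d - 1) (S d) = (\<Sum>t<d. term_E t)"
proof (induction d)
  case 0
  then show ?case using R_base(1)[OF q, of "q - 1"] q by (cases "q = 1") (auto simp: R_def[of 0])
next
  case (Suc d)
  have j: "1 \<le> q + d" "q + d \<le> n" using Suc.prems q by auto
  have "R (q + d) (S (Suc d)) = term_E d * R (q + d) (S d) + R (q + d - 1) (S d)"
    using R_blk[OF nz_Suc(2)[OF Suc.prems(1)] S_G[OF nz_Suc(1)[OF Suc.prems(1)]] j] by (simp add: term_E_def)
  also have "R (q + d) (S d) = 1" using R_S[OF nz_Suc(1)[OF Suc.prems(1)] j] by simp
  also have "R (q + d - 1) (S d) = (\<Sum>t<d. term_E t)" using Suc.IH[OF nz_Suc(1)[OF Suc.prems(1)]] Suc.prems by simp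
  finally show ?case by simp
qed

text \<open>The barred half and v_0 can be entered only from v_n, which is first reached when q + d
  = n.\<close>

lemma Rb_S: "nz d \<Longrightarrow> q + d \<le> n \<Longrightarrow> (\<forall>j. 1 \<le> j \<longrightarrow> j \<le> n \<longrightarrow> Rb j (S d) = 0) \<and> R0 (S d) = 0"
proof (induction d)
  case 0
  then show ?case using R_base(2)[OF q] R0_base[OF q] by simp
next
  case (Suc d)
  note z = nz_Suc(2)[OF Suc.prems(1)] S_G[OF nz_Suc(1)[OF Suc.prems(1)]]
  have "R n (S d) = 0" using R_S[OF nz_Suc(1)[OF Suc.prems(1)] n_pos order_refl] Suc.prems by simp
  moreover have "(\<forall>j. 1 \<le> j \<longrightarrow> j \<le> n \<longrightarrow> Rb j (S d) = 0) \<and> R0 (S d) = 0"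
    using Suc.IH[OF nz_Suc(1)[OF Suc.prems(1)]] Suc.prems by simp
  ultimately show ?case
    using Rb_blk[OF z] R0_blk[OF z] n_pos by auto
qed

text \<open>With superscript M - d, the block takes v_n to all barred vectors and, with factor 2, to
  v_0; the next block collects these at the barred v_1. The resulting terms correspond to the v_l,
  to v_0, and, for vectors still at v_n after an earlier stop, to the barred v_j.\<close>

lemma Rb_S_final:
  assumes d: "q + d = n" and nz: "nz (Suc (Suc d))"
  shows "Rb 1 (S (Suc (Suc d))) =
    (\<Sum>l=1..<n. c (M - int d - 1) l * (if l = 1 then 1 else inverse (c (M - int d) (l - 1))))
    + c (M - int d - 1) n ^ 2 * inverse (c (M - int d) (n - 1))
    + 2 * (c (M - int d - 1) n * inverse (c (M - int d) n)) + (\<Sum>t<Suc d. term_E t)"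
proof -
  note z1 = nz_Suc(1)[OF nz] nz_Suc(1)[OF nz_Suc(1)[OF nz]]
  note z = nz_Suc(2)[OF z1(1)] S_G[OF z1(2)]
  note z' = nz_Suc(2)[OF nz] S_G[OF z1(1)]
  have 0: "R n (S d) = 1" "R0 (S d) = 0" "\<And>j. 1 \<le> j \<Longrightarrow> j \<le> n \<Longrightarrow> Rb j (S d) = 0"
    using R_S[OF z1(2) n_pos order_refl] Rb_S[OF z1(2)] d by auto
  have 1: "Rb j (S (Suc d)) = (if j = 1 then 1 else inverse (c (M - int d) (j - 1)))" if "1 \<le> j" "j \<le> n" for j
    using Rb_blk[OF z that] 0 that n_pos by simp
  have 2: "R0 (S (Suc d)) = 2 * inverse (c (M - int d) n)"
    using R0_blk[OF z] 0 by simp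
  have 3: "R n (S (Suc d)) = (\<Sum>t<Suc d. term_E t)"
    using R_S_stationary[OF z1(1)] d by simp
  have i: "M - int (Suc d) = M - int d - 1" by simp
  have "Rb 1 (S (Suc (Suc d))) = (\<Sum>l=1..<n. c (M - int (Suc d)) l * Rb l (S (Suc d))) + c (M - int (Suc d)) n ^ 2 * Rb n (S (Suc d))
     + c (M - int (Suc d)) n * R0 (S (Suc d)) + R n (S (Suc d))"
    using Rb_blk[OF z', where j = 1] n_pos unfolding S.simps(2)[of "Suc d"] by simp
  also have "(\<Sum>l=1..<n. c (M - int (Suc d)) l * Rb l (S (Suc d)))
      = (\<Sum>l=1..<n. c (M - int (Suc d)) l * (if l = 1 then 1 else inverse (c (M - int d) (l - 1))))"
    by (rule sum.cong[OF refl], subst 1) auto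
  finally show ?thesis
    using n2 by (simp only: 1[OF n_pos order_refl] 2 3 i) simp
qed

end

end


section \<open>Evaluation of the minors\<close>

context minors
begin

definition th where "th c ms = prod_list (map (\<lambda>m::int. tail (c m) 1) ms)"

definition ws where "ws c ms = concat (map (\<lambda>m::int. map (\<lambda>i. (i, inverse (c m i), c m i :: complex)) [1..<n+1]) ms)"

lemma th_append: "th c (ms @ ms') = th c ms * th c ms'"
  by (simp add: th_def)

lemma ws_append: "ws c (ms @ ms') = ws c ms @ ws c ms'"
  by (simp add: ws_def)

lemma fst_ws: "map fst (ws c ms) = cox n (length ms)"
  by (induction ms) (simp_all add: ws_def cox_Suc o_def del: upt_Suc)

lemma tail_xs:
  assumes "\<And>i. i \<in> I \<Longrightarrow> cc i \<noteq> 0"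
  shows "tail cc 1 = xs_prod True (map (\<lambda>i. (i, inverse (cc i), cc i)) [1..<n+1])"
proof -
  have "set l \<subseteq> I \<Longrightarrow> prod_list (map (\<lambda>i. BY i (cc i)) l) = xs_prod True (map (\<lambda>i. (i, inverse (cc i), cc i)) l)" for l
    by (induction l) (simp_all add: BY_expand assms)
  moreover have "set [1..<n+1] \<subseteq> I" by (auto simp: I_def)
  ultimately show ?thesis unfolding tail_def by blast
qed

lemma th_xs:
  "(\<And>m i. m \<in> set ms \<Longrightarrow> i \<in> I \<Longrightarrow> c m i \<noteq> 0) \<Longrightarrow> th c ms = xs_prod True (ws c ms)"
proof (induction ms)
  case (Cons m ms)
  have "th c (m # ms) = tail (c m) 1 * th c ms" by (simp add: th_def)
  also have "tail (c m) 1 = xs_prod True (map (\<lambda>i. (i, inverse (c m i), c m i)) [1..<n+1])"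
    by (rule tail_xs) (use Cons.prems in auto)
  also have "th c ms = xs_prod True (ws c ms)" using Cons by simp
  finally show ?case by (simp add: ws_def del: upt_Suc)
qed (simp add: th_def ws_def)

lemma S_th: "S c q M d = th c [M - int d + 1..M] * sl True (pj q)" if q: "1 \<le> q" "q \<le> n"
proof (induction d)
  case (Suc d)
  have "[M - int (Suc d) + 1..M] = (M - int d) # [M - int d + 1..M]"
    by (subst upto_rec1) auto
  then show ?case using Suc by (simp add: th_def S.simps[OF q] mult.assoc)
qed (simp add: S.simps[OF q] th_def)

lemma xs_prod_ex:
  "redu n (map fst wl) \<Longrightarrow> \<exists>u\<in>U. \<exists>v\<in>U. xs_prod b wl = u * sl b (map fst wl) * v"
proof (induction wl)
  case Nil
  have "xs_prod b [] = 1 * sl b (map fst []) * 1" by simp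
  then show ?case using U_I(2) by blast
next
  case (Cons a wl)
  obtain i s t where a: "a = (i, s, t)" by (cases a)
  have red: "redu n (i # map fst wl)" using Cons.prems by (simp add: a)
  then obtain u v where uv: "u \<in> U" "v \<in> U" "xs_prod b wl = u * sl b (map fst wl) * v"
    using Cons.IH by (auto simp: redu_Cons)
  obtain u' E where "u' \<in> U" "E \<in> U"
    "x i s * sg b i * x i t * (u * sl b (map fst wl) * v) = u' * sl b (i # map fst wl) * (E * v)"
    using xs_prod_step[OF red uv(1,2)] by metis
  moreover from this have "E * v \<in> U" using uv by blast
  ultimately show ?case using uv by (auto simp: a)
qed

lemma set_cox_I: "set (cox n m) \<subseteq> I"
  using set_cox by (simp add: I_def)

lemma sl_cox_G: "sl b (cox n m) \<in> G"
  by (intro sl_G set_cox_I)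

text \<open>\<open>Rb 1\<close> is the coordinate at the lowest weight vector, and U only raises
  weights.\<close>

lemma Rb_U: assumes g: "g \<in> G" and u: "u \<in> U" shows "Rb 1 (u * g) = Rb 1 g"
proof -
  have "u \<in> gen (\<Union>i\<in>I. range (x i)) \<Longrightarrow> Rb 1 (u * g) = Rb 1 g"
  proof (induction u rule: gen.induct)
    case (gen_left a u)
    then obtain i t where a: "i \<in> I" "a = x i t" by blast
    have "u \<in> U" using gen_left.hyps(2) by (simp only: U_def)
    then have "u * g \<in> G" by (rule G_I(4)[OF U_G g])
    then have "Rb 1 (x i t * (u * g)) = Rb 1 (u * g)"
      using a n_pos by (intro Rb_x) (auto simp: I_def)
    then show ?case using gen_left.IH by (simp add: a mult.assoc)
  qed simp
  then show ?thesis using u by (simp add: U_def)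
qed

text \<open>The word \<open>pb 1\<close> is one full block followed by \<open>pj n\<close>.\<close>

lemma Rb_cox: "Rb 1 (sl True (cox n (Suc m)) * g) = R n (sl True (cox n m) * g)"
proof -
  have "Rb 1 (sl True [1..<n+1] * (sl True (cox n m) * g)) = R n (sl True (cox n m) * g)"
    unfolding Rb_def pb_def using n2 by (subst rw_append) (simp add: R_def)
  then show ?thesis by (simp only: cox_Suc sl_simps mult.assoc)
qed

lemma R_sb: assumes "i \<in> I" "1 \<le> j" "j \<le> n" "g \<in> G" "i \<noteq> j" "Suc i \<noteq> j"
  shows "R j (sb i * g) = R j g"
proof -
  have xg: "x i (-1) * g \<in> G" by (rule G_I(4)[OF G_I(1)[OF assms(1)] assms(4)])
  have yxg: "y i 1 * (x i (-1) * g) \<in> G" by (rule G_I(4)[OF G_I(2)[OF assms(1)] xg])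
  show ?thesis
    unfolding sb_def mult.assoc R_x[OF assms(1-3) yxg assms(5)] R_y[OF assms(1-3) xg assms(6)]
      R_x[OF assms(1-4) assms(5)] ..
qed

lemma R_sl: "1 \<le> j \<Longrightarrow> j \<le> n \<Longrightarrow> g \<in> G \<Longrightarrow> set l \<subseteq> I \<Longrightarrow> (\<And>i. i \<in> set l \<Longrightarrow> i \<noteq> j \<and> Suc i \<noteq> j) \<Longrightarrow>
    R j (sl True l * g) = R j g"
proof (induction l)
  case (Cons i l)
  have lg: "sl True l * g \<in> G" using Cons.prems by (intro G_I(4) sl_G) auto
  have "R j (sb i * (sl True l * g)) = R j (sl True l * g)"
    by (rule R_sb[OF _ _ _ lg]) (use Cons.prems in auto)
  then show ?case using Cons by (simp add: sg_def mult.assoc)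
qed simp

lemma R_cox1: assumes j: "1 \<le> j" "Suc j \<le> n" and g: "g \<in> G"
  shows "R (Suc j) (sl True [1..<n+1] * g) = R j g"
proof -
  have "[1..<n+1] = [1..<j] @ [j..<n+1]" using upt_add_eq_append[of 1 j "n + 1 - j"] j by simp
  also have "[j..<n+1] = j # [Suc j..<n+1]" using j by (simp add: upt_rec)
  finally have l: "sl True [1..<n+1] * g = sl True [1..<j] * (sb j * (sl True [Suc j..<n+1] * g))"
    by (simp only: sl_simps mult.assoc sg_def if_True)
  have G1: "sl True [Suc j..<n+1] * g \<in> G" by (intro G_I(4) sl_G g) (auto simp: I_def)
  have "R (Suc j) (sl True [1..<n+1] * g) = R (Suc j) (sb j * (sl True [Suc j..<n+1] * g))"
    unfolding l
  proof (rule R_sl)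
    show "sb j * (sl True [Suc j..<n+1] * g) \<in> G" by (intro G_I(4)[OF _ G1] sb_G) (use j in \<open>simp add: I_def\<close>)
  qed (use j in \<open>auto simp: I_def\<close>)
  also have "\<dots> = R j (sl True [Suc j..<n+1] * g)"
    using j by (simp add: R_def pj_Suc rw_Cons)
  also have "\<dots> = R j g"
    by (rule R_sl[OF _ _ g]) (use j in \<open>auto simp: I_def\<close>)
  finally show ?thesis .
qed

lemma R_cox: "m < j \<Longrightarrow> j \<le> n \<Longrightarrow> g \<in> G \<Longrightarrow> R j (sl True (cox n m) * g) = R (j - m) g"
proof (induction m arbitrary: j)
  case (Suc m)
  obtain j' where j': "j = Suc j'" "1 \<le> j'" using Suc.prems by (cases j) auto
  have G: "sl True (cox n m) * g \<in> G" by (intro G_I(4) sl_cox_G Suc.prems)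
  have "R j (sl True (cox n (Suc m)) * g) = R (Suc j') (sl True [1..<n+1] * (sl True (cox n m) * g))"
    by (simp only: cox_Suc sl_simps mult.assoc j')
  also have "\<dots> = R j' (sl True (cox n m) * g)"
    using Suc.prems j' by (intro R_cox1 G) auto
  also have "\<dots> = R (j' - m) g" using Suc.prems j' by (intro Suc.IH) auto
  finally show ?case by (simp add: j')
qed simp

text \<open>x_k alone changes the coordinate at v_k, adding t times the coordinate at v_(k+1), which
  is constantly 1 on U. The word p is any one taking v_1 to v_(k+1): both \<open>pj (k+1)\<close>
  and \<open>cox n k\<close> occur.\<close>

lemma R_chi:
  assumes k: "1 \<le> k" "k < n" and p: "set p \<subseteq> I"
    and w: "\<And>w. Lam n 1 (wact n (rev p) w) = of_int (w (Suc k))"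
    and 0: "R k (sl True p) = 0" and 1: "R (Suc k) (sl True p) = 1" and u: "u \<in> U"
  shows "R k (u * sl True p) = chi k u"
proof (rule chi_char[OF _ _ _ u])
  show "k \<in> I" using k by (simp add: I_def)
  show "R k (1 * sl True p) = 0" using 0 by simp
  fix j t u assume j: "j \<in> I" and u: "u \<in> U"
  have G: "u * sl True p \<in> G" by (intro G_I(4) U_G u sl_G p)
  show "R k (x j t * u * sl True p) = (if j = k then t else 0) + R k (u * sl True p)"
  proof (cases "j = k")
    case True
    have "set (pj (Suc k)) \<subseteq> I" using k by (intro set_pj) simp
    then have "rw 1 (pj (Suc k)) (u * sl True p) = rw 1 (pj (Suc k)) (sl True p)"
      using wt_pj[of "Suc k"] w k by (intro rw_U_const I1 p u) simp_all
    then have "R (Suc k) (u * sl True p) = 1" using 1 by (simp add: R_def)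
    then show ?thesis using R_x1[OF k G, of t] True by (simp add: mult.assoc)
  next
    case False
    then show ?thesis using R_x[OF j _ _ G False, of t] k by (simp add: mult.assoc)
  qed
qed

text \<open>Every simple root is negative on w_0 \<rho>, so the functional of the lowest weight
  ignores u, factor by factor. The lifts of w_0 then cancel, and the minor of v * sb_k
  remains.\<close>

lemma D_w0:
  assumes k: "k \<in> I" and r: "redu n r" "wact n r = wact n (cox n n)" and u: "u \<in> U" and v: "v \<in> U"
  shows "D k (sl False (rev r) * (u * sl True (cox n n) * v) * sb k) = chi k v"
proof -
  have set: "set r \<subseteq> I" by (rule set_I[OF r(1)])
  have a: "alpha n i (wact n r (rho n)) < 0" if "i \<in> I" for i
    using that by (auto simp: r(2) alpha_def wact_cox_n rho_def I_def)
  define g where "g = sl True (cox n n) * (v * sb k)"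
  have g: "g \<in> G" unfolding g_def by (intro G_I(4) sl_cox_G U_G v sb_G k)
  have "u \<in> gen (\<Union>i\<in>I. range (x i)) \<Longrightarrow> rw k r (u * g) = rw k r g"
  proof (induction u rule: gen.induct)
    case (gen_left b u)
    then obtain i t where b: "i \<in> I" "b = x i t" by blast
    have "u \<in> U" using gen_left.hyps(2) by (simp only: U_def)
    then have "u * g \<in> G" by (rule G_I(4)[OF U_G g])
    then show ?case using gen_left.IH rw_x[OF k set b(1) a[OF b(1)]] by (simp add: b mult.assoc)
  qed simp
  then have "rw k r (u * g) = rw k r g" using u by (simp add: U_def)
  also have "sl True (cox n n) = sl True r"
    unfolding sl_lift by (rule lift_unique) (simp_all add: r redu_cox)
  then have "rw k r g = rw k (r @ []) (sl True r * (v * sb k))" by (simp add: g_def)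
  also have "\<dots> = chi k v" unfolding rw_append rw_Nil chi_def ..
  finally show ?thesis by (simp add: rw_def g_def mult.assoc)
qed

context
  fixes c :: "int \<Rightarrow> nat \<Rightarrow> complex"
  assumes nz0: "\<And>m i. m \<in> {1..int n} \<Longrightarrow> i \<in> I \<Longrightarrow> c m i \<noteq> 0"
begin

lemma th_xs': "set ms \<subseteq> {1..int n} \<Longrightarrow> th c ms = xs_prod True (ws c ms)"
  using nz0 by (intro th_xs) auto

text \<open>\<alpha>_n belongs to the last letter of the word, so all other letters leave the
  character unchanged, and the last factor contributes the argument of its right-hand x_n.\<close>

theorem minor_last:
  assumes r: "redu n r" "wact n r = wact n (cox n n)"
  shows "D n (sl False (rev r) * th c [1..int n] * sb n) = c (int n) n"
proof -
  have up: "[1..int n] = [1..int n - 1] @ [int n]" using n2 by (simp add: upto_rec2)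
  define w1 where "w1 = ws c [1..int n - 1] @ map (\<lambda>i. (i, inverse (c (int n) i), c (int n) i)) [1..<n]"
  have e: "ws c [1..int n] = w1 @ [(n, inverse (c (int n) n), c (int n) n)]"
    unfolding up ws_append w1_def using n2 by (simp add: ws_def)
  have f: "map fst w1 @ [n] = cox n n"
    using arg_cong[OF e, of "map fst"] by (simp add: fst_ws)
  have "xs_prod True [(n, inverse (c (int n) n), c (int n) n)]
     = x n (inverse (c (int n) n)) * sl True [n] * x n (c (int n) n)" by simp
  moreover have "\<exists>u'\<in>U. \<exists>v'\<in>U. xs_prod True w1 * (x n (inverse (c (int n) n)) * sl True [n] * x n (c (int n) n))
      = u' * sl True (map fst w1 @ [n]) * v' \<and> chi n v' = chi n (x n (c (int n) n))"
  proof (rule xs_prod_decomp)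
    show "redu n (map fst w1 @ [n])" unfolding f by (rule redu_cox) simp
    fix q i q' assume *: "map fst w1 = q @ i # q'"
    have "cox n n = q @ i # (q' @ [n])" using f * by simp
    then obtain m where m: "m < n" "i \<in> {1..n}" "q' @ [n] = [i+1..<n+1] @ cox n m"
      using suffix_form n_pos by blast
    \<comment> \<open>The last letter has been split off, so it is not the letter considered
      here.\<close>
    have "(i, m) \<noteq> (n, 0)" using m(3) by (cases m) auto
    then show "alpha n i (wact n (q' @ [n]) (sr n n (rho n))) > 0"
      unfolding m(3) using m(1,2) n_pos by (intro alpha_suffix_pos) auto
  qed (use I1(2) in auto)
  ultimately obtain u v where uv: "u \<in> U" "v \<in> U" "th c [1..int n] = u * sl True (cox n n) * v"
    "chi n v = chi n (x n (c (int n) n))"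
    unfolding th_xs'[of "[1..int n]", simplified] e xs_prod_simps(3) f[symmetric] by metis
  show ?thesis
    unfolding uv(3) D_w0[OF I1(2) r uv(1,2)] uv(4) using chi_x[OF I1(2) I1(2)] by simp
qed

context
  fixes k assumes k: "1 \<le> k" "k < n"
begin

lemma kI: "k \<in> I" using k by (simp add: I_def)

text \<open>The letters left of the last n - k + 1 blocks have roots other than \<alpha>_k, so the
  character can be read off from these blocks. The word \<open>pj (k+1)\<close> prepares v_(k+1),
  the unipotent factor v has the character as coefficient at v_k, n - k blocks of lifts carry v_k to
  v_n, and one more carries v_n to the lowest weight vector.\<close>

theorem minor_right:
  assumes r: "redu n r" "wact n r = wact n (cox n n)"
  shows "D k (sl False (rev r) * th c [1..int n] * sb k) = Rb 1 (th c [int k..int n] * sl True (pj (k+1)))"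
proof -
  have up: "[1..int n] = [1..int k - 1] @ [int k..int n]" using k by (intro upto_split1) auto
  define m where "m = n - k + 1"
  have m: "m \<le> n" "m = Suc (n - k)" using k by (auto simp: m_def)
  have len: "length [int k..int n] = m" "length [1..int k - 1] = n - m" using k by (auto simp: m_def nat_diff_distrib)
  have "redu n (map fst (ws c [int k..int n]))" unfolding fst_ws len by (rule redu_cox[OF m(1)])
  from xs_prod_ex[OF this, of True]
  obtain u v where uv: "u \<in> U" "v \<in> U" "xs_prod True (ws c [int k..int n]) = u * sl True (cox n m) * v"
    unfolding fst_ws len by blast
  have th2: "th c [int k..int n] = u * sl True (cox n m) * v"
    using th_xs'[of "[int k..int n]"] k uv(3) by simp
  have cox: "cox n (n - m) @ cox n m = cox n n" using m by (simp flip: cox_add)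
  have "\<exists>u'\<in>U. \<exists>v'\<in>U. xs_prod True (ws c [1..int k - 1]) * (u * sl True (cox n m) * v)
      = u' * sl True (map fst (ws c [1..int k - 1]) @ cox n m) * v' \<and> chi k v' = chi k v"
  proof (rule xs_prod_decomp[OF _ uv(1,2) kI])
    show "redu n (map fst (ws c [1..int k - 1]) @ cox n m)"
      unfolding fst_ws len cox by (rule redu_cox) simp
    fix q i q' assume "map fst (ws c [1..int k - 1]) = q @ i # q'"
    then have "cox n (n - m) = q @ i # q'" by (simp add: fst_ws len del: length_upto)
    then obtain a where a: "a < n - m" "i \<in> {1..n}" "q' = [i+1..<n+1] @ cox n a"
      using suffix_form n_pos by blast
    have "q' @ cox n m = [i+1..<n+1] @ cox n (a + m)" by (simp add: a cox_add)
    then show "alpha n i (wact n (q' @ cox n m) (sr n k (rho n))) > 0"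
      using a k by (simp only:) (intro alpha_suffix_pos, auto simp: m_def)
  qed
  then obtain u' v' where uv': "u' \<in> U" "v' \<in> U" "chi k v' = chi k v"
    "xs_prod True (ws c [1..int k - 1]) * (u * sl True (cox n m) * v) = u' * sl True (cox n n) * v'"
    unfolding fst_ws len cox by blast
  have "th c [1..int n] = th c [1..int k - 1] * th c [int k..int n]" unfolding up th_append ..
  also have "th c [1..int k - 1] = xs_prod True (ws c [1..int k - 1])"
    using k by (intro th_xs') auto
  finally have "th c [1..int n] = u' * sl True (cox n n) * v'" unfolding th2 uv'(4) .
  then have L: "D k (sl False (rev r) * th c [1..int n] * sb k) = chi k v"
    using D_w0[OF kI r uv'(1,2)] uv'(3) by simp
  have q: "1 \<le> k + 1" "k + 1 \<le> n" "1 \<le> Suc k" "Suc k \<le> n" "k \<le> n" using k by auto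
  have G: "v * sl True (pj (k+1)) \<in> G" by (intro G_I(4) U_G uv(2) sl_pj_G q)
  have "Rb 1 (th c [int k..int n] * sl True (pj (k+1))) = Rb 1 (u * (sl True (cox n m) * (v * sl True (pj (k+1)))))"
    unfolding th2 by (simp only: mult.assoc)
  also have "\<dots> = Rb 1 (sl True (cox n m) * (v * sl True (pj (k+1))))"
    by (rule Rb_U[OF G_I(4)[OF sl_cox_G G] uv(1)])
  also have "\<dots> = R n (sl True (cox n (n - k)) * (v * sl True (pj (k+1))))"
    unfolding m(2) by (rule Rb_cox)
  also have "\<dots> = R k (v * sl True (pj (k+1)))"
    using R_cox[of "n - k" n "v * sl True (pj (k+1))"] k G by simp
  also have "\<dots> = chi k v"
  proof (rule R_chi[OF k _ _ _ _ uv(2)])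
    show "set (pj (k+1)) \<subseteq> I" by (rule set_pj[OF q(2)])
    show "Lam n 1 (wact n (rev (pj (k + 1))) w) = of_int (w (Suc k))" for w
      using wt_pj[OF q(3,4)] by simp
    show "R k (sl True (pj (k+1))) = 0" "R (Suc k) (sl True (pj (k+1))) = 1"
      using R_base(1)[OF q(1,2) k(1) q(5)] R_base(1)[OF q(1,2) q(3,4)] by simp_all
  qed
  finally show ?thesis using L by simp
qed

lemma sr_k_rho: "j \<in> I \<Longrightarrow> j \<noteq> k \<Longrightarrow> alpha n j (sr n k (rho n)) > 0"
  using k by (auto simp: alpha_def sr_def rho_def I_def)

text \<open>This minor is the character of the left-hand unipotent factor of the product. Only the
  first k blocks influence it, and a product of k lifted blocks takes v_1 to v_(k+1), so
  \<open>R_chi\<close> turns it into a coordinate.\<close>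

theorem minor_left:
  assumes r: "redu n r" "wact n r = wact n (cox n n @ [k])"
  shows "D k (sl False (rev r) * th c [1..int n]) = R k (th c [1..int k])"
proof -
  have setr: "set r \<subseteq> I" by (rule set_I[OF r(1)])
  \<comment> \<open>w_0 acts as -1 and commutes with s_k.\<close>
  have w0: "wact n (cox n n) (sr n k w) = sr n k (wact n (cox n n) w)" for w
    using k by (auto simp: wact_cox_n sr_def fun_eq_iff)
  have wr: "wact n r w = sr n k (wact n (cox n n) w)" for w using r(2) w0 by simp
  have kr: "wact n (k # r) = wact n (cox n n)" "wact n (r @ [k]) = wact n (cox n n)"
    by (simp_all add: fun_eq_iff wr w0)
  have ak: "alpha n k (wact n r (rho n)) = 1"
    using k by (simp add: wr) (simp add: alpha_def wact_cox_n rho_def)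
  have redk: "redu n (k # r)" using r(1) ak k by (simp add: redu_Cons)
  have rl: "length (k # r) = length (cox n n)"
    using redk redu_cox[of n n] kr by (simp add: redu_def)
  have redk': "redu n (r @ [k])"
    using redu_cox[of n n] kr rl setr k by (simp add: redu_def I_def)
  have l1: "lift (cox n n) = sb k * lift r"
    using lift_unique[OF redu_cox redk] kr by simp
  have l2: "lift (cox n n) = lift r * sb k"
    using lift_unique[OF redu_cox redk'] kr by simp
  define P where "P = sl True (cox n n)"
  have PG: "P \<in> G" unfolding P_def by (rule sl_cox_G)
  have chi_eq: "rw k r (u * P) = chi k u" if u: "u \<in> U" for u
  proof (rule chi_char[OF kI _ _ u])
    have "rw k r (1 * P) = rw k (r @ []) (sl True r * sb k)" by (simp add: P_def sl_lift l2)
    also have "\<dots> = 0" unfolding rw_append rw_Nil by (rule D_sb[OF kI])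
    finally show "rw k r (1 * P) = 0" .
    fix j t u assume j: "j \<in> I" and u: "u \<in> U"
    have G: "u * P \<in> G" by (intro G_I(4) U_G u PG)
    show "rw k r (x j t * u * P) = (if j = k then t else 0) + rw k r (u * P)"
    proof (cases "j = k")
      case True
      have "wact n r (coroot k) = wact n r (wact n (rev r) (coroot k))" if "wact n r (coroot k) = coroot k"
        using that by simp
      \<comment> \<open>w_0 and s_k both negate this coroot, so their product fixes it and the
        weight of the functional on it is 1.\<close>
      have "wact n r (coroot k) = coroot k"
        using k by (auto simp: wr wact_cox_n sr_def coroot_def fun_eq_iff)
      then have "wact n (rev r) (coroot k) = coroot k" by (metis wact_rev(1))
      then have "Lam n k (wact n (rev r) (coroot k)) = 1" by (simp add: Lam_coroot[OF kI kI])
      then have "rw k r (x k t * (u * P)) = rw k r (u * P) + t * rw k (k # r) (u * P)"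
        using ak by (intro rw_x1[OF kI setr kI _ _ G]) auto
      moreover have "rw k (k # r) (u * P) = 1"
      proof -
        have P: "P = sl True (k # r)" by (simp only: P_def sl_lift l1 lift_simps)
        have "set (k # r) \<subseteq> I" using setr kI by simp
        then have "rw k (k # r) (u * sl True (k # r)) = rw k (k # r) (sl True (k # r))"
          by (intro rw_U_const kI u refl)
        also have "\<dots> = rw k ((k # r) @ []) (sl True (k # r) * 1)" by simp
        also have "\<dots> = 1" unfolding rw_append rw_Nil by (rule D_one[OF kI])
        finally show ?thesis by (simp only: P)
      qed
      ultimately show ?thesis using True by (simp add: mult.assoc)
    next
      case False
      have "alpha n j (wact n r (rho n)) = - alpha n j (sr n k (rho n))"
        using j k by (auto simp: alpha_def r(2) wact_cox_n I_def)
      then have "alpha n j (wact n r (rho n)) < 0" using sr_k_rho[OF j False] by simp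
      then show ?thesis using rw_x[OF kI setr j _ G, of t] False by (simp add: mult.assoc)
    qed
  qed
  have up: "[1..int n] = [1..int k] @ [int k + 1..int n]" using k by (intro upto_split2) auto
  define w1 where "w1 = ws c [1..int k]"
  define w2 where "w2 = ws c [int k + 1..int n]"
  \<comment> \<open>\<open>xs_prod_decomp\<close> controls the right-hand unipotent factor, so it is
    applied to the inverse product, with reversed words and inverse lifts; its right-hand factor is
    the inverse of the left-hand factor wanted.\<close>
  have f1: "map fst (xs_rev w1) = rev (cox n k)" by (simp add: w1_def fst_ws)
  have f2: "map fst (xs_rev w2) = rev (cox n (n - k))" using k by (simp add: w2_def fst_ws nat_diff_distrib)
  have "redu n (map fst (xs_rev w1))" unfolding f1 using k by (intro redu_rev redu_cox) simp
  from xs_prod_ex[OF this, of False] obtain u1 v1 where uv1: "u1 \<in> U" "v1 \<in> U"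
    "xs_prod False (xs_rev w1) = u1 * sl False (rev (cox n k)) * v1" unfolding f1 by blast
  have cox: "rev (cox n (n - k)) @ rev (cox n k) = rev (cox n n)"
    using k cox_add[of n k "n - k"] by (simp flip: rev_append)
  have "\<exists>u'\<in>U. \<exists>v'\<in>U. xs_prod False (xs_rev w2) * (u1 * sl False (rev (cox n k)) * v1)
      = u' * sl False (map fst (xs_rev w2) @ rev (cox n k)) * v' \<and> chi k v' = chi k v1"
  proof (rule xs_prod_decomp[OF _ uv1(1,2) kI])
    show "redu n (map fst (xs_rev w2) @ rev (cox n k))"
      unfolding f2 cox by (intro redu_rev redu_cox) simp
    fix q i q' assume "map fst (xs_rev w2) = q @ i # q'"
    then have "rev (rev (cox n (n - k))) = rev q' @ i # rev q" unfolding f2 by simp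
    then have "cox n (n - k) = rev q' @ i # rev q" by simp
    then obtain a where a: "a < n - k" "i \<in> {1..n}" "rev q' = cox n (n - k - Suc a) @ [1..<i]"
      using suffix_form n_pos by blast
    have "rev (q' @ rev (cox n k)) = cox n (k + (n - k - Suc a)) @ [1..<i]" by (simp add: a cox_add)
    then have e: "q' @ rev (cox n k) = rev (cox n (k + (n - k - Suc a)) @ [1..<i])"
      by (metis rev_rev_ident)
    show "alpha n i (wact n (q' @ rev (cox n k)) (sr n k (rho n))) > 0"
      unfolding e by (rule alpha_prefix_pos) (use a k in auto)
  qed
  then obtain u2 v2 where uv2: "u2 \<in> U" "v2 \<in> U" "chi k v2 = chi k v1"
    "xs_prod False (xs_rev w2) * xs_prod False (xs_rev w1) = u2 * sl False (rev (cox n n)) * v2"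
    unfolding f2 cox uv1(3) by blast
  have inv: "xs_prod True w = v' * sl True p * u'"
    if "xs_prod False (xs_rev w) = u * sl False (rev p) * v" "u * u' = 1" "u' * u = 1" "v * v' = 1" "v' * v = 1" for w u v u' v' p
  proof -
    have "sl False (rev p) * sl True p = 1" using sl_inv[of False "rev p"] by simp
    then have "(u * sl False (rev p) * v) * (v' * sl True p * u') = 1"
      using that by (metis (no_types, opaque_lifting) mult.assoc mult_1_left)
    moreover have "xs_prod True w * (u * sl False (rev p) * v) = 1"
      using xs_prod_rev'[of True w] that(1) by simp
    ultimately show ?thesis by (rule inverse_unique_mult)
  qed
  obtain u1' v1' u2' v2' where i: "u1' \<in> U" "u1 * u1' = 1" "u1' * u1 = 1" "v1' \<in> U" "v1 * v1' = 1" "v1' * v1 = 1"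
    "u2' \<in> U" "u2 * u2' = 1" "u2' * u2 = 1" "v2' \<in> U" "v2 * v2' = 1" "v2' * v2 = 1"
    using U_inverse uv1 uv2 by metis
  have T1: "th c [1..int k] = v1' * sl True (cox n k) * u1'"
    using inv[OF uv1(3) i(2,3,5,6)] th_xs'[of "[1..int k]"] k by (simp add: w1_def)
  have "xs_prod False (xs_rev (w1 @ w2)) = u2 * sl False (rev (cox n n)) * v2"
    using uv2(4) by simp
  then have "xs_prod True (w1 @ w2) = v2' * sl True (cox n n) * u2'"
    by (rule inv[OF _ i(8,9,11,12)])
  moreover have "th c [1..int n] = xs_prod True (ws c [1..int n])" by (rule th_xs') simp
  moreover have "ws c [1..int n] = w1 @ w2" by (simp only: up ws_append w1_def w2_def)
  ultimately have T2: "th c [1..int n] = v2' * sl True (cox n n) * u2'" by simp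
  have "chi k v1' = - chi k v1" "chi k v2' = - chi k v2"
    using chi_mult[OF kI i(4) uv1(2)] chi_mult[OF kI i(10) uv2(2)] i chi_one[OF kI] by (simp_all add: eq_neg_iff_add_eq_0)
  then have cc: "chi k v2' = chi k v1'" using uv2(3) by simp
  have "D k (sl False (rev r) * th c [1..int n]) = D k ((sl False (rev r) * (v2' * P)) * u2')"
    by (simp add: T2 P_def mult.assoc)
  also have "\<dots> = rw k r (v2' * P)"
    unfolding rw_def by (rule D_right_U[OF kI i(7)]) (intro G_I(4) p'[OF kI setr] U_G i(10) PG)
  also have "\<dots> = chi k v1'" using chi_eq[OF i(10)] cc by simp
  also have "\<dots> = R k (v1' * sl True (cox n k))"
  proof (rule R_chi[OF k _ _ _ _ i(4), symmetric])
    show "set (cox n k) \<subseteq> I" by (rule set_cox_I)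
    show w: "Lam n 1 (wact n (rev (cox n k)) w) = of_int (w (Suc k))" for w
      using Lam_1[of "wact n (rev (cox n k)) w"] k by (simp add: wact_rev_cox)
    have "R (Suc k) (sl True (cox n k) * 1) = R 1 1"
      using R_cox[of k "Suc k" 1] k by auto
    then show "R (Suc k) (sl True (cox n k)) = 1" using D_one[OF I1(1)] by (simp add: R_def pj_def rw_Nil)
    have "R k (sl True (cox n (k - 1)) * sl True (cox n 1)) = R 1 (sl True (cox n 1))"
      using R_cox[of "k - 1" k "sl True (cox n 1)"] sl_cox_G k by simp
    moreover have "cox n k = cox n (k - 1) @ cox n 1" using k by (simp flip: cox_add)
    moreover have "rw 1 [] (sl True (cox n 1)) = 0"
      by (rule rw_weight_zero[OF I1(1) _ set_cox_I, where w = "\<lambda>l. if l = 1 then 1 else 0" and a = 1 and b = 0])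
         (use n2 in \<open>auto simp: Lam_1[unfolded One_nat_def] wact_rev_cox\<close>)
    ultimately show "R k (sl True (cox n k)) = 0" by (simp add: R_def pj_def)
  qed
  also have "R k (v1' * sl True (cox n k)) = R k (th c [1..int k])"
    unfolding T1 using k D_right_U[OF I1(1) i(1), of "sl False (rev (pj k)) * (v1' * sl True (cox n k))"]
      G_I(4)[OF p'(1)[OF I1(1) set_pj[of k]] G_I(4)[OF U_G[OF i(4)] sl_cox_G[of True k]]]
    by (simp add: R_def rw_def mult.assoc)
  finally show ?thesis .
qed

text \<open>\<open>Rb_S_final\<close> with M = n and q = k + 1. The block that stops at index j = k
  + 1 + t has superscript n - t = n + k + 1 - j.\<close>

theorem minor_right_value:
  "Rb 1 (th c [int k..int n] * sl True (pj (k+1))) =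
    (\<Sum>l=1..<n. c (int k) l * (if l = 1 then 1 else inverse (c (int k + 1) (l - 1))))
    + c (int k) n ^ 2 * inverse (c (int k + 1) (n - 1))
    + 2 * (c (int k) n * inverse (c (int k + 1) n))
    + (\<Sum>j=k+1..n. c (int (n + k + 1) - int j) (j - 1) * ee (c (int (n + k + 1) - int j)) j)"
proof -
  have q: "1 \<le> k + 1" "k + 1 \<le> n" using k by auto
  define d where "d = n - k - 1"
  have d: "k + 1 + d = n" using k by (simp add: d_def)
  have nz': "nz c (int n) (Suc (Suc d))"
    unfolding nz_def[OF q]
    by (intro allI impI ballI nz0) (use d k in auto)
  have ix: "int n - int d - 1 = int k" "int n - int d = int k + 1" "int n - int (Suc (Suc d)) + 1 = int k"
    using d by auto
  have "(\<Sum>t<Suc d. term_E c (k+1) (int n) t) = (\<Sum>j=k+1..n. c (int (n + k + 1) - int j) (j - 1) * ee (c (int (n + k + 1) - int j)) j)"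
    unfolding term_E_def[OF q]
    by (rule sum.reindex_bij_witness[where i = "\<lambda>j. j - (k + 1)" and j = "\<lambda>t. k + 1 + t"])
       (use d k in \<open>auto simp: of_nat_diff algebra_simps\<close>)
  then show ?thesis
    using Rb_S_final[OF q d nz'] unfolding S_th[OF q] ix by simp
qed

text \<open>\<open>R_S_stationary\<close> with M = d = k and q = 1: in k blocks v_1 reaches v_k with
  exactly one stop.\<close>

theorem minor_left_value:
  "R k (th c [1..int k]) = (\<Sum>j=1..k. (if j = 1 then 1 else c (int (k + 1) - int j) (j - 1)) * inverse (c (int (k + 1) - int j) j))"
proof -
  have q: "1 \<le> (1::nat)" "1 \<le> n" using n_pos by auto
  have nz': "nz c (int k) k" unfolding nz_def[OF q] using nz0 k by auto
  have "(\<Sum>t<k. term_E c 1 (int k) t) = (\<Sum>j=1..k. (if j = 1 then 1 else c (int (k + 1) - int j) (j - 1)) * inverse (c (int (k + 1) - int j) j))"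
    unfolding term_E_def[OF q]
    by (rule sum.reindex_bij_witness[where i = "\<lambda>j. j - 1" and j = "\<lambda>t. 1 + t"])
       (use k in \<open>auto simp: ee_def of_nat_diff algebra_simps\<close>)
  moreover have "R (1 + k - 1) (S c 1 (int k) k) = (\<Sum>t<k. term_E c 1 (int k) t)"
    using k by (intro R_S_stationary[OF q nz']) simp
  ultimately show ?thesis unfolding S_th[OF q] by (simp add: pj_def)
qed

end

end

end


section \<open>The monomials of the vector crystal\<close>

text \<open>The partial sums vanish before m0, jump to their maximum at m0 and cannot exceed it
  later.\<close>

lemma mono_nf_eq:
  assumes "\<And>m. m < m0 \<Longrightarrow> Poly_Mapping.lookup Y (m, i) = 0" "Poly_Mapping.lookup Y (m0, i) > 0"
    "\<And>m. m > m0 \<Longrightarrow> Poly_Mapping.lookup Y (m, i) \<le> 0"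
  shows "mono_nf i Y = m0"
proof -
  let ?L = "\<lambda>k. Poly_Mapping.lookup Y (k, i)"
  define K where "K = {k. (k, i) \<in> Poly_Mapping.keys Y}"
  have K: "finite K"
    unfolding K_def using finite_imageI[OF finite_keys[of Y], of fst]
    by (rule finite_subset[rotated]) force
  have p: "partial_wt Y i m = (\<Sum>k\<in>{k \<in> K. k \<le> m}. ?L k)" for m
    by (simp add: partial_wt_def K_def)
  have low: "partial_wt Y i m = 0" if "m < m0" for m
    unfolding p by (rule sum.neutral) (use that assms(1) in auto)
  have m0K: "m0 \<in> K" using assms(2) by (auto simp: K_def in_keys_iff)
  have high: "partial_wt Y i m \<le> ?L m0" if "m \<ge> m0" for m
  proof -
    have "partial_wt Y i m = ?L m0 + (\<Sum>k\<in>{k \<in> K. k \<le> m} - {m0}. ?L k)"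
      unfolding p using K m0K that by (subst sum.remove[of _ m0]) auto
    moreover have "(\<Sum>k\<in>{k \<in> K. k \<le> m} - {m0}. ?L k) \<le> 0"
      using assms(1,3) by (intro sum_nonpos) (metis DiffE insertCI linorder_neqE order_refl)
    ultimately show ?thesis by simp
  qed
  have eq: "partial_wt Y i m0 = ?L m0"
  proof -
    have "partial_wt Y i m0 = ?L m0 + (\<Sum>k\<in>{k \<in> K. k \<le> m0} - {m0}. ?L k)"
      unfolding p using K m0K by (subst sum.remove[of _ m0]) auto
    moreover have "(\<Sum>k\<in>{k \<in> K. k \<le> m0} - {m0}. ?L k) = 0"
      using assms(1) by (intro sum.neutral) auto
    ultimately show ?thesis by simp
  qed
  have "range (partial_wt Y i) \<subseteq> sum ?L ` Pow K" by (auto simp: p)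
  then have fin: "finite (range (partial_wt Y i))" using K finite_subset by blast
  have phi: "mono_phi i Y = ?L m0"
    unfolding mono_phi_def
  proof (rule Max_eqI[OF fin])
    fix a assume "a \<in> range (partial_wt Y i)"
    then obtain m where "a = partial_wt Y i m" by blast
    then show "a \<le> ?L m0" using low[of m] high[of m] assms(2) by (cases "m < m0") auto
  qed (use eq in \<open>metis rangeI\<close>)
  show ?thesis
    unfolding mono_nf_def phi
  proof (rule Least_equality)
    show "?L m0 = partial_wt Y i m0" using eq by simp
    fix m assume "?L m0 = partial_wt Y i m"
    then show "m0 \<le> m" using low[of m] assms(2) by fastforce
  qed
qed

text \<open>The paper's convention \<open>c\<^sub>0\<^sup>(\<^sup>m\<^sup>) = 1\<close>, and the factor that is squared for \<open>j = n\<close>.\<close>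

definition var0 :: "int \<Rightarrow> nat \<Rightarrow> monomial" where "var0 m j = (if j = 0 then 0 else var m j)"
definition var2 :: "nat \<Rightarrow> int \<Rightarrow> nat \<Rightarrow> monomial" where "var2 n m j = Poly_Mapping.single (m, j) (if j = n then 2 else 1)"

lemma lookup_var: "Poly_Mapping.lookup (var m j) (m', i) = (if m = m' \<and> j = i then 1 else 0)"
  by (auto simp: var_def lookup_single when_def)

lemma lookup_var0: "Poly_Mapping.lookup (var0 m j) (m', i) = (if m = m' \<and> j = i \<and> j \<noteq> 0 then 1 else 0)"
  by (auto simp: var0_def lookup_var)

lemma lookup_var2: "Poly_Mapping.lookup (var2 n m j) (m', i) = (if m = m' \<and> j = i then (if j = n then 2 else 1) else 0)"
  by (auto simp: var2_def lookup_single when_def)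

lemma var2_neq: "j \<noteq> n \<Longrightarrow> var2 n m j = var m j"
  by (simp add: var2_def var_def)

lemma var2_n: "var2 n m n = var m n + var m n"
  by (simp add: var2_def var_def flip: single_add)

lemmas lookups = lookup_minus lookup_add lookup_var lookup_var0 lookup_var2

text \<open>The sign puts the neighbour i - 1 at superscript m + 1 and the neighbour i + 1 at m. The
  Cartan integer -2 at (n, n-1) produces the square in \<open>var2\<close>.\<close>

lemma mono_A_sign0:
  assumes "n \<ge> 2" "i \<in> {1..n}"
  shows "mono_A n sign0 m i = var m i + var (m + 1) i - var0 (m + 1) (i - 1) - (if i = n then 0 else var2 n m (Suc i))"
proof -
  have t: "Poly_Mapping.single (m + sign0 j i, j) (cartan_B n j i) =
      (if j = i - 1 then - var0 (m + 1) (i - 1) else 0) + (if j = Suc i then - var2 n m (Suc i) else 0)"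
    if "j \<in> {1..n} - {i}" for j
    using that assms
    by (auto simp: poly_mapping_eq_iff fun_eq_iff lookups lookup_single when_def cartan_B_def sign0_def)
  have "(\<Sum>j \<in> {1..n} - {i}. Poly_Mapping.single (m + sign0 j i, j) (cartan_B n j i)) =
      (\<Sum>j \<in> {1..n} - {i}. if j = i - 1 then - var0 (m + 1) (i - 1) else 0) +
      (\<Sum>j \<in> {1..n} - {i}. if j = Suc i then - var2 n m (Suc i) else 0)"
    unfolding sum.distrib[symmetric] by (rule sum.cong[OF refl t])
  also have "\<dots> = - var0 (m + 1) (i - 1) - (if i = n then 0 else var2 n m (Suc i))"
    using assms by (auto simp: sum.delta var0_def)
  finally show ?thesis by (simp add: mono_A_def)
qed

context
  fixes n :: nat and mv :: "vec_elt \<Rightarrow> monomial" and k :: int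
  assumes n: "n \<ge> 2"
    and emb: "crystal_embedding n (vec_crystal n) (mono_crystal n sign0) mv"
    and start: "mv (V 1) = var k 1"
begin

text \<open>An embedding respects defined arrows, so its values are forced by the one at v_1, each
  arrow dividing by a monomial A.\<close>

lemma vec_step:
  assumes "i \<in> {1..n}" "b \<in> V ` {1..n} \<union> {V0} \<union> Vbar ` {1..n}" "vec_arrow n i b = Some b'"
  shows "mv b' = mv b - mono_A n sign0 (mono_nf i (mv b)) i"
proof -
  have "f_op (vec_crystal n) i b = Some b'" "b \<in> elts (vec_crystal n)"
    using assms by (simp_all add: vec_crystal_def crystal_of_arrows_def Let_def)
  then have "f_op (mono_crystal n sign0) i (mv b) = Some (mv b')"
    using emb assms(1) unfolding crystal_embedding_def by blast
  then show ?thesis by (simp add: mono_crystal_def split: if_splits)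
qed

lemma mv_V:
  assumes "1 \<le> j" "j \<le> n"
  shows "mv (V j) = var2 n k j - var0 (k + 1) (j - 1)"
  using assms
proof (induction j rule: dec_induct)
  case base
  then show ?case using start n by (simp add: var2_neq var0_def)
next
  case (step j)
  have IH: "mv (V j) = var2 n k j - var0 (k + 1) (j - 1)" using step by simp
  have nf: "mono_nf j (mv (V j)) = k"
    unfolding IH by (rule mono_nf_eq) (use step in \<open>auto simp: lookups\<close>)
  have "mv (V (Suc j)) = mv (V j) - mono_A n sign0 (mono_nf j (mv (V j))) j"
    by (rule vec_step) (use step in auto)
  also have "\<dots> = var2 n k (Suc j) - var0 (k + 1) j"
    unfolding nf unfolding IH using n step by (simp add: mono_A_sign0 var2_neq[of j]) (simp add: var0_def)
  finally show ?case by simp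
qed

lemma mv_V0: "mv V0 = var k n - var (k + 1) n"
proof -
  have V: "mv (V n) = var2 n k n - var0 (k + 1) (n - 1)" using mv_V[of n] n by simp
  have nf: "mono_nf n (mv (V n)) = k"
    unfolding V by (rule mono_nf_eq) (use n in \<open>auto simp: lookups\<close>)
  have "mv V0 = mv (V n) - mono_A n sign0 (mono_nf n (mv (V n))) n"
    by (rule vec_step) (use n in auto)
  then show ?thesis unfolding nf unfolding V using n mono_A_sign0[of n n k] by (simp only: var2_n) simp
qed

lemma mv_Vbar:
  assumes "1 \<le> j" "j \<le> n"
  shows "mv (Vbar j) = var0 (k + int n - int j + 1) (j - 1) - var2 n (k + int n - int j + 1) j"
  using assms(2,1)
proof (induction j rule: inc_induct)
  case base
  have nf: "mono_nf n (mv V0) = k"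
    unfolding mv_V0 by (rule mono_nf_eq) (auto simp: lookups)
  have "mv (Vbar n) = mv V0 - mono_A n sign0 (mono_nf n (mv V0)) n"
    by (rule vec_step) (use n in auto)
  then show ?case unfolding nf unfolding mv_V0 using n mono_A_sign0[of n n k] by (simp only: var2_n) simp
next
  case (step j)
  define q where "q = k + int n - int (Suc j) + 1"
  have IH: "mv (Vbar (Suc j)) = var0 q j - var2 n q (Suc j)" using step by (simp add: q_def)
  have nf: "mono_nf j (mv (Vbar (Suc j))) = q"
    unfolding IH by (rule mono_nf_eq) (use step in \<open>auto simp: lookups\<close>)
  have "mv (Vbar j) = mv (Vbar (Suc j)) - mono_A n sign0 (mono_nf j (mv (Vbar (Suc j)))) j"
    by (rule vec_step) (use step in auto)
  also have "\<dots> = var0 (q + 1) (j - 1) - var2 n (q + 1) j"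
    unfolding nf unfolding IH using n step by (simp add: mono_A_sign0 var2_neq[of j]) (simp add: var0_def)
  also have "q + 1 = k + int n - int j + 1" by (simp add: q_def)
  finally show ?case .
qed

end

lemma mono_eval_superset:
  assumes "finite K" "Poly_Mapping.keys Y \<subseteq> K"
  shows "mono_eval c Y = (\<Prod>(m, i)\<in>K. c m i powi Poly_Mapping.lookup Y (m, i))"
  unfolding mono_eval_def
  by (rule prod.mono_neutral_left[OF assms]) (auto simp: in_keys_iff)

text \<open>Integer powers of 0 do not obey the exponent law, so quotients are evaluated only where
  the variables involved are nonzero.\<close>

definition nonzero_on :: "(int \<Rightarrow> nat \<Rightarrow> complex) \<Rightarrow> monomial \<Rightarrow> bool" where
  "nonzero_on c Y \<longleftrightarrow> (\<forall>(m, i)\<in>Poly_Mapping.keys Y. c m i \<noteq> 0)"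

lemma mono_eval_diff:
  assumes "nonzero_on c Y" "nonzero_on c Z"
  shows "mono_eval c (Y - Z) = mono_eval c Y * inverse (mono_eval c Z)"
proof -
  let ?K = "Poly_Mapping.keys Y \<union> Poly_Mapping.keys Z"
  have "Poly_Mapping.keys (Y - Z) \<subseteq> ?K" by (rule keys_diff)
  then have "mono_eval c (Y - Z) = (\<Prod>(m, i)\<in>?K. c m i powi Poly_Mapping.lookup (Y - Z) (m, i))"
    by (intro mono_eval_superset) auto
  also have "\<dots> = (\<Prod>(m, i)\<in>?K. c m i powi Poly_Mapping.lookup Y (m, i) * inverse (c m i powi Poly_Mapping.lookup Z (m, i)))"
    by (rule prod.cong) (use assms in \<open>auto simp: nonzero_on_def lookup_minus power_int_diff divide_inverse\<close>)
  also have "\<dots> = (\<Prod>(m, i)\<in>?K. c m i powi Poly_Mapping.lookup Y (m, i)) * inverse (\<Prod>(m, i)\<in>?K. c m i powi Poly_Mapping.lookup Z (m, i))"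
    by (simp add: case_prod_beta prod.distrib prod_inversef[symmetric] o_def)
  also have "\<dots> = mono_eval c Y * inverse (mono_eval c Z)"
    by (subst (1 2) mono_eval_superset[symmetric]) auto
  finally show ?thesis .
qed

lemma keys_var: "Poly_Mapping.keys (var m j) = {(m, j)}"
  by (simp add: var_def)

lemma mono_eval_var: "mono_eval c (var m j) = c m j"
  by (simp add: mono_eval_def keys_var lookup_var)

lemma mono_eval_0: "mono_eval c 0 = 1"
  by (simp add: mono_eval_def)

lemma mono_eval_var0: "mono_eval c (var0 m j) = (if j = 0 then 1 else c m j)"
  by (simp add: var0_def mono_eval_var mono_eval_0)

lemma mono_eval_var2: "mono_eval c (var2 n m j) = (if j = n then c m j ^ 2 else c m j)"
  by (simp add: mono_eval_def var2_def)

lemma nonzero_on_var0: "(j \<noteq> 0 \<Longrightarrow> c m j \<noteq> 0) \<Longrightarrow> nonzero_on c (var0 m j)"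
  and nonzero_on_var2: "c m j \<noteq> 0 \<Longrightarrow> nonzero_on c (var2 n m j)"
  and nonzero_on_var: "c m j \<noteq> 0 \<Longrightarrow> nonzero_on c (var m j)"
  by (auto simp: nonzero_on_def var0_def var2_def keys_var)


section \<open>Square matrices as a Banach algebra\<close>

text \<open>A copy of the matrix type on which \<open>*\<close> is the matrix product and the norm
  is the maximal absolute row sum, which is submultiplicative and gives the unit norm 1.\<close>

typedef 'n cmat = "UNIV :: (complex^'n^'n) set" morphisms mat_of cm by simp

no_notation fps_nth (infixl \<open>$\<close> 75)

lemma mat_of_cm [simp]: "mat_of (cm A) = A"
  by (simp add: cm_inverse)

lemma cmat_eqI: "mat_of a = mat_of b \<Longrightarrow> a = b"
  by (simp add: mat_of_inject)

definition row_norm :: "complex^'n^'n \<Rightarrow> 'n \<Rightarrow> real" where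
  "row_norm A i = (\<Sum>j\<in>UNIV. norm (A $ i $ j))"

instantiation cmat :: (finite) real_normed_algebra_1
begin

definition zero_cmat :: "'a cmat" where "zero_cmat = cm 0"
definition one_cmat :: "'a cmat" where "one_cmat = cm (mat 1)"
definition plus_cmat :: "'a cmat \<Rightarrow> 'a cmat \<Rightarrow> 'a cmat" where "plus_cmat a b = cm (mat_of a + mat_of b)"
definition minus_cmat :: "'a cmat \<Rightarrow> 'a cmat \<Rightarrow> 'a cmat" where "minus_cmat a b = cm (mat_of a - mat_of b)"
definition uminus_cmat :: "'a cmat \<Rightarrow> 'a cmat" where "uminus_cmat a = cm (- mat_of a)"
definition times_cmat :: "'a cmat \<Rightarrow> 'a cmat \<Rightarrow> 'a cmat" where "times_cmat a b = cm (mat_of a ** mat_of b)"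
definition scaleR_cmat :: "real \<Rightarrow> 'a cmat \<Rightarrow> 'a cmat" where "scaleR_cmat r a = cm (r *\<^sub>R mat_of a)"
definition norm_cmat :: "'a cmat \<Rightarrow> real" where "norm_cmat a = Max (range (row_norm (mat_of a)))"
definition sgn_cmat :: "'a cmat \<Rightarrow> 'a cmat" where "sgn_cmat a = inverse (norm a) *\<^sub>R a"
definition dist_cmat :: "'a cmat \<Rightarrow> 'a cmat \<Rightarrow> real" where "dist_cmat a b = norm (a - b)"
definition uniformity_cmat :: "('a cmat \<times> 'a cmat) filter" where
  "uniformity_cmat = (INF e\<in>{0<..}. principal {(a, b). dist a b < e})"
definition open_cmat :: "'a cmat set \<Rightarrow> bool" where
  "open_cmat S \<longleftrightarrow> (\<forall>a\<in>S. \<forall>\<^sub>F (b, b') in uniformity. b = a \<longrightarrow> b' \<in> S)"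

lemma mat_of_simps [simp]:
  "mat_of 0 = 0" "mat_of 1 = mat 1" "mat_of (a + b) = mat_of a + mat_of b" "mat_of (a - b) = mat_of a - mat_of b"
  "mat_of (- a) = - mat_of a" "mat_of (a * b) = mat_of a ** mat_of b" "mat_of (r *\<^sub>R a) = r *\<^sub>R mat_of a"
  by (simp_all add: zero_cmat_def one_cmat_def plus_cmat_def minus_cmat_def uminus_cmat_def times_cmat_def scaleR_cmat_def)

lemma row_norm_le: "row_norm (mat_of a) i \<le> norm a"
  unfolding norm_cmat_def by (rule Max_ge) auto

lemma norm_cmat_leI: "(\<And>i. row_norm (mat_of a) i \<le> B) \<Longrightarrow> norm a \<le> B"
  unfolding norm_cmat_def by (subst Max_le_iff) auto

lemma norm_cmat_nonneg: "0 \<le> norm (a :: 'a cmat)"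
  by (rule order.trans[OF _ row_norm_le[of a undefined]]) (simp add: row_norm_def sum_nonneg)

lemma norm_scaleR_le: "norm (r *\<^sub>R a :: 'a cmat) \<le> \<bar>r\<bar> * norm a"
proof (rule norm_cmat_leI)
  fix i
  have "row_norm (mat_of (r *\<^sub>R a)) i = \<bar>r\<bar> * row_norm (mat_of a) i"
    by (simp add: row_norm_def sum_distrib_left)
  then show "row_norm (mat_of (r *\<^sub>R a)) i \<le> \<bar>r\<bar> * norm a" using row_norm_le by (simp add: mult_left_mono)
qed

instance
proof
  fix a b c :: "'a cmat" and r s :: real
  show "a + b + c = a + (b + c)" "a + b = b + a" "0 + a = a" "- a + a = 0" "a - b = a + - b"
    by (simp_all add: cmat_eqI)
  show "a * b * c = a * (b * c)" by (simp add: cmat_eqI matrix_mul_assoc)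
  show "(a + b) * c = a * c + b * c" "a * (b + c) = a * b + a * c"
    by (simp_all add: cmat_eqI vec_eq_iff matrix_matrix_mult_def sum.distrib distrib_left distrib_right)
  show "1 * a = a" "a * 1 = a" by (simp_all add: cmat_eqI)
  show "(0::'a cmat) \<noteq> 1"
  proof
    assume "(0::'a cmat) = 1"
    then have "(0 :: complex^'a^'a) = mat 1" by (metis mat_of_simps(1,2))
    from arg_cong[OF this, of "\<lambda>A. A $ undefined $ undefined"] show False by (simp add: mat_def)
  qed
  show "r *\<^sub>R (a + b) = r *\<^sub>R a + r *\<^sub>R b" "(r + s) *\<^sub>R a = r *\<^sub>R a + s *\<^sub>R a"
    "r *\<^sub>R s *\<^sub>R a = (r * s) *\<^sub>R a" "1 *\<^sub>R a = a"
    by (simp_all add: cmat_eqI scaleR_add_right scaleR_add_left)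
  show "r *\<^sub>R a * b = r *\<^sub>R (a * b)" "a * r *\<^sub>R b = r *\<^sub>R (a * b)"
    by (simp_all add: cmat_eqI vec_eq_iff matrix_matrix_mult_def scaleR_right.sum)
  show "dist a b = norm (a - b)" "sgn a = inverse (norm a) *\<^sub>R a"
    "(uniformity :: ('a cmat \<times> 'a cmat) filter) = (INF e\<in>{0<..}. principal {(a, b). dist a b < e})"
    by (simp_all add: dist_cmat_def sgn_cmat_def uniformity_cmat_def)
  show "open S \<longleftrightarrow> (\<forall>a\<in>S. \<forall>\<^sub>F (b, b') in uniformity. b = a \<longrightarrow> b' \<in> S)" for S :: "'a cmat set"
    by (simp add: open_cmat_def)
  show "norm a = 0 \<longleftrightarrow> a = 0"
  proof
    assume z: "norm a = 0"
    have "mat_of a $ i $ j = 0" for i j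
    proof -
      have "norm (mat_of a $ i $ j) \<le> row_norm (mat_of a) i"
        unfolding row_norm_def by (rule member_le_sum) auto
      then have "norm (mat_of a $ i $ j) \<le> 0" using row_norm_le[of a i] z by linarith
      then show ?thesis by simp
    qed
    then show "a = 0" by (intro cmat_eqI) (simp add: vec_eq_iff)
  next
    assume "a = 0"
    then have "norm a \<le> 0" by (intro norm_cmat_leI) (simp add: row_norm_def)
    then show "norm a = 0" using norm_cmat_nonneg[of a] by simp
  qed
  show "norm (a + b) \<le> norm a + norm b"
  proof (rule norm_cmat_leI)
    fix i
    have "row_norm (mat_of (a + b)) i \<le> row_norm (mat_of a) i + row_norm (mat_of b) i"
      unfolding row_norm_def sum.distrib[symmetric] by (intro sum_mono) (simp add: norm_triangle_ineq)
    then show "row_norm (mat_of (a + b)) i \<le> norm a + norm b"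
      using row_norm_le[of a i] row_norm_le[of b i] by linarith
  qed
  show "norm (r *\<^sub>R a) = \<bar>r\<bar> * norm a"
  proof (cases "r = 0")
    case True
    then show ?thesis using norm_scaleR_le[of 0 a] norm_cmat_nonneg[of "0 *\<^sub>R a"] by simp
  next
    case False
    have "a = inverse r *\<^sub>R (r *\<^sub>R a)" using False by (simp add: cmat_eqI)
    then have "norm a \<le> \<bar>inverse r\<bar> * norm (r *\<^sub>R a)" using norm_scaleR_le by metis
    then have "\<bar>r\<bar> * norm a \<le> \<bar>r\<bar> * (\<bar>inverse r\<bar> * norm (r *\<^sub>R a))" by (rule mult_left_mono) simp
    also have "\<dots> = norm (r *\<^sub>R a)" using False by (simp flip: mult.assoc abs_mult)
    finally show ?thesis using norm_scaleR_le[of r a] by simp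
  qed
  show "norm (a * b) \<le> norm a * norm b"
  proof (rule norm_cmat_leI)
    fix i
    have "row_norm (mat_of (a * b)) i = (\<Sum>j\<in>UNIV. norm (\<Sum>k\<in>UNIV. mat_of a $ i $ k * mat_of b $ k $ j))"
      by (simp add: row_norm_def matrix_matrix_mult_def)
    also have "\<dots> \<le> (\<Sum>j\<in>UNIV. \<Sum>k\<in>UNIV. norm (mat_of a $ i $ k) * norm (mat_of b $ k $ j))"
      by (intro sum_mono order.trans[OF norm_sum]) (simp add: norm_mult)
    also have "\<dots> = (\<Sum>k\<in>UNIV. norm (mat_of a $ i $ k) * row_norm (mat_of b) k)"
      by (subst sum.swap) (simp add: row_norm_def sum_distrib_left)
    also have "\<dots> \<le> (\<Sum>k\<in>UNIV. norm (mat_of a $ i $ k) * norm b)"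
      by (intro sum_mono mult_left_mono row_norm_le) simp
    also have "\<dots> = row_norm (mat_of a) i * norm b"
      by (simp add: row_norm_def sum_distrib_right)
    also have "\<dots> \<le> norm a * norm b"
      by (intro mult_right_mono row_norm_le norm_cmat_nonneg)
    finally show "row_norm (mat_of (a * b)) i \<le> norm a * norm b" .
  qed
  show "norm (1 :: 'a cmat) = 1"
  proof -
    have "row_norm (mat 1 :: complex^'a^'a) i = 1" for i
    proof -
      have "row_norm (mat 1 :: complex^'a^'a) i = (\<Sum>j\<in>UNIV. if j = i then 1 else 0)"
        unfolding row_norm_def by (rule sum.cong) (auto simp: mat_def)
      then show ?thesis by simp
    qed
    then have "range (row_norm (mat 1 :: complex^'a^'a)) = {1}" by auto
    then show ?thesis by (simp add: norm_cmat_def)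
  qed
qed

end

lemma entry_le_norm: "norm (mat_of a $ i $ j) \<le> norm a"
proof -
  have "norm (mat_of a $ i $ j) \<le> row_norm (mat_of a) i"
    unfolding row_norm_def by (rule member_le_sum) auto
  then show ?thesis using row_norm_le[of a i] by simp
qed

lemma norm_le_entries: "norm a \<le> (\<Sum>i\<in>UNIV. \<Sum>j\<in>UNIV. norm (mat_of a $ i $ j))"
proof (rule norm_cmat_leI)
  fix i
  show "row_norm (mat_of a) i \<le> (\<Sum>i\<in>UNIV. \<Sum>j\<in>UNIV. norm (mat_of a $ i $ j))"
    unfolding row_norm_def by (rule member_le_sum) (auto intro: sum_nonneg)
qed

instance cmat :: (finite) banach
proof
  fix X :: "nat \<Rightarrow> 'a cmat" assume X: "Cauchy X"
  have "Cauchy (\<lambda>k. mat_of (X k) $ i $ j)" for i j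
  proof (rule CauchyI)
    fix r :: real assume "0 < r"
    then obtain M where M: "\<forall>m\<ge>M. \<forall>k\<ge>M. norm (X m - X k) < r" using X CauchyD by blast
    then show "\<exists>M. \<forall>m\<ge>M. \<forall>k\<ge>M. norm (mat_of (X m) $ i $ j - mat_of (X k) $ i $ j) < r"
    proof (intro exI[of _ M] allI impI)
      fix m k assume "M \<le> m" "M \<le> k"
      then have "norm (X m - X k) < r" using M by blast
      then show "norm (mat_of (X m) $ i $ j - mat_of (X k) $ i $ j) < r"
        using entry_le_norm[of "X m - X k" i j] by simp
    qed
  qed
  then have "\<exists>l. (\<lambda>k. mat_of (X k) $ i $ j) \<longlonglongrightarrow> l" for i j
    using Cauchy_convergent convergent_def by blast
  then obtain L where L: "\<And>i j. (\<lambda>k. mat_of (X k) $ i $ j) \<longlonglongrightarrow> L i j" by metis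
  define B where "B = cm (\<chi> i j. L i j)"
  have "(\<lambda>k. \<Sum>i\<in>UNIV. \<Sum>j\<in>UNIV. norm (mat_of (X k) $ i $ j - L i j)) \<longlonglongrightarrow> (\<Sum>i\<in>(UNIV::'a set). \<Sum>j\<in>(UNIV::'a set). norm (L i j - L i j))"
    by (intro tendsto_intros L)
  then have z: "(\<lambda>k. \<Sum>i\<in>UNIV. \<Sum>j\<in>UNIV. norm (mat_of (X k) $ i $ j - L i j)) \<longlonglongrightarrow> 0" by simp
  have "(\<lambda>k. X k - B) \<longlonglongrightarrow> 0"
  proof (rule Lim_null_comparison[OF _ z])
    show "\<forall>\<^sub>F k in sequentially. norm (X k - B) \<le> (\<Sum>i\<in>UNIV. \<Sum>j\<in>UNIV. norm (mat_of (X k) $ i $ j - L i j))"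
      using norm_le_entries[of "X _ - B"] by (intro always_eventually allI) (simp add: B_def)
  qed
  then show "convergent X" unfolding convergent_def using LIM_zero_iff by blast
qed

lemma tendsto_mat_of: "(f \<longlongrightarrow> a) F \<Longrightarrow> ((\<lambda>t. mat_of (f t)) \<longlongrightarrow> mat_of (a :: 'n::finite cmat)) F"
proof (intro vec_tendstoI)
  fix i j assume f: "(f \<longlongrightarrow> a) F"
  have l: "((\<lambda>t. norm (f t - a)) \<longlongrightarrow> 0) F"
    using tendsto_norm[OF tendsto_diff[OF f tendsto_const[of a]]] by simp
  have b: "norm (mat_of (f t) $ i $ j - mat_of a $ i $ j) \<le> norm (f t - a)" for t
    using entry_le_norm[of "f t - a" i j] by simp
  have "((\<lambda>t. mat_of (f t) $ i $ j - mat_of a $ i $ j) \<longlongrightarrow> 0) F"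
    by (rule Lim_null_comparison[OF always_eventually[OF allI[OF b]] l])
  then show "((\<lambda>t. mat_of (f t) $ i $ j) \<longlongrightarrow> mat_of a $ i $ j) F" by (simp add: LIM_zero_iff)
qed

definition cscale :: "complex \<Rightarrow> 'n::finite cmat \<Rightarrow> 'n cmat" where
  "cscale z a = cm (mat z ** mat_of a)"

lemma mat_times_entry: "(mat z ** A) $ i $ j = z * (A :: complex^'n^'n) $ i $ j"
  by (simp add: mat_def matrix_matrix_mult_def if_distrib[of "\<lambda>x. x * _"] cong: if_cong)

lemma mat_of_cscale [simp]: "mat_of (cscale z a) = mat z ** mat_of a"
  by (simp add: cscale_def)

lemma cscale_algebra: "complex_banach_algebra cscale"
proof
  fix z w :: complex and a b :: "'n::finite cmat" and r :: real
  show "cscale z (a + b) = cscale z a + cscale z b" "cscale (z + w) a = cscale z a + cscale w a"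
    "cscale z (cscale w a) = cscale (z * w) a"
    by (rule cmat_eqI, simp add: vec_eq_iff mat_times_entry algebra_simps)+
  show "cscale (complex_of_real r) a = r *\<^sub>R a"
    by (rule cmat_eqI) (simp add: vec_eq_iff mat_times_entry, simp add: scaleR_conv_of_real)
  show "cscale z a * b = cscale z (a * b)" by (rule cmat_eqI) (simp add: matrix_mul_assoc)
  show "a * cscale z b = cscale z (a * b)"
  proof (rule cmat_eqI)
    have "mat_of a ** (mat z ** mat_of b) = mat z ** (mat_of a ** mat_of b)"
      unfolding vec_eq_iff
      by (simp add: mat_times_entry) (simp add: matrix_matrix_mult_def[of "mat_of a"] mat_times_entry sum_distrib_left mult.left_commute)
    then show "mat_of (a * cscale z b) = mat_of (cscale z (a * b))" by simp
  qed
qed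

lemma mat_of_power: "mat_of (a ^ k) = ((**) (mat_of a) ^^ k) (mat 1)"
  by (induction k) simp_all

lemma mexp_eq: "mexp A = mat_of (exp (cm A))"
proof -
  have "(\<lambda>k. (cm A) ^ k /\<^sub>R fact k) sums exp (cm A)" by (rule exp_converges)
  then have "(\<lambda>m. mat_of (\<Sum>k<m. (cm A) ^ k /\<^sub>R fact k)) \<longlonglongrightarrow> mat_of (exp (cm A))"
    unfolding sums_def by (rule tendsto_mat_of)
  moreover have "mat_of (\<Sum>k<m. (cm A) ^ k /\<^sub>R fact k) = (\<Sum>k<m. (1 / fact k) *\<^sub>R (((**) A ^^ k) (mat 1)))" for m
    by (induction m) (simp_all add: mat_of_power divide_inverse)
  ultimately have "(\<lambda>k. (1 / fact k) *\<^sub>R (((**) A ^^ k) (mat 1))) sums mat_of (exp (cm A))"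
    unfolding sums_def by simp
  then show ?thesis unfolding mexp_def by (rule sums_unique[symmetric])
qed

lemma mprod_eq: "mprod (map (\<lambda>i. mat_of (g i)) l) = mat_of (prod_list (map g l))"
  by (induction l) (simp_all add: mprod_def)

lemma mat_of_inv: "a * b = 1 \<Longrightarrow> b * a = 1 \<Longrightarrow> matrix_inv (mat_of a) = mat_of b"
proof -
  assume "a * b = 1" "b * a = 1"
  then have ab: "mat_of a ** mat_of b = mat 1" "mat_of b ** mat_of a = mat 1" by (metis mat_of_simps(2,6))+
  then have inv: "mat_of a ** matrix_inv (mat_of a) = mat 1 \<and> matrix_inv (mat_of a) ** mat_of a = mat 1"
    unfolding matrix_inv_def by (intro someI_ex[of "\<lambda>A'. mat_of a ** A' = mat 1 \<and> A' ** mat_of a = mat 1"]) blast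
  have "matrix_inv (mat_of a) = matrix_inv (mat_of a) ** (mat_of a ** mat_of b)" by (simp add: ab)
  also have "\<dots> = (matrix_inv (mat_of a) ** mat_of a) ** mat_of b" by (simp only: matrix_mul_assoc)
  also have "\<dots> = mat_of b" using inv by simp
  finally show ?thesis .
qed

lemma regular_GL_continuous: "regular_GL p \<Longrightarrow> continuous_on {A. invertible A} p"
proof (induction rule: regular_GL.induct)
  case (entry i j)
  then show ?case by (intro continuous_intros)
next
  case det_inverse
  have "continuous_on {A. invertible A} (\<lambda>A :: complex^'a^'a. det A)"
    unfolding det_def by (intro continuous_intros)
  then show ?case by (intro continuous_on_inverse) (auto simp: invertible_det_nz)
qed (auto intro!: continuous_intros)

lemma regular_GL_holomorphic:
  fixes f :: "complex \<Rightarrow> complex^'n^'n"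
  assumes "regular_GL p" and f: "\<And>i j. (\<lambda>t. f t $ i $ j) holomorphic_on UNIV" "\<And>t. invertible (f t)"
  shows "(\<lambda>t. p (f t)) holomorphic_on UNIV"
  using assms(1)
proof (induction rule: regular_GL.induct)
  case det_inverse
  have "(\<lambda>t. det (f t)) holomorphic_on UNIV"
    unfolding det_def by (intro holomorphic_intros f)
  then show ?case using f(2) by (intro holomorphic_on_inverse) (auto simp: invertible_det_nz)
qed (auto intro!: holomorphic_intros f)


section \<open>The matrix group\<close>

lemma mat_of_comm: "mat_of (comm a b) = lie_bracket (mat_of a) (mat_of b)"
  by (simp add: comm_def lie_bracket_def)

lemma mat_of_comm_power: "mat_of ((comm a ^^ k) b) = (lie_bracket (mat_of a) ^^ k) (mat_of b)"
  by (induction k) (simp_all add: mat_of_comm)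

lemma mat_of_gen:
  assumes "u \<in> gen S" "\<And>a. a \<in> S \<Longrightarrow> mat_of a \<in> T"
  shows "mat_of u \<in> generate GL T"
  using assms(1)
proof induction
  case gen_one
  then show ?case using generate.one[of GL T] by (simp add: GL_def)
next
  case (gen_left a u)
  then show ?case
    using generate.eng[OF generate.incl[OF assms(2)], of a "mat_of u" GL] by (simp add: GL_def)
qed

lemma bounded_linear_entry: "bounded_linear (\<lambda>a. mat_of a $ i $ j)"
  by (rule bounded_linear_intro[where K = 1]) (use entry_le_norm in auto)

locale chevalley_matrices =
  fixes n :: nat and e f h :: "nat \<Rightarrow> complex^'N^'N"
  assumes n: "n \<ge> 2" and CS: "chevalley_serre_B n e f h"

sublocale chevalley_matrices \<subseteq> ch: chevalley_B cscale n "\<lambda>i. cm (e i)" "\<lambda>i. cm (f i)" "\<lambda>i. cm (h i)"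
proof (intro chevalley_B.intro cscale_algebra chevalley_B_axioms.intro)
  fix i j assume ij: "i \<in> {1..n}" "j \<in> {1..n}"
  note cs = CS[unfolded chevalley_serre_B_def, rule_format, OF ij]
  show "comm (cm (h i)) (cm (h j)) = 0" "comm (cm (h i)) (cm (e j)) = cscale (of_int (cartan_B n i j)) (cm (e j))"
    "comm (cm (h i)) (cm (f j)) = - cscale (of_int (cartan_B n i j)) (cm (f j))"
    "comm (cm (e i)) (cm (f j)) = (if i = j then cm (h i) else 0)"
    using cs by (auto intro!: cmat_eqI simp: mat_of_comm)
  show "i \<noteq> j \<Longrightarrow> (comm (cm (e i)) ^^ nat (1 - cartan_B n i j)) (cm (e j)) = 0"
    "i \<noteq> j \<Longrightarrow> (comm (cm (f i)) ^^ nat (1 - cartan_B n i j)) (cm (f j)) = 0"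
    using cs by (auto intro!: cmat_eqI simp: mat_of_comm_power)
qed (rule n)

context chevalley_matrices
begin

lemma mexp_ep: "mexp (mat t ** A) = mat_of (ch.ep (cm A) t)"
  by (simp add: mexp_eq ch.ep_def cscale_def)

lemma one_param_eq: "one_param e i t = mat_of (ch.x i t)" "one_param f i t = mat_of (ch.y i t)"
  by (simp_all add: one_param_def mexp_ep ch.x_def ch.y_def)

lemma coroot_eq: "coroot_subgroup h i t = mat_of (ch.al i t)"
  by (simp add: coroot_subgroup_def mexp_ep ch.al_def)

lemma refl_lift_eq: "refl_lift e f = (\<lambda>i. mat_of (ch.sb i))"
  by (simp add: refl_lift_def one_param_eq ch.sb_def fun_eq_iff)

lemma ep_h_tor: "i \<in> ch.I \<Longrightarrow> ch.ep (cm (h i)) z = ch.tor (\<lambda>j. if j = i then z else 0)"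
proof -
  assume "i \<in> ch.I"
  then have "(\<Sum>j\<in>ch.I. cscale (if j = i then z else 0) (cm (h j))) = cscale z (cm (h i))"
    by (subst sum.remove[of ch.I i]) (auto simp: ch.I_def)
  then show ?thesis by (simp add: ch.tor_def ch.ep_def)
qed

lemma al_list_tor:
  "distinct l \<Longrightarrow> set l \<subseteq> ch.I \<Longrightarrow>
   prod_list (map (\<lambda>i. ch.al i (exp (z i))) l) = ch.tor (\<lambda>j. if j \<in> set l then z j else 0)"
proof (induction l)
  case Nil
  then show ?case by (simp add: ch.tor_def)
next
  case (Cons i l)
  have "(\<lambda>j. (if j = i then z i else 0) + (if j \<in> set l then z j else 0)) =
      (\<lambda>j. if j \<in> set (i # l) then z j else 0)"
    using Cons.prems by (auto simp: fun_eq_iff)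
  then show ?case using Cons by (simp add: ch.al_exp ep_h_tor ch.tor_add)
qed

lemma torus_eq: "torus_elt n h (\<lambda>j. exp (z j)) = mat_of (ch.tor z)"
proof -
  have s: "set [1..<n+1] = ch.I" by (auto simp: ch.I_def)
  have "torus_elt n h (\<lambda>j. exp (z j)) = mat_of (prod_list (map (\<lambda>i. ch.al i (exp (z i))) [1..<n+1]))"
    unfolding torus_elt_def coroot_eq by (rule mprod_eq)
  also have "\<dots> = mat_of (ch.tor (\<lambda>j. if j \<in> ch.I then z j else 0))"
    by (subst al_list_tor) (simp_all only: s distinct_upt order.refl)
  also have "ch.tor (\<lambda>j. if j \<in> ch.I then z j else 0) = ch.tor z"
    unfolding ch.tor_def by (simp cong: sum.cong)
  finally show ?thesis .
qed

lemma mat_of_subgroups: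
  "u \<in> ch.U \<Longrightarrow> mat_of u \<in> unipotent_subgroup n e"
  "u \<in> ch.Um \<Longrightarrow> mat_of u \<in> unipotent_subgroup n f"
  "u \<in> ch.G \<Longrightarrow> mat_of u \<in> chevalley_group n e f"
  unfolding ch.U_def ch.Um_def ch.G_def unipotent_subgroup_def chevalley_group_def ch.I_def
  by (erule mat_of_gen; force simp: one_param_eq)+

lemma invertible_G: "u \<in> ch.G \<Longrightarrow> invertible (mat_of u)"
  unfolding invertible_def using ch.G_inverse[of u] by (metis mat_of_simps(2,6))

text \<open>The entry is an everywhere convergent power series in t with coefficients
  \<open>L k\<close> divided by k!.\<close>

lemma entry_ep_holomorphic: "(\<lambda>t. mat_of (a * ch.ep A t * b) $ p $ q) holomorphic_on UNIV"
proof -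
  define L where "L k = mat_of (a * A ^ k * b) $ p $ q" for k
  have pw: "cscale t A ^ k = cscale (t ^ k) (A ^ k)" for t k
    by (induction k) (simp_all add: mult.commute)
  have "(\<lambda>k. (L k /\<^sub>R fact k) * t ^ k) sums (mat_of (a * ch.ep A t * b) $ p $ q)" for t
  proof -
    have "(\<lambda>k. mat_of (a * (cscale t A ^ k /\<^sub>R fact k) * b) $ p $ q) sums (mat_of (a * ch.ep A t * b) $ p $ q)"
      unfolding ch.ep_def
      by (intro bounded_linear.sums[OF bounded_linear_entry] sums_mult sums_mult2 exp_converges)
    moreover have "mat_of (a * (cscale t A ^ k /\<^sub>R fact k) * b) $ p $ q = (L k /\<^sub>R fact k) * t ^ k" for k
    proof -
      have "mat_of (a * (cscale t A ^ k /\<^sub>R fact k) * b) = mat_of (cscale (t ^ k) (a * A ^ k * b) /\<^sub>R fact k)"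
        unfolding pw by simp
      then show ?thesis by (simp only: mat_of_simps mat_of_cscale vector_scaleR_component mat_times_entry L_def) simp
    qed
    ultimately show ?thesis by simp
  qed
  then have "(\<lambda>t. mat_of (a * ch.ep A t * b) $ p $ q) holomorphic_on ball 0 r" for r
    by (intro power_series_holomorphic[where a = "\<lambda>k. L k /\<^sub>R fact k"]) simp
  then show ?thesis
    unfolding holomorphic_on_def
    by (metis (no_types, lifting) at_within_open centre_in_ball dist_0_norm field_differentiable_at_within gt_ex iso_tuple_UNIV_I mem_ball open_ball)
qed

text \<open>The reduced word inside \<open>weyl_lift\<close> is chosen arbitrarily, so all that is
  known of it is the element it represents. The evaluations of the minors are therefore stated for
  any reduced word r.\<close>

lemma weyl_lift_word:
  assumes "set r \<subseteq> {1..n}"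
  shows "\<exists>r'. redu n r' \<and> wact n r' = wact n r \<and> weyl_lift n e f (weyl_word n r) = mat_of (ch.lift r')"
proof -
  define r' where "r' = (SOME r'. reduced_expression n (weyl_word n r) r')"
  have "reduced_expression n (weyl_word n r) r'"
    unfolding r'_def by (rule someI_ex[OF reduced_expression_ex[OF n assms]])
  then have "redu n r'" "wact n r' = wact n r"
    using reduced_expression_word[OF n assms] by auto
  moreover have "weyl_lift n e f (weyl_word n r) = mat_of (ch.lift r')"
    unfolding weyl_lift_def r'_def[symmetric] refl_lift_eq ch.lift_def by (rule mprod_eq)
  ultimately show ?thesis by blast
qed

lemma weyl_lift_redu:
  assumes "redu n r"
  shows "weyl_lift n e f (weyl_word n r) = mat_of (ch.lift r)"
proof -
  have "set r \<subseteq> {1..n}" using assms by (induction r) (auto simp: redu_Cons)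
  then show ?thesis using weyl_lift_word ch.lift_unique[OF _ assms] by metis
qed

end

locale chevalley_minors = chevalley_matrices n e f h
  for n :: nat and e f h :: "nat \<Rightarrow> complex^'N^'N" +
  fixes \<Delta> :: "nat \<Rightarrow> complex^'N^'N \<Rightarrow> complex"
  assumes PM: "i \<in> {1..n} \<Longrightarrow> principal_minor n e f h i (\<Delta> i)"

text \<open>A regular function agrees on the group with a polynomial in the entries and the inverse
  determinant; this gives continuity, and holomorphy along x_i(t) because the entries there are
  entire and the determinant has no zero.\<close>

sublocale chevalley_minors \<subseteq> ch: minors cscale n "\<lambda>i. cm (e i)" "\<lambda>i. cm (f i)" "\<lambda>i. cm (h i)" "\<lambda>k a. \<Delta> k (mat_of a)"
proof
  fix k assume k: "k \<in> ch.I"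
  then have "principal_minor n e f h k (\<Delta> k)" using PM by (simp add: ch.I_def)
  then obtain p where p: "regular_GL p" "\<And>g. g \<in> chevalley_group n e f \<Longrightarrow> \<Delta> k g = p g"
    and cell: "\<And>u u' t. u \<in> unipotent_subgroup n f \<Longrightarrow> u' \<in> unipotent_subgroup n e \<Longrightarrow>
      (\<forall>j\<in>{1..n}. t j \<noteq> 0) \<Longrightarrow> \<Delta> k (u ** torus_elt n h t ** u') = t k"
    unfolding principal_minor_def regular_on_def by blast
  have D: "g \<in> ch.G \<Longrightarrow> \<Delta> k (mat_of g) = p (mat_of g)" for g
    by (intro p mat_of_subgroups)
  show "continuous_on ch.G (\<lambda>a. \<Delta> k (mat_of a))"
  proof -
    have "continuous_on ch.G (\<lambda>a. p (mat_of a))"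
    proof (rule continuous_on_compose2[OF regular_GL_continuous[OF p(1)]])
      show "continuous_on ch.G mat_of"
        unfolding continuous_on_def by (intro ballI tendsto_mat_of tendsto_ident_at)
    qed (use invertible_G in auto)
    then show ?thesis by (simp add: D cong: continuous_on_cong)
  qed
  show "(\<lambda>t. \<Delta> k (mat_of (a * ch.x i t * b))) holomorphic_on UNIV"
    if "i \<in> ch.I" "a \<in> ch.G" "b \<in> ch.G" for i a b
  proof -
    have g: "a * ch.x i t * b \<in> ch.G" for t
      by (intro ch.G_I(4) ch.G_I(1) that)
    have "(\<lambda>t. p (mat_of (a * ch.x i t * b))) holomorphic_on UNIV"
      using p(1)
    proof (rule regular_GL_holomorphic)
      show "(\<lambda>t. mat_of (a * ch.x i t * b) $ p $ q) holomorphic_on UNIV" for p q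
        unfolding ch.x_def by (rule entry_ep_holomorphic)
    qed (rule invertible_G[OF g])
    then show ?thesis by (simp only: D[OF g])
  qed
  show "\<Delta> k (mat_of (u * ch.tor z * v)) = exp (z k)" if "u \<in> ch.Um" "v \<in> ch.U" for u v z
    using cell[OF mat_of_subgroups(2)[OF that(1)] mat_of_subgroups(1)[OF that(2)], of "\<lambda>j. exp (z j)"]
    by (simp add: torus_eq)
qed

context chevalley_minors
begin

lemma matrix_inv_lift: "matrix_inv (mat_of (ch.lift r)) = mat_of (ch.sl False (rev r))"
  using ch.sl_inv[of True r] ch.sl_inv'[of True r] by (intro mat_of_inv) (simp_all add: ch.sl_lift)

lemma Theta_minus_eq: "Theta_minus n f h c = mat_of (ch.th c [1..int n])"
proof -
  have b: "bold_y f h i t = mat_of (ch.BY i t)" for i t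
    by (simp add: bold_y_def one_param_eq coroot_eq ch.BY_def)
  have "Theta_minus n f h c = mprod (map (\<lambda>m. mat_of (ch.tail (c m) 1)) [1..int n])"
    unfolding Theta_minus_def b mprod_eq ch.tail_def ..
  also have "\<dots> = mat_of (ch.th c [1..int n])" unfolding ch.th_def by (rule mprod_eq)
  finally show ?thesis .
qed

lemma redu_Nil: "redu n []"
  by (simp add: redu_def ninv_rho)

lemma weyl_lift_simple_refl: "k \<in> {1..n} \<Longrightarrow> weyl_lift n e f (simple_refl n k) = mat_of (ch.sb k)"
proof -
  assume "k \<in> {1..n}"
  then have "redu n [k]" by (simp add: redu_Cons redu_Nil alpha_def rho_def; arith)
  from weyl_lift_redu[OF this] show ?thesis by simp
qed

lemma weyl_lift_id: "weyl_lift n e f id = mat 1"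
  using weyl_lift_redu[OF redu_Nil] by simp

lemma gen_minor_right:
  assumes "k \<in> {1..n}"
  obtains r where "redu n r" "wact n r = wact n (cox n n)"
    "gen_minor n e f (\<Delta> k) (longest_elt n) (simple_refl n k) (Theta_minus n f h c) =
       \<Delta> k (mat_of (ch.sl False (rev r) * ch.th c [1..int n] * ch.sb k))"
proof -
  obtain r where r: "redu n r" "wact n r = wact n (cox n n)"
    "weyl_lift n e f (longest_elt n) = mat_of (ch.lift r)"
    using weyl_lift_word[OF set_cox] longest_elt_eq[OF n] by metis
  show thesis
    by (rule that[OF r(1,2)]) (simp add: gen_minor_def r(3) matrix_inv_lift Theta_minus_eq weyl_lift_simple_refl[OF assms])
qed

lemma gen_minor_left:
  assumes "k \<in> {1..n}"
  obtains r where "redu n r" "wact n r = wact n (cox n n @ [k])"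
    "gen_minor n e f (\<Delta> k) (longest_elt n \<circ> simple_refl n k) id (Theta_minus n f h c) =
       \<Delta> k (mat_of (ch.sl False (rev r) * ch.th c [1..int n]))"
proof -
  have w: "longest_elt n \<circ> simple_refl n k = weyl_word n (cox n n @ [k])"
    by (simp add: longest_elt_eq[OF n] weyl_word_append)
  have "set (cox n n @ [k]) \<subseteq> {1..n}" using set_cox[of n n] assms by auto
  then obtain r where r: "redu n r" "wact n r = wact n (cox n n @ [k])"
    "weyl_lift n e f (longest_elt n \<circ> simple_refl n k) = mat_of (ch.lift r)"
    using weyl_lift_word unfolding w by metis
  show thesis
    by (rule that[OF r(1,2)]) (simp add: gen_minor_def r(3) matrix_inv_lift Theta_minus_eq weyl_lift_id)
qed

end

section \<open>Monomials\<close>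

context
  fixes n :: nat and c :: "int \<Rightarrow> nat \<Rightarrow> complex" and m :: "vec_elt \<Rightarrow> monomial" and k :: int
  assumes n: "n \<ge> 2" and emb: "crystal_embedding n (vec_crystal n) (mono_crystal n sign0) m" "m (V 1) = var k 1"
begin

lemma eval_V:
  assumes "1 \<le> j" "j \<le> n" "c k j \<noteq> 0" "j \<noteq> 1 \<Longrightarrow> c (k + 1) (j - 1) \<noteq> 0"
  shows "mono_eval c (m (V j)) =
    (if j = n then c k j ^ 2 else c k j) * (if j = 1 then 1 else inverse (c (k + 1) (j - 1)))"
  using assms unfolding mv_V[OF n emb assms(1,2)]
  by (subst mono_eval_diff) (auto simp: nonzero_on_var0 nonzero_on_var2 mono_eval_var0 mono_eval_var2)

lemma eval_V0:
  assumes "c k n \<noteq> 0" "c (k + 1) n \<noteq> 0"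
  shows "mono_eval c (m V0) = c k n * inverse (c (k + 1) n)"
  using assms unfolding mv_V0[OF n emb]
  by (subst mono_eval_diff) (simp_all add: nonzero_on_var mono_eval_var)

lemma eval_Vbar:
  assumes "1 \<le> j" "j \<le> n" "c p j \<noteq> 0" "j \<noteq> 1 \<Longrightarrow> c p (j - 1) \<noteq> 0" "k + int n - int j + 1 = p"
  shows "mono_eval c (m (Vbar j)) =
    (if j = 1 then 1 else c p (j - 1)) * (if j = n then inverse (c p j) ^ 2 else inverse (c p j))"
  using assms(1-4) unfolding mv_Vbar[OF n emb assms(1,2)] assms(5)
  by (subst mono_eval_diff) (auto simp: nonzero_on_var0 nonzero_on_var2 mono_eval_var0 mono_eval_var2 power_inverse)

end

theorem theorem8p6:
  fixes n :: nat
    and e f h :: "nat \<Rightarrow> complex^'N^'N"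
    and \<Delta> :: "nat \<Rightarrow> complex^'N^'N \<Rightarrow> complex"
    and c :: "int \<Rightarrow> nat \<Rightarrow> complex"
    and m_vec :: "int \<Rightarrow> vec_elt \<Rightarrow> monomial"
    and m_spin :: "int \<Rightarrow> nat set \<Rightarrow> monomial"
  assumes "n \<ge> 2"
    and "simply_connected_B n e f h"
    and "\<forall>i\<in>{1..n}. principal_minor n e f h i (\<Delta> i)"
    and "\<forall>m\<in>{1..int n}. \<forall>i\<in>{1..n}. c m i \<noteq> 0"
    and "\<forall>k. crystal_embedding n (vec_crystal n) (mono_crystal n sign0) (m_vec k) \<and>
             m_vec k (V 1) = var k 1"
    and "\<forall>k. crystal_embedding n (spin_crystal n) (mono_crystal n sign0) (m_spin k) \<and>
             m_spin k {} = var k n"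
  shows "gen_minor n e f (\<Delta> n) (longest_elt n) (simple_refl n n) (Theta_minus n f h c) =
           mono_eval c (m_spin (int n) {}) \<and>
         mono_eval c (m_spin (int n) {}) = c (int n) n \<and>
         (\<forall>k\<in>{1..n-1}.
            gen_minor n e f (\<Delta> k) (longest_elt n) (simple_refl n k) (Theta_minus n f h c) =
              (\<Sum>j=1..n. mono_eval c (m_vec (int k) (V j))) + 2 * mono_eval c (m_vec (int k) V0) +
              (\<Sum>j=k+1..n. mono_eval c (m_vec (int k) (Vbar j))) \<and>
            gen_minor n e f (\<Delta> k) (longest_elt n \<circ> simple_refl n k) id (Theta_minus n f h c) =
              (\<Sum>j=1..k. mono_eval c (m_vec (int k - int n) (Vbar j))))"
proof -
  interpret chevalley_minors n e f h \<Delta>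
    using assms(1-3) by unfold_locales (simp_all add: simply_connected_B_def)
  have nz: "c m i \<noteq> 0" if "m \<in> {1..int n}" "i \<in> {1..n}" for m i
    using assms(4) that by blast
  then have nz0: "c m i = 0 \<Longrightarrow> m \<notin> {1..int n} \<or> i \<notin> {1..n}" for m i
    by blast
  have nz': "\<And>m i. m \<in> {1..int n} \<Longrightarrow> i \<in> ch.I \<Longrightarrow> c m i \<noteq> 0"
    using nz by (simp add: ch.I_def)
  have emb: "crystal_embedding n (vec_crystal n) (mono_crystal n sign0) (m_vec k)" "m_vec k (V 1) = var k 1" for k
    using assms(5) by blast+
  have spin: "mono_eval c (m_spin (int n) {}) = c (int n) n"
    using assms(6) by (simp add: mono_eval_var)
  have nI: "n \<in> {1..n}" using n by simp
  obtain r where r: "redu n r" "wact n r = wact n (cox n n)"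
    "gen_minor n e f (\<Delta> n) (longest_elt n) (simple_refl n n) (Theta_minus n f h c) =
       \<Delta> n (mat_of (ch.sl False (rev r) * ch.th c [1..int n] * ch.sb n))"
    by (rule gen_minor_right[OF nI])
  have 1: "gen_minor n e f (\<Delta> n) (longest_elt n) (simple_refl n n) (Theta_minus n f h c) = c (int n) n"
    unfolding r(3) by (rule ch.minor_last[OF nz' r(1,2)])
  have 2: "gen_minor n e f (\<Delta> k) (longest_elt n) (simple_refl n k) (Theta_minus n f h c) =
      (\<Sum>j=1..n. mono_eval c (m_vec (int k) (V j))) + 2 * mono_eval c (m_vec (int k) V0) +
      (\<Sum>j=k+1..n. mono_eval c (m_vec (int k) (Vbar j)))" if k: "1 \<le> k" "k < n" for k
  proof -
    have kI: "k \<in> {1..n}" using k by simp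
    obtain r where r: "redu n r" "wact n r = wact n (cox n n)"
      "gen_minor n e f (\<Delta> k) (longest_elt n) (simple_refl n k) (Theta_minus n f h c) =
         \<Delta> k (mat_of (ch.sl False (rev r) * ch.th c [1..int n] * ch.sb k))"
      by (rule gen_minor_right[OF kI])
    have "gen_minor n e f (\<Delta> k) (longest_elt n) (simple_refl n k) (Theta_minus n f h c) =
      (\<Sum>l=1..<n. c (int k) l * (if l = 1 then 1 else inverse (c (int k + 1) (l - 1)))) +
      c (int k) n ^ 2 * inverse (c (int k + 1) (n - 1)) + 2 * (c (int k) n * inverse (c (int k + 1) n)) +
      (\<Sum>j=k+1..n. c (int (n + k + 1) - int j) (j - 1) * ch.ee (c (int (n + k + 1) - int j)) j)"
      unfolding r(3) by (rule trans[OF ch.minor_right[OF nz' k r(1,2)] ch.minor_right_value[OF nz' k]])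
    also have "(\<Sum>l=1..<n. c (int k) l * (if l = 1 then 1 else inverse (c (int k + 1) (l - 1)))) =
        (\<Sum>l=1..<n. mono_eval c (m_vec (int k) (V l)))"
      using k by (intro sum.cong refl) (subst eval_V[OF n emb]; auto dest!: nz0)
    also have "c (int k) n ^ 2 * inverse (c (int k + 1) (n - 1)) = mono_eval c (m_vec (int k) (V n))"
      using k n by (subst eval_V[OF n emb]) (auto dest!: nz0)
    also have "(\<Sum>l=1..<n. mono_eval c (m_vec (int k) (V l))) + mono_eval c (m_vec (int k) (V n)) =
        (\<Sum>j=1..n. mono_eval c (m_vec (int k) (V j)))"
      using n by (simp add: sum.last_plus add.commute)
    also have "c (int k) n * inverse (c (int k + 1) n) = mono_eval c (m_vec (int k) V0)"
      using k by (subst eval_V0[OF n emb]) (auto dest!: nz0)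
    also have "(\<Sum>j=k+1..n. c (int (n + k + 1) - int j) (j - 1) * ch.ee (c (int (n + k + 1) - int j)) j) =
        (\<Sum>j=k+1..n. mono_eval c (m_vec (int k) (Vbar j)))"
    proof (intro sum.cong refl)
      fix j assume "j \<in> {k+1..n}"
      then show "c (int (n + k + 1) - int j) (j - 1) * ch.ee (c (int (n + k + 1) - int j)) j =
          mono_eval c (m_vec (int k) (Vbar j))"
        \<comment> \<open>p is the superscript k + n - j + 1, which stays within 2, ..., n because j
          runs over k + 1, ..., n.\<close>
        using k by (subst eval_Vbar[OF n emb, where p = "int (n + k + 1) - int j"]) (auto dest!: nz0 simp: ch.ee_def)
    qed
    finally show ?thesis .
  qed
  have 3: "gen_minor n e f (\<Delta> k) (longest_elt n \<circ> simple_refl n k) id (Theta_minus n f h c) =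
      (\<Sum>j=1..k. mono_eval c (m_vec (int k - int n) (Vbar j)))" if k: "1 \<le> k" "k < n" for k
  proof -
    have kI: "k \<in> {1..n}" using k by simp
    obtain r where r: "redu n r" "wact n r = wact n (cox n n @ [k])"
      "gen_minor n e f (\<Delta> k) (longest_elt n \<circ> simple_refl n k) id (Theta_minus n f h c) =
         \<Delta> k (mat_of (ch.sl False (rev r) * ch.th c [1..int n]))"
      by (rule gen_minor_left[OF kI])
    have "gen_minor n e f (\<Delta> k) (longest_elt n \<circ> simple_refl n k) id (Theta_minus n f h c) =
        (\<Sum>j=1..k. (if j = 1 then 1 else c (int (k + 1) - int j) (j - 1)) * inverse (c (int (k + 1) - int j) j))"
      unfolding r(3) by (rule trans[OF ch.minor_left[OF nz' k r(1,2)] ch.minor_left_value[OF nz' k]])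
    also have "\<dots> = (\<Sum>j=1..k. mono_eval c (m_vec (int k - int n) (Vbar j)))"
    proof (intro sum.cong refl)
      fix j assume "j \<in> {1..k}"
      then show "(if j = 1 then 1 else c (int (k + 1) - int j) (j - 1)) * inverse (c (int (k + 1) - int j) j) =
          mono_eval c (m_vec (int k - int n) (Vbar j))"
        \<comment> \<open>Starting at superscript k - n turns k + n - j + 1 into k + 1 - j, so the
          superscripts stay within 1, ..., k.\<close>
        using k by (subst eval_Vbar[OF n emb, where p = "int (k + 1) - int j"]) (auto dest!: nz0)
    qed
    finally show ?thesis .
  qed
  show ?thesis using 1 2 3 spin by auto
qed

end
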